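(* In the setting described in the context, for every $S'\rtimes^{\beta'}_{H'}G$-module $M'$ there is a natural isomorphism of left $S$-modules \[(S\rtimes^{\beta}_HG)\otimes_{S'\rtimes^{\beta'}_{H'}G}M'\;\cong\;(S\otimes_{S'}M')_H,\] where the right-hand side denotes the coinvariants of $S\otimes_{S'}M'$ under the secret $H$-action.
   Context: Let $L$ be a commutative ring and $G$ a group. For an $L$-algebra $S$ with $G$ acting by $L$-algebra automorphisms ($s\mapsto g\cdot s$), the skew-group ring $S\rtimes G$ is the free left $S$-module on $G$ with $(sg)(s'g')=(s(g\cdot s'))(gg')$. For a normal subgroup $N$ of $G$, a $G$-equivariant trivialisation is a group homomorphism $\beta\colon N\to S^\times$ with $\beta(n)s\beta(n)^{-1}=n\cdot s$ for all $s\in S$, $n\in N$, and $\beta(gng^{-1})=g\cdot\beta(n)$ for all $g\in G$, $n\in N$; then $S\rtimes^\beta_NG:=(S\rtimes G)/(S\rtimes G)\{\beta(n)^{-1}n-1:n\in N\}$ is an associative ring (a crossed product of $S$ with $G/N$). Assume: $S,S'$ are $L$-algebras with $G$ acting on both by $L$-algebra automorphisms; $f\colon S'\to S$ is a $G$-equivariant $L$-algebra homomorphism; $H'\le H$ are normal subgroups of $G$; $\beta\colon H\to S^\times$ and $\beta'\colon H'\to S'^\times$ are $G$-equivariant trivialisations with $f(\beta'(h'))=\beta(h')$ for $h'\in H'$. Then $f$ induces a ring homomorphism $S'\rtimes^{\beta'}_{H'}G\to S\rtimes^\beta_HG$, and any $S'\rtimes^{\beta'}_{H'}G$-module $M'$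 carries a $G$-action. The secret $H$-action on $S\otimes_{S'}M'$ is the well-defined action by left $S$-linear automorphisms $h\star(s\otimes m')=s\beta(h)^{-1}\otimes h\cdot m'$; its coinvariants are $(S\otimes_{S'}M')/\langle h\star v-v\rangle$. *)

theory Defs
  imports "HOL-Algebra.Algebra"
begin

section \<open>Algebras and modules over non-commutative rings\<close>

text \<open>The library locale \<^locale>\<open>algebra\<close> requires the algebra to be commutative.\<close>

locale assoc_algebra = module + ring M +
  assumes smult_mult_left:
      "\<lbrakk>a \<in> carrier R; x \<in> carrier M; y \<in> carrier M\<rbrakk> \<Longrightarrow>
        (a \<odot>\<^bsub>M\<^esub> x) \<otimes>\<^bsub>M\<^esub> y = a \<odot>\<^bsub>M\<^esub> (x \<otimes>\<^bsub>M\<^esub> y)"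
    and smult_mult_right:
      "\<lbrakk>a \<in> carrier R; x \<in> carrier M; y \<in> carrier M\<rbrakk> \<Longrightarrow>
        x \<otimes>\<^bsub>M\<^esub> (a \<odot>\<^bsub>M\<^esub> y) = a \<odot>\<^bsub>M\<^esub> (x \<otimes>\<^bsub>M\<^esub> y)"

text \<open>
  The library locale \<^locale>\<open>module\<close> requires a commutative base ring. As in that locale, the
  fields \<^const>\<open>monoid.mult\<close> and \<^const>\<open>monoid.one\<close> of a module record carry no meaning. That
  \<open>R\<close> is a ring is deliberately not part of the predicate, so that assuming \<open>left_module R M\<close>
  imposes nothing on \<open>R\<close> itself.
\<close>

locale left_module = abelian_group M
  for R :: "('r, 'x) ring_scheme" (structure) and M :: "('r, 'm, 'y) module_scheme" (structure) +
  assumes lm_smult_closed: "\<lbrakk>a \<in> carrier R; x \<in> carrier M\<rbrakk> \<Longrightarrow> a \<odot>\<^bsub>M\<^esub> x \<in> carrier M"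
    and lm_smult_l_distr: "\<lbrakk>a \<in> carrier R; b \<in> carrier R; x \<in> carrier M\<rbrakk> \<Longrightarrow>
      (a \<oplus>\<^bsub>R\<^esub> b) \<odot>\<^bsub>M\<^esub> x = a \<odot>\<^bsub>M\<^esub> x \<oplus>\<^bsub>M\<^esub> b \<odot>\<^bsub>M\<^esub> x"
    and lm_smult_r_distr: "\<lbrakk>a \<in> carrier R; x \<in> carrier M; y \<in> carrier M\<rbrakk> \<Longrightarrow>
      a \<odot>\<^bsub>M\<^esub> (x \<oplus>\<^bsub>M\<^esub> y) = a \<odot>\<^bsub>M\<^esub> x \<oplus>\<^bsub>M\<^esub> a \<odot>\<^bsub>M\<^esub> y"
    and lm_smult_assoc: "\<lbrakk>a \<in> carrier R; b \<in> carrier R; x \<in> carrier M\<rbrakk> \<Longrightarrow>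
      (a \<otimes>\<^bsub>R\<^esub> b) \<odot>\<^bsub>M\<^esub> x = a \<odot>\<^bsub>M\<^esub> (b \<odot>\<^bsub>M\<^esub> x)"
    and lm_smult_one: "x \<in> carrier M \<Longrightarrow> \<one>\<^bsub>R\<^esub> \<odot>\<^bsub>M\<^esub> x = x"

definition left_module_hom ::
    "('r, 'x) ring_scheme \<Rightarrow> ('r, 'm) module \<Rightarrow> ('r, 'n) module \<Rightarrow> ('m \<Rightarrow> 'n) set" where
  "left_module_hom R M N =
    {h \<in> carrier M \<rightarrow> carrier N.
      (\<forall>x\<in>carrier M. \<forall>y\<in>carrier M. h (x \<oplus>\<^bsub>M\<^esub> y) = h x \<oplus>\<^bsub>N\<^esub> h y) \<and>
      (\<forall>r\<in>carrier R. \<forall>x\<in>carrier M. h (r \<odot>\<^bsub>M\<^esub> x) = r \<odot>\<^bsub>N\<^esub> h x)}"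

definition left_module_iso ::
    "('r, 'x) ring_scheme \<Rightarrow> ('r, 'm) module \<Rightarrow> ('r, 'n) module \<Rightarrow> ('m \<Rightarrow> 'n) set" where
  "left_module_iso R M N = {h \<in> left_module_hom R M N. bij_betw h (carrier M) (carrier N)}"

definition restrict_scalars :: "('s \<Rightarrow> 'r) \<Rightarrow> ('r, 'm) module \<Rightarrow> ('s, 'm) module" where
  "restrict_scalars i M =
    \<lparr>carrier = carrier M, monoid.mult = monoid.mult M, one = one M,
     ring.zero = ring.zero M, add = ring.add M,
     smult = (\<lambda>s x. i s \<odot>\<^bsub>M\<^esub> x)\<rparr>"

text \<open>
  The map into the quotient by \<open>K\<close> induced by \<open>h\<close>: if \<open>h\<close> is compatible with the quotients, all
  the cosets in the union coincide (the same device as in \<^const>\<open>rcoset_mult\<close>).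
\<close>

definition quot_map :: "('b, 'x) monoid_scheme \<Rightarrow> 'b set \<Rightarrow> ('a \<Rightarrow> 'b) \<Rightarrow> 'a set \<Rightarrow> 'b set" where
  "quot_map G K h C = (\<Union>x\<in>C. K #>\<^bsub>G\<^esub> h x)"

definition quot_module :: "('r, 'm) module \<Rightarrow> 'm set \<Rightarrow> ('r, 'm set) module" where
  "quot_module M K =
    \<lparr>carrier = a_rcosets\<^bsub>M\<^esub> K, monoid.mult = undefined, one = undefined,
     ring.zero = K, add = set_add M,
     smult = (\<lambda>r. quot_map (add_monoid M) K (\<lambda>x. r \<odot>\<^bsub>M\<^esub> x))\<rparr>"


section \<open>Tensor products over non-commutative rings\<close>

text \<open>A \<open>(T, R)\<close>-bimodule: a left \<open>T\<close>-module with an additional right multiplication by \<open>R\<close>.\<close>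

record ('t, 'a, 'r) bimodule = "('t, 'a) module" +
  rsmult :: "'a \<Rightarrow> 'r \<Rightarrow> 'a"

text \<open>
  A ring \<open>A\<close> as a \<open>(T, R)\<close>-bimodule along ring homomorphisms \<open>i\<close> from \<open>T\<close> and \<open>j\<close> from \<open>R\<close> to \<open>A\<close>.
\<close>

definition bimodule_via ::
    "('t \<Rightarrow> 'a) \<Rightarrow> ('a, 'x) ring_scheme \<Rightarrow> ('r \<Rightarrow> 'a) \<Rightarrow> ('t, 'a, 'r) bimodule" where
  "bimodule_via i A j =
    \<lparr>carrier = carrier A, monoid.mult = monoid.mult A, one = one A,
     ring.zero = ring.zero A, add = ring.add A,
     smult = (\<lambda>t x. i t \<otimes>\<^bsub>A\<^esub> x), rsmult = (\<lambda>x r. x \<otimes>\<^bsub>A\<^esub> j r)\<rparr>"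

definition tensor_relations ::
    "('r, 'x) ring_scheme \<Rightarrow> ('t, 'a, 'r) bimodule \<Rightarrow> ('r, 'b) module \<Rightarrow> (('a \<times> 'b) \<Rightarrow>\<^sub>0 int) set" where
  "tensor_relations R A B =
     {frag_of (a \<oplus>\<^bsub>A\<^esub> a', b) - frag_of (a, b) - frag_of (a', b) |
        a a' b. a \<in> carrier A \<and> a' \<in> carrier A \<and> b \<in> carrier B} \<union>
     {frag_of (a, b \<oplus>\<^bsub>B\<^esub> b') - frag_of (a, b) - frag_of (a, b') |
        a b b'. a \<in> carrier A \<and> b \<in> carrier B \<and> b' \<in> carrier B} \<union>
     {frag_of (rsmult A a r, b) - frag_of (a, r \<odot>\<^bsub>B\<^esub> b) |
        a r b. a \<in> carrier A \<and> r \<in> carrier R \<and> b \<in> carrier B}"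

definition tensor_kernel ::
    "('r, 'x) ring_scheme \<Rightarrow> ('t, 'a, 'r) bimodule \<Rightarrow> ('r, 'b) module \<Rightarrow> (('a \<times> 'b) \<Rightarrow>\<^sub>0 int) set" where
  "tensor_kernel R A B =
     generate (free_Abelian_group (carrier A \<times> carrier B)) (tensor_relations R A B)"

text \<open>
  The additive map into the tensor product of \<open>A\<close> and \<open>B\<close> over \<open>R\<close> that sends the class of
  \<open>(x, y)\<close> to the class of \<open>(u x, v y)\<close>.
\<close>

definition tensor_map ::
    "('r, 'x) ring_scheme \<Rightarrow> ('t, 'a, 'r) bimodule \<Rightarrow> ('r, 'b) module \<Rightarrow>
     ('c \<Rightarrow> 'a) \<Rightarrow> ('d \<Rightarrow> 'b) \<Rightarrow> (('c \<times> 'd) \<Rightarrow>\<^sub>0 int) set \<Rightarrow> (('a \<times> 'b) \<Rightarrow>\<^sub>0 int) set" where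
  "tensor_map R A B u v =
     quot_map (free_Abelian_group (carrier A \<times> carrier B)) (tensor_kernel R A B)
       (frag_extend (\<lambda>(x, y). frag_of (u x, v y)))"

definition tensor ::
    "('r, 'x) ring_scheme \<Rightarrow> ('t, 'a, 'r) bimodule \<Rightarrow> ('r, 'b) module \<Rightarrow>
     ('t, (('a \<times> 'b) \<Rightarrow>\<^sub>0 int) set) module" where
  "tensor R A B =
    (let Q = free_Abelian_group (carrier A \<times> carrier B) Mod tensor_kernel R A B in
      \<lparr>carrier = carrier Q, monoid.mult = undefined, one = undefined,
       ring.zero = one Q, add = monoid.mult Q,
       smult = (\<lambda>t. tensor_map R A B (\<lambda>a. t \<odot>\<^bsub>A\<^esub> a) (\<lambda>b. b))\<rparr>)"


section \<open>Skew group rings and crossed products\<close>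

locale equivariant_algebra = assoc_algebra L S + group_action G "carrier S" act
  for L :: "('l, 'x) ring_scheme" and G :: "('g, 'y) monoid_scheme"
    and S :: "('l, 's, 'z) module_scheme" and act :: "'g \<Rightarrow> 's \<Rightarrow> 's" +
  assumes act_ring_hom: "g \<in> carrier G \<Longrightarrow> act g \<in> ring_hom S S"
    and act_smult: "\<lbrakk>g \<in> carrier G; l \<in> carrier L; s \<in> carrier S\<rbrakk> \<Longrightarrow>
      act g (l \<odot>\<^bsub>S\<^esub> s) = l \<odot>\<^bsub>S\<^esub> act g s"

locale equivariant_trivialisation = normal N G
  for G :: "('g, 'y) monoid_scheme" and S :: "('s, 'x) ring_scheme"
    and act :: "'g \<Rightarrow> 's \<Rightarrow> 's" and N :: "'g set" and \<beta> :: "'g \<Rightarrow> 's" +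
  assumes triv_hom: "\<beta> \<in> hom (G\<lparr>carrier := N\<rparr>) (units_of S)"
    and triv_conj: "\<lbrakk>n \<in> N; s \<in> carrier S\<rbrakk> \<Longrightarrow> \<beta> n \<otimes>\<^bsub>S\<^esub> s \<otimes>\<^bsub>S\<^esub> inv\<^bsub>S\<^esub> \<beta> n = act n s"
    and triv_equivariant: "\<lbrakk>g \<in> carrier G; n \<in> N\<rbrakk> \<Longrightarrow>
      \<beta> (g \<otimes>\<^bsub>G\<^esub> n \<otimes>\<^bsub>G\<^esub> inv\<^bsub>G\<^esub> g) = act g (\<beta> n)"

text \<open>The monomial \<open>sg\<close>.\<close>

definition skew_single ::
    "('s, 'x) ring_scheme \<Rightarrow> ('g, 'y) monoid_scheme \<Rightarrow> 's \<Rightarrow> 'g \<Rightarrow> ('g \<Rightarrow> 's)" where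
  "skew_single S G s g = (\<lambda>k\<in>carrier G. if k = g then s else \<zero>\<^bsub>S\<^esub>)"

text \<open>
  Elements are the finitely supported coefficient functions. Collecting the terms of
  \<open>(\<Sum> a\<^sub>g g) (\<Sum> b\<^sub>h h) = \<Sum> a\<^sub>g (g \<cdot> b\<^sub>h) gh\<close> with \<open>gh = k\<close> gives the coefficient of the product at \<open>k\<close>.
\<close>

definition skew_group_ring ::
    "('s, 'x) ring_scheme \<Rightarrow> ('g, 'y) monoid_scheme \<Rightarrow> ('g \<Rightarrow> 's \<Rightarrow> 's) \<Rightarrow> ('g \<Rightarrow> 's) ring" where
  "skew_group_ring S G act =
    \<lparr>carrier = {a \<in> carrier G \<rightarrow>\<^sub>E carrier S. finite {g \<in> carrier G. a g \<noteq> \<zero>\<^bsub>S\<^esub>}},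
     monoid.mult = (\<lambda>a b. \<lambda>k\<in>carrier G.
       \<Oplus>\<^bsub>S\<^esub>g\<in>{g \<in> carrier G. a g \<noteq> \<zero>\<^bsub>S\<^esub>}. a g \<otimes>\<^bsub>S\<^esub> act g (b (inv\<^bsub>G\<^esub> g \<otimes>\<^bsub>G\<^esub> k))),
     one = skew_single S G \<one>\<^bsub>S\<^esub> \<one>\<^bsub>G\<^esub>,
     ring.zero = (\<lambda>k\<in>carrier G. \<zero>\<^bsub>S\<^esub>),
     add = (\<lambda>a b. \<lambda>k\<in>carrier G. a k \<oplus>\<^bsub>S\<^esub> b k)\<rparr>"

text \<open>The left ideal consisting of the finite sums of products \<open>a x\<close> with \<open>a \<in> A\<close> and \<open>x \<in> Y\<close>.\<close>

definition left_ideal_gen :: "('a, 'x) ring_scheme \<Rightarrow> 'a set \<Rightarrow> 'a set" where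
  "left_ideal_gen A Y = generate (add_monoid A) {a \<otimes>\<^bsub>A\<^esub> x | a x. a \<in> carrier A \<and> x \<in> Y}"

definition crossed_ideal ::
    "('s, 'x) ring_scheme \<Rightarrow> ('g, 'y) monoid_scheme \<Rightarrow> ('g \<Rightarrow> 's \<Rightarrow> 's) \<Rightarrow>
     'g set \<Rightarrow> ('g \<Rightarrow> 's) \<Rightarrow> ('g \<Rightarrow> 's) set" where
  "crossed_ideal S G act N \<beta> =
    left_ideal_gen (skew_group_ring S G act)
      {skew_single S G (inv\<^bsub>S\<^esub> \<beta> n) n \<ominus>\<^bsub>skew_group_ring S G act\<^esub> \<one>\<^bsub>skew_group_ring S G act\<^esub> |
        n. n \<in> N}"

definition crossed_product ::
    "('s, 'x) ring_scheme \<Rightarrow> ('g, 'y) monoid_scheme \<Rightarrow> ('g \<Rightarrow> 's \<Rightarrow> 's) \<Rightarrow>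
     'g set \<Rightarrow> ('g \<Rightarrow> 's) \<Rightarrow> ('g \<Rightarrow> 's) set ring" where
  "crossed_product S G act N \<beta> = skew_group_ring S G act Quot crossed_ideal S G act N \<beta>"

text \<open>The class of the monomial \<open>sg\<close>.\<close>

definition crossed_single ::
    "('s, 'x) ring_scheme \<Rightarrow> ('g, 'y) monoid_scheme \<Rightarrow> ('g \<Rightarrow> 's \<Rightarrow> 's) \<Rightarrow>
     'g set \<Rightarrow> ('g \<Rightarrow> 's) \<Rightarrow> 's \<Rightarrow> 'g \<Rightarrow> ('g \<Rightarrow> 's) set" where
  "crossed_single S G act N \<beta> s g =
    crossed_ideal S G act N \<beta> +>\<^bsub>skew_group_ring S G act\<^esub> skew_single S G s g"

text \<open>
  The map \<open>sg \<mapsto> f(s)g\<close> from some crossed product into the crossed product determined by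
  \<open>S\<close>, \<open>G\<close>, \<open>act\<close>, \<open>N\<close>, \<open>\<beta>\<close>.
\<close>

definition crossed_map ::
    "('s, 'x) ring_scheme \<Rightarrow> ('g, 'y) monoid_scheme \<Rightarrow> ('g \<Rightarrow> 's \<Rightarrow> 's) \<Rightarrow>
     'g set \<Rightarrow> ('g \<Rightarrow> 's) \<Rightarrow> ('t \<Rightarrow> 's) \<Rightarrow> ('g \<Rightarrow> 't) set \<Rightarrow> ('g \<Rightarrow> 's) set" where
  "crossed_map S G act N \<beta> f =
    quot_map (add_monoid (skew_group_ring S G act)) (crossed_ideal S G act N \<beta>)
      (\<lambda>a. \<lambda>g\<in>carrier G. f (a g))"


section \<open>The two functors\<close>

text \<open>
  Throughout, primed data (\<open>S'\<close>, \<open>act'\<close>, \<open>H'\<close>, \<open>\<beta>'\<close>) belong to the source of \<open>f\<close>, and \<open>M\<close> is a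
  module over the primed crossed product.
\<close>

definition crossed_bimodule ::
    "('s, 'x) ring_scheme \<Rightarrow> ('g, 'y) monoid_scheme \<Rightarrow> ('g \<Rightarrow> 's \<Rightarrow> 's) \<Rightarrow>
     'g set \<Rightarrow> ('g \<Rightarrow> 's) \<Rightarrow> ('t \<Rightarrow> 's) \<Rightarrow> ('s, ('g \<Rightarrow> 's) set, ('g \<Rightarrow> 't) set) bimodule" where
  "crossed_bimodule S G act H \<beta> f =
    bimodule_via (\<lambda>s. crossed_single S G act H \<beta> s \<one>\<^bsub>G\<^esub>)
      (crossed_product S G act H \<beta>) (crossed_map S G act H \<beta> f)"

definition crossed_induced where
  "crossed_induced G S' act' H' \<beta>' S act H \<beta> f M =
    tensor (crossed_product S' G act' H' \<beta>') (crossed_bimodule S G act H \<beta> f) M"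

text \<open>The maps \<open>id \<otimes> \<phi>\<close>, for a homomorphism \<open>\<phi>\<close> with target \<open>N\<close>.\<close>

definition crossed_induced_map where
  "crossed_induced_map G S' act' H' \<beta>' S act H \<beta> f N \<phi> =
    tensor_map (crossed_product S' G act' H' \<beta>') (crossed_bimodule S G act H \<beta> f) N (\<lambda>x. x) \<phi>"

definition base_change where
  "base_change G S' act' H' \<beta>' S f M =
    tensor S' (bimodule_via (\<lambda>s. s) S f)
      (restrict_scalars (\<lambda>s. crossed_single S' G act' H' \<beta>' s \<one>\<^bsub>G\<^esub>) M)"

definition base_change_map where
  "base_change_map G S' act' H' \<beta>' S f N u \<phi> =
    tensor_map S' (bimodule_via (\<lambda>s. s) S f)
      (restrict_scalars (\<lambda>s. crossed_single S' G act' H' \<beta>' s \<one>\<^bsub>G\<^esub>) N) u \<phi>"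

text \<open>
  \<open>h \<star> (s \<otimes> m) = s \<beta>(h)\<^sup>-\<^sup>1 \<otimes> h \<cdot> m\<close>, where \<open>h\<close> acts on \<open>m\<close> as the class of \<open>1h\<close> in the crossed
  product over \<open>S'\<close>.
\<close>

definition secret_action where
  "secret_action G S' act' H' \<beta>' S \<beta> f M h =
    base_change_map G S' act' H' \<beta>' S f M
      (\<lambda>s. s \<otimes>\<^bsub>S\<^esub> inv\<^bsub>S\<^esub> \<beta> h)
      (\<lambda>m. crossed_single S' G act' H' \<beta>' \<one>\<^bsub>S'\<^esub> h \<odot>\<^bsub>M\<^esub> m)"

definition coinvariants_kernel :: "('r, 'v) module \<Rightarrow> 'g set \<Rightarrow> ('g \<Rightarrow> 'v \<Rightarrow> 'v) \<Rightarrow> 'v set" where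
  "coinvariants_kernel V H act =
    generate (add_monoid V) {act h v \<ominus>\<^bsub>V\<^esub> v | h v. h \<in> H \<and> v \<in> carrier V}"

definition secret_coinvariants where
  "secret_coinvariants G S' act' H' \<beta>' S H \<beta> f M =
    (let V = base_change G S' act' H' \<beta>' S f M in
      quot_module V (coinvariants_kernel V H (secret_action G S' act' H' \<beta>' S \<beta> f M)))"

text \<open>The map on coinvariants induced by \<open>id \<otimes> \<phi>\<close>, for a homomorphism \<open>\<phi>\<close> with target \<open>N\<close>.\<close>

definition secret_coinvariants_map where
  "secret_coinvariants_map G S' act' H' \<beta>' S H \<beta> f N \<phi> =
    (let V = base_change G S' act' H' \<beta>' S f N in
      quot_map (add_monoid V)
        (coinvariants_kernel V H (secret_action G S' act' H' \<beta>' S \<beta> f N))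
        (base_change_map G S' act' H' \<beta>' S f N (\<lambda>s. s) \<phi>))"

end

theory Submission
  imports Defs
begin

text \<open>
  Both sides are generated by monomials, and the isomorphism is the unique additive map with
  \<open>sg \<otimes> m \<mapsto> [s \<otimes> g \<cdot> m]\<close>; its inverse is \<open>[s \<otimes> m] \<mapsto> s1 \<otimes> m\<close>. The first map descends to the crossed
  product because multiplying \<open>sg\<close> on the right by \<open>\<beta>(n)\<^sup>-\<^sup>1 n\<close> gives \<open>s \<beta>(n')\<^sup>-\<^sup>1 n' g\<close> with \<open>n' = gng\<^sup>-\<^sup>1\<close>,
  so its value changes from \<open>[v]\<close> to \<open>[n' \<star> v]\<close>. The second descends to the coinvariants because
  \<open>\<beta>(h)\<^sup>-\<^sup>1 h = 1\<close> in the crossed product. All identities between additive maps, including the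
  associativity of the skew group ring, are checked on monomials.
\<close>

section \<open>Quotients of groups\<close>

text \<open>\<open>S\<close> may be non-commutative, so factors
  \<open>\<beta>(n)\<^sup>-\<^sup>1\<close> have to be moved past scalars. The rule
  \<open>\<beta>(n)\<^sup>-\<^sup>1 (n \<cdot> s) = s \<beta>(n)\<^sup>-\<^sup>1\<close>, a
  rewriting of the conjugation axiom, does this. Together with equivariance it makes the left ideal
  that defines the crossed product two-sided, and it makes the secret action well defined: right
  multiplication by \<open>\<beta>(h)\<^sup>-\<^sup>1\<close> and the action of \<open>h\<close> are
  only semilinear over \<open>S'\<close>, but both twist a scalar \<open>r\<close> into
  \<open>h \<cdot> r\<close>, and the twists match in the tensor product. The elements on both sides
  are cosets, so the comparison map and its inverse come from universal properties, are known by
  their values on generators only, and are chosen separately for each module. The values on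
  monomials are therefore carried along with the isomorphism: they determine it, and naturality of
  the chosen family follows from them. The conditions \<open>H' \<subseteq> H\<close> and
  \<open>f (\<beta>' h) = \<beta> h\<close> enter through the ring homomorphism between the crossed
  products, which turns the larger one into a right module.\<close>

lemma hom_eq_on_generate:
  assumes "group G" "group H" "h \<in> hom G H" "k \<in> hom G H" "E \<subseteq> carrier G"
    and eq: "\<And>x. x \<in> E \<Longrightarrow> h x = k x" and "x \<in> generate G E"
  shows "h x = k x"
proof -
  interpret h: group_hom G H h using assms by (simp add: group_hom_def group_hom_axioms_def)
  interpret k: group_hom G H k using assms by (simp add: group_hom_def group_hom_axioms_def)
  from \<open>x \<in> generate G E\<close> show ?thesis
  proof (induction rule: generate.induct)
    case (inv y)
    then show ?case using eq \<open>E \<subseteq> carrier G\<close> by auto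
  next
    case (eng y z)
    then show ?case using h.G.generate_in_carrier[OF \<open>E \<subseteq> carrier G\<close>] by auto
  qed (use eq in auto)
qed

text \<open>The image of a generated subgroup is generated by the images of the generators. Tensor
  relations, crossed ideal and coinvariants are all given by generators, and maps out of their
  quotients are shown to be well defined through this lemma.\<close>

lemma hom_generate_subset:
  assumes "group G" "group H" "h \<in> hom G H" "E \<subseteq> carrier G" "subgroup K H"
    and "\<And>x. x \<in> E \<Longrightarrow> h x \<in> K"
  shows "h ` generate G E \<subseteq> K"
proof -
  interpret h: group_hom G H h using assms by (simp add: group_hom_def group_hom_axioms_def)
  show ?thesis
    unfolding h.generate_img[OF \<open>E \<subseteq> carrier G\<close>, symmetric]
    by (rule h.H.generate_subgroup_incl) (use assms in auto)
qed

text \<open>Changing the representative multiplies \<open>h x\<close> by an element of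
  \<open>N\<close>, so the union that defines \<open>quot_map\<close> runs over copies of a single
  coset.\<close>

lemma quot_map_r_coset:
  assumes N': "N' \<lhd> G'" and N: "N \<lhd> G" and h: "h \<in> hom G' G" and sub: "h ` N' \<subseteq> N"
    and x: "x \<in> carrier G'"
  shows "quot_map G N h (N' #>\<^bsub>G'\<^esub> x) = N #>\<^bsub>G\<^esub> h x"
proof -
  interpret N': normal N' G' by fact
  interpret N: normal N G by fact
  have "N #>\<^bsub>G\<^esub> h (n \<otimes>\<^bsub>G'\<^esub> x) = N #>\<^bsub>G\<^esub> h x" if "n \<in> N'" for n
  proof -
    have "h n \<in> N" using that sub by auto
    moreover have "h (n \<otimes>\<^bsub>G'\<^esub> x) = h n \<otimes>\<^bsub>G\<^esub> h x"
      using h that x N'.subset by (auto simp: hom_def)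
    ultimately show ?thesis
      using N.coset_mult_assoc[OF N.subset, of "h n" "h x"] N.coset_join2[OF _ N.subgroup_axioms, of "h n"]
        hom_in_carrier[OF h x] N.subset by auto
  qed
  moreover have "N' #>\<^bsub>G'\<^esub> x = (\<lambda>n. n \<otimes>\<^bsub>G'\<^esub> x) ` N'"
    by (auto simp: r_coset_def)
  ultimately have "quot_map G N h (N' #>\<^bsub>G'\<^esub> x) = (\<Union>n\<in>N'. N #>\<^bsub>G\<^esub> h x)"
    by (simp add: quot_map_def)
  \<comment> \<open>A union over an empty index set would be empty instead of being the
    coset.\<close>
  moreover have "N' \<noteq> {}" using subgroup.one_closed[OF N'.subgroup_axioms] by blast
  ultimately show ?thesis by (simp only: UN_constant if_False)
qed

lemma quot_map_hom:
  assumes N': "N' \<lhd> G'" and N: "N \<lhd> G" and h: "h \<in> hom G' G" and sub: "h ` N' \<subseteq> N"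
  shows "quot_map G N h \<in> hom (G' Mod N') (G Mod N)"
proof (rule homI)
  interpret N': normal N' G' by fact
  interpret N: normal N G by fact
  note q = quot_map_r_coset[OF N' N h sub]
  note hc = hom_in_carrier[OF h]
  fix C assume "C \<in> carrier (G' Mod N')"
  then obtain x where x: "x \<in> carrier G'" "C = N' #>\<^bsub>G'\<^esub> x"
    by (auto simp: FactGroup_def RCOSETS_def)
  show "quot_map G N h C \<in> carrier (G Mod N)"
    using x hc[of x] by (auto simp: q FactGroup_def RCOSETS_def)
  fix D assume "D \<in> carrier (G' Mod N')"
  then obtain y where y: "y \<in> carrier G'" "D = N' #>\<^bsub>G'\<^esub> y"
    by (auto simp: FactGroup_def RCOSETS_def)
  show "quot_map G N h (C \<otimes>\<^bsub>G' Mod N'\<^esub> D) = quot_map G N h C \<otimes>\<^bsub>G Mod N\<^esub> quot_map G N h D"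
    using x y hc[of x] hc[of y] hom_mult[OF h, of x y] by (simp add: q FactGroup_def N'.rcos_sum N.rcos_sum)
qed

text \<open>Vanishing on \<open>N\<close> makes \<open>h\<close> constant on cosets, which is the
  hypothesis of \<open>FactGroup_universal\<close>.\<close>

lemma quot_factor:
  assumes N: "N \<lhd> G" and D: "group D" and h: "h \<in> hom G D" and ker: "\<And>n. n \<in> N \<Longrightarrow> h n = \<one>\<^bsub>D\<^esub>"
  obtains k where "k \<in> hom (G Mod N) D" "\<And>x. x \<in> carrier G \<Longrightarrow> k (N #>\<^bsub>G\<^esub> x) = h x"
proof -
  interpret N: normal N G by fact
  interpret h: group_hom G D h using D h N.is_group by (simp add: group_hom_def group_hom_axioms_def)
  have eq: "h x = h y" if "x \<in> carrier G" "y \<in> carrier G" "N #>\<^bsub>G\<^esub> x = N #>\<^bsub>G\<^esub> y" for x y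
  proof -
    have "x \<in> N #>\<^bsub>G\<^esub> y" using that N.rcos_self[OF _ N.subgroup_axioms, of x] by simp
    then obtain n where "n \<in> N" "x = n \<otimes>\<^bsub>G\<^esub> y" by (auto simp: r_coset_def)
    then show ?thesis using ker[of n] that N.subset by auto
  qed
  from FactGroup_universal[OF h N, OF eq] that show ?thesis by blast
qed

lemma quot_generate:
  assumes N: "N \<lhd> G" and E: "E \<subseteq> carrier G" and gen: "carrier G = generate G E"
  shows "carrier (G Mod N) = generate (G Mod N) ((\<lambda>x. N #>\<^bsub>G\<^esub> x) ` E)"
proof -
  interpret N: normal N G by fact
  interpret group_hom G "G Mod N" "(#>\<^bsub>G\<^esub>) N"
    using N.is_group N.factorgroup_is_group N.r_coset_hom_Mod
    by (simp add: group_hom_def group_hom_axioms_def)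
  have "carrier (G Mod N) = (#>\<^bsub>G\<^esub>) N ` carrier G"
    by (auto simp: FactGroup_def RCOSETS_def)
  then show ?thesis using generate_img[OF E] gen by simp
qed

text \<open>
  The additive monoid of a module record keeps an unspecified record extension, so it is not equal
  to the quotient group from which the module is built; the two only agree in their fields.
\<close>

lemma comm_group_cong:
  assumes "comm_group G" "carrier D = carrier G" "monoid.mult D = monoid.mult G" "one D = one G"
  shows "comm_group D"
proof -
  interpret comm_group G by fact
  show ?thesis
    by (rule comm_groupI) (use assms in \<open>auto simp: m_assoc intro: m_comm l_inv_ex\<close>)
qed

text \<open>\<open>m_inv\<close> is determined by these three fields, so both inductive closures
  have the same rules.\<close>

lemma generate_cong:
  assumes "carrier D = carrier G" "monoid.mult D = monoid.mult G" "one D = one G"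
  shows "generate D E = generate G E"
proof -
  have "m_inv D = m_inv G" using assms by (simp add: m_inv_def fun_eq_iff)
  note eqs = this assms
  have "x \<in> generate G E" if "x \<in> generate D E" for x
    using that by induction (simp_all add: eqs generate.intros)
  moreover have "x \<in> generate D E" if "x \<in> generate G E" for x
    using that by induction (simp_all add: eqs[symmetric] generate.intros)
  ultimately show ?thesis by blast
qed

section \<open>Tensor products\<close>

definition pure_tensor ::
    "('r, 'x) ring_scheme \<Rightarrow> ('t, 'a, 'r) bimodule \<Rightarrow> ('r, 'b) module \<Rightarrow> 'a \<Rightarrow> 'b \<Rightarrow> (('a \<times> 'b) \<Rightarrow>\<^sub>0 int) set"
  where "pure_tensor R A B a b =
    tensor_kernel R A B #>\<^bsub>free_Abelian_group (carrier A \<times> carrier B)\<^esub> frag_of (a, b)"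

lemma tensor_simps:
  "carrier (tensor R A B) = carrier (free_Abelian_group (carrier A \<times> carrier B) Mod tensor_kernel R A B)"
  "add (tensor R A B) = monoid.mult (free_Abelian_group (carrier A \<times> carrier B) Mod tensor_kernel R A B)"
  "ring.zero (tensor R A B) = one (free_Abelian_group (carrier A \<times> carrier B) Mod tensor_kernel R A B)"
  "smult (tensor R A B) = (\<lambda>t. tensor_map R A B (\<lambda>a. t \<odot>\<^bsub>A\<^esub> a) (\<lambda>b. b))"
  by (simp_all add: tensor_def Let_def)

text \<open>\<open>hom\<close> reads only \<open>carrier\<close> and \<open>mult\<close>, so facts
  about the quotient of the free group apply to the tensor record whatever its extension field
  is.\<close>

lemma hom_tensor:
  "hom (add_monoid (tensor R A B)) D = hom (free_Abelian_group (carrier A \<times> carrier B) Mod tensor_kernel R A B) D"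
  "hom D (add_monoid (tensor R A B)) = hom D (free_Abelian_group (carrier A \<times> carrier B) Mod tensor_kernel R A B)"
  by (simp_all add: hom_def tensor_simps)

text \<open>The additive part of the tensor product. Closure of the two scalar multiplications puts
  the balancing relations into the free group; left scalars are added in
  \<open>tensor_bimodule\<close>.\<close>

locale tensor_pair = A: abelian_group A + B: abelian_group B
  for R :: "('r, 'x) ring_scheme" and A :: "('t, 'a, 'r) bimodule" and B :: "('r, 'b) module" +
  assumes rsmult_closed: "\<lbrakk>a \<in> carrier A; r \<in> carrier R\<rbrakk> \<Longrightarrow> rsmult A a r \<in> carrier A"
    and smult_closed: "\<lbrakk>r \<in> carrier R; b \<in> carrier B\<rbrakk> \<Longrightarrow> r \<odot>\<^bsub>B\<^esub> b \<in> carrier B"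
begin

abbreviation F where "F \<equiv> free_Abelian_group (carrier A \<times> carrier B)"
abbreviation K where "K \<equiv> tensor_kernel R A B"
abbreviation T where "T \<equiv> tensor R A B"
abbreviation pure where "pure \<equiv> pure_tensor R A B"

lemma frag_of_F: "\<lbrakk>a \<in> carrier A; b \<in> carrier B\<rbrakk> \<Longrightarrow> frag_of (a, b) \<in> carrier F"
  by simp

lemma diff_F: "\<lbrakk>x \<in> carrier F; y \<in> carrier F\<rbrakk> \<Longrightarrow> x - y \<in> carrier F"
  using keys_diff[of x y] by auto

lemma add_F: "\<lbrakk>x \<in> carrier F; y \<in> carrier F\<rbrakk> \<Longrightarrow> x + y \<in> carrier F"
  using keys_add[of x y] by auto

lemma relations_carrier: "tensor_relations R A B \<subseteq> carrier F"
  unfolding tensor_relations_def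
  by (intro Un_least; safe; intro diff_F frag_of_F) (auto simp: rsmult_closed smult_closed)

lemma subgroup_kernel: "subgroup K F"
  unfolding tensor_kernel_def by (rule group.generate_is_subgroup) (simp_all add: relations_carrier del: carrier_free_Abelian_group_iff)

lemma normal_kernel: "K \<lhd> F"
  by (rule comm_group.subgroup_imp_normal[OF abelian_free_Abelian_group subgroup_kernel])

lemma abelian_group_tensor: "abelian_group T"
  by (rule comm_group_abelian_groupI,
      rule comm_group_cong[OF comm_group.abelian_FactGroup[OF abelian_free_Abelian_group subgroup_kernel]])
    (simp_all add: tensor_simps)

sublocale T: abelian_group T by (rule abelian_group_tensor)

lemma coset_hom: "(\<lambda>x. K #>\<^bsub>F\<^esub> x) \<in> hom F (add_monoid T)"
  unfolding hom_tensor by (rule normal.r_coset_hom_Mod[OF normal_kernel])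

lemma pure_closed: "\<lbrakk>a \<in> carrier A; b \<in> carrier B\<rbrakk> \<Longrightarrow> pure a b \<in> carrier T"
  using hom_in_carrier[OF coset_hom, of "frag_of (a, b)"] by (simp add: pure_tensor_def)

lemma coset_eqI:
  assumes "x \<in> carrier F" "y \<in> carrier F" "x - y \<in> K"
  shows "K #>\<^bsub>F\<^esub> x = K #>\<^bsub>F\<^esub> y"
proof -
  interpret normal K F by (rule normal_kernel)
  have "x \<in> K #>\<^bsub>F\<^esub> y"
    unfolding r_coset_def using assms(3) by (auto intro!: bexI[of _ "x - y"])
  then show ?thesis
    using repr_independence[OF _ _ subgroup_kernel] assms(2) by metis
qed

lemma relation_kernel: "x \<in> tensor_relations R A B \<Longrightarrow> x \<in> K"
  by (simp add: tensor_kernel_def generate.incl)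

lemma kernel_add_left:
  assumes "a \<in> carrier A" "a' \<in> carrier A" "b \<in> carrier B"
  shows "frag_of (a \<oplus>\<^bsub>A\<^esub> a', b) - frag_of (a, b) - frag_of (a', b) \<in> K"
  by (rule relation_kernel) (use assms in \<open>unfold tensor_relations_def, blast\<close>)

lemma kernel_add_right:
  assumes "a \<in> carrier A" "b \<in> carrier B" "b' \<in> carrier B"
  shows "frag_of (a, b \<oplus>\<^bsub>B\<^esub> b') - frag_of (a, b) - frag_of (a, b') \<in> K"
  by (rule relation_kernel) (use assms in \<open>unfold tensor_relations_def, blast\<close>)

lemma pure_add_left:
  assumes "a \<in> carrier A" "a' \<in> carrier A" "b \<in> carrier B"
  shows "pure (a \<oplus>\<^bsub>A\<^esub> a') b = pure a b \<oplus>\<^bsub>T\<^esub> pure a' b"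
proof -
  have "pure a b \<oplus>\<^bsub>T\<^esub> pure a' b = K #>\<^bsub>F\<^esub> (frag_of (a, b) + frag_of (a', b))"
    using hom_mult[OF coset_hom, of "frag_of (a, b)" "frag_of (a', b)"] assms by (simp add: pure_tensor_def)
  moreover have "frag_of (a \<oplus>\<^bsub>A\<^esub> a', b) - (frag_of (a, b) + frag_of (a', b)) \<in> K"
    using kernel_add_left[OF assms] by (simp add: diff_diff_eq)
  moreover have "frag_of (a, b) + frag_of (a', b) \<in> carrier F"
    using assms by (intro add_F frag_of_F)
  ultimately show ?thesis
    using coset_eqI[of "frag_of (a \<oplus>\<^bsub>A\<^esub> a', b)"] assms
    by (simp add: pure_tensor_def del: carrier_free_Abelian_group_iff)
qed

lemma pure_add_right:
  assumes "a \<in> carrier A" "b \<in> carrier B" "b' \<in> carrier B"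
  shows "pure a (b \<oplus>\<^bsub>B\<^esub> b') = pure a b \<oplus>\<^bsub>T\<^esub> pure a b'"
proof -
  have "pure a b \<oplus>\<^bsub>T\<^esub> pure a b' = K #>\<^bsub>F\<^esub> (frag_of (a, b) + frag_of (a, b'))"
    using hom_mult[OF coset_hom, of "frag_of (a, b)" "frag_of (a, b')"] assms by (simp add: pure_tensor_def)
  moreover have "frag_of (a, b \<oplus>\<^bsub>B\<^esub> b') - (frag_of (a, b) + frag_of (a, b')) \<in> K"
    using kernel_add_right[OF assms] by (simp add: diff_diff_eq)
  moreover have "frag_of (a, b) + frag_of (a, b') \<in> carrier F"
    using assms by (intro add_F frag_of_F)
  ultimately show ?thesis
    using coset_eqI[of "frag_of (a, b \<oplus>\<^bsub>B\<^esub> b')"] assms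
    by (simp add: pure_tensor_def del: carrier_free_Abelian_group_iff)
qed

lemma pure_balanced:
  assumes "a \<in> carrier A" "r \<in> carrier R" "b \<in> carrier B"
  shows "pure (rsmult A a r) b = pure a (r \<odot>\<^bsub>B\<^esub> b)"
proof -
  have "frag_of (rsmult A a r, b) - frag_of (a, r \<odot>\<^bsub>B\<^esub> b) \<in> K"
    by (rule relation_kernel) (use assms in \<open>unfold tensor_relations_def, blast\<close>)
  then show ?thesis
    unfolding pure_tensor_def
    by (intro coset_eqI) (use assms rsmult_closed smult_closed in auto)
qed

lemma pure_hom_left: "b \<in> carrier B \<Longrightarrow> (\<lambda>a. pure a b) \<in> hom (add_monoid A) (add_monoid T)"
  by (auto simp: hom_def pure_closed pure_add_left)

lemma F_generated: "carrier F = generate F (frag_of ` (carrier A \<times> carrier B))"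
proof -
  interpret F: comm_group F by (rule abelian_free_Abelian_group)
  have gen: "subgroup (generate F (frag_of ` (carrier A \<times> carrier B))) F"
    by (rule F.generate_is_subgroup) auto
  have "x \<in> generate F (frag_of ` (carrier A \<times> carrier B))" if "x \<in> carrier F" for x
  proof (rule free_Abelian_group_induct[of x "carrier A \<times> carrier B"], goal_cases)
    case 2 then show ?case using subgroup.one_closed[OF gen] by simp
  next
    \<comment> \<open>The induction rule closes under differences \<open>x - y\<close>; in the group
      \<open>F\<close> this is multiplication by the inverse \<open>- y\<close>.\<close>
    case (3 x y)
    have "- y \<in> generate F (frag_of ` (carrier A \<times> carrier B))"
      using subgroup.m_inv_closed[OF gen 3(4)] 3(2) by simp
    from subgroup.m_closed[OF gen 3(3) this] show ?case by simp
  qed (use that in \<open>auto intro: generate.incl\<close>)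
  then show ?thesis using subgroup.subset[OF gen] by blast
qed

lemma tensor_generated:
  "carrier T = generate (add_monoid T) {pure a b | a b. a \<in> carrier A \<and> b \<in> carrier B}"
proof -
  have "(\<lambda>x. K #>\<^bsub>F\<^esub> x) ` frag_of ` (carrier A \<times> carrier B)
      = {pure a b | a b. a \<in> carrier A \<and> b \<in> carrier B}"
    by (auto simp: pure_tensor_def image_iff)
  then show ?thesis
    using quot_generate[OF normal_kernel _ F_generated]
      generate_cong[of "add_monoid T" "F Mod K"]
    by (simp add: tensor_simps image_subset_iff)
qed

text \<open>Generation is used twice: pure tensors generate \<open>T\<close>, and for fixed
  \<open>b\<close> additivity in the left slot reduces \<open>a\<close> to a generating set
  \<open>E\<close> of \<open>A\<close>. The set \<open>E\<close> is left open so that monomials of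
  the crossed product can be inserted.\<close>

lemma tensor_hom_eqI:
  assumes D: "group D" and hk: "h \<in> hom (add_monoid T) D" "k \<in> hom (add_monoid T) D"
    and E: "E \<subseteq> carrier A" "carrier A = generate (add_monoid A) E"
    and eq: "\<And>a b. \<lbrakk>a \<in> E; b \<in> carrier B\<rbrakk> \<Longrightarrow> h (pure a b) = k (pure a b)"
    and x: "x \<in> carrier T"
  shows "h x = k x"
proof (rule hom_eq_on_generate[OF T.a_group D hk])
  show "x \<in> generate (add_monoid T) {pure a b | a b. a \<in> carrier A \<and> b \<in> carrier B}"
    using x tensor_generated by simp
  show "{pure a b |a b. a \<in> carrier A \<and> b \<in> carrier B} \<subseteq> carrier (add_monoid T)"
    by (auto simp: pure_closed)
  fix y assume "y \<in> {pure a b |a b. a \<in> carrier A \<and> b \<in> carrier B}"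
  then obtain a b where y: "y = pure a b" "a \<in> carrier A" "b \<in> carrier B" by blast
  have "(h \<circ> (\<lambda>a. pure a b)) a = (k \<circ> (\<lambda>a. pure a b)) a"
  proof (rule hom_eq_on_generate[OF A.a_group D])
    show "h \<circ> (\<lambda>a. pure a b) \<in> hom (add_monoid A) D" "k \<circ> (\<lambda>a. pure a b) \<in> hom (add_monoid A) D"
      by (rule hom_compose[OF pure_hom_left[OF y(3)]], fact hk)+
  qed (use E y eq in auto)
  then show "h y = k y" by (simp add: y)
qed

lemma tensor_hom_eqI':
  assumes D: "group D" and hk: "h \<in> hom (add_monoid T) D" "k \<in> hom (add_monoid T) D"
    and eq: "\<And>a b. \<lbrakk>a \<in> carrier A; b \<in> carrier B\<rbrakk> \<Longrightarrow> h (pure a b) = k (pure a b)"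
    and x: "x \<in> carrier T"
  shows "h x = k x"
proof (rule tensor_hom_eqI[OF D hk _ _ eq x])
  show "carrier A = generate (add_monoid A) (carrier A)"
    using A.a_group by (metis group.generate_incl generate.incl
      partial_object.select_convs(1) subset_antisym subset_iff)
qed auto

text \<open>Biadditivity and balance say that the extension of \<open>\<phi>\<close> to the free
  group kills the three families of relations, so it factors through \<open>T\<close>.\<close>

lemma tensor_lift:
  assumes D: "comm_group D"
    and closed: "\<And>a b. \<lbrakk>a \<in> carrier A; b \<in> carrier B\<rbrakk> \<Longrightarrow> \<phi> a b \<in> carrier D"
    and add_left: "\<And>a a' b. \<lbrakk>a \<in> carrier A; a' \<in> carrier A; b \<in> carrier B\<rbrakk> \<Longrightarrow>
      \<phi> (a \<oplus>\<^bsub>A\<^esub> a') b = \<phi> a b \<otimes>\<^bsub>D\<^esub> \<phi> a' b"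
    and add_right: "\<And>a b b'. \<lbrakk>a \<in> carrier A; b \<in> carrier B; b' \<in> carrier B\<rbrakk> \<Longrightarrow>
      \<phi> a (b \<oplus>\<^bsub>B\<^esub> b') = \<phi> a b \<otimes>\<^bsub>D\<^esub> \<phi> a b'"
    and balanced: "\<And>a r b. \<lbrakk>a \<in> carrier A; r \<in> carrier R; b \<in> carrier B\<rbrakk> \<Longrightarrow>
      \<phi> (rsmult A a r) b = \<phi> a (r \<odot>\<^bsub>B\<^esub> b)"
  obtains h where "h \<in> hom (add_monoid T) D"
    "\<And>a b. \<lbrakk>a \<in> carrier A; b \<in> carrier B\<rbrakk> \<Longrightarrow> h (pure a b) = \<phi> a b"
proof -
  interpret D: comm_group D by fact
  interpret F: comm_group F by (rule abelian_free_Abelian_group)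
  obtain h where h: "h \<in> hom F D" and
    "\<And>x. x \<in> carrier A \<times> carrier B \<Longrightarrow> h (frag_of x) = case_prod \<phi> x"
    by (rule D.free_Abelian_group_universal[of "case_prod \<phi>" "carrier A \<times> carrier B"])
      (use closed in auto)
  then have hp: "h (frag_of (a, b)) = \<phi> a b" if "a \<in> carrier A" "b \<in> carrier B" for a b
    using that by auto
  interpret h: group_hom F D h
    by (simp add: group_hom_def group_hom_axioms_def h)
  have h_diff: "h (x - y) = h x \<otimes>\<^bsub>D\<^esub> inv\<^bsub>D\<^esub> h y" if xy: "x \<in> carrier F" "y \<in> carrier F" for x y
  proof -
    have "x - y = x \<otimes>\<^bsub>F\<^esub> inv\<^bsub>F\<^esub> y" using xy by simp
    then show ?thesis using xy h.hom_mult h.hom_inv by (metis F.inv_closed)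
  qed
  \<comment> \<open>The value of \<open>h\<close> at an additivity relation has this shape, with the
    sum already expanded; it is trivial because \<open>D\<close> is commutative.\<close>
  have cancel: "p \<otimes>\<^bsub>D\<^esub> q \<otimes>\<^bsub>D\<^esub> inv\<^bsub>D\<^esub> p \<otimes>\<^bsub>D\<^esub> inv\<^bsub>D\<^esub> q = \<one>\<^bsub>D\<^esub>" if "p \<in> carrier D" "q \<in> carrier D" for p q
  proof -
    have "p \<otimes>\<^bsub>D\<^esub> q \<otimes>\<^bsub>D\<^esub> inv\<^bsub>D\<^esub> p \<otimes>\<^bsub>D\<^esub> inv\<^bsub>D\<^esub> q = (p \<otimes>\<^bsub>D\<^esub> q) \<otimes>\<^bsub>D\<^esub> inv\<^bsub>D\<^esub> (p \<otimes>\<^bsub>D\<^esub> q)"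
      using that by (simp add: D.inv_mult D.m_assoc)
    then show ?thesis using that by simp
  qed
  have "h x = \<one>\<^bsub>D\<^esub>" if "x \<in> tensor_relations R A B" for x
    using that unfolding tensor_relations_def
  proof (elim UnE CollectE exE conjE)
    fix a a' b assume *: "x = frag_of (a \<oplus>\<^bsub>A\<^esub> a', b) - frag_of (a, b) - frag_of (a', b)"
      "a \<in> carrier A" "a' \<in> carrier A" "b \<in> carrier B"
    then have "h x = h (frag_of (a \<oplus>\<^bsub>A\<^esub> a', b)) \<otimes>\<^bsub>D\<^esub> inv\<^bsub>D\<^esub> h (frag_of (a, b)) \<otimes>\<^bsub>D\<^esub> inv\<^bsub>D\<^esub> h (frag_of (a', b))"
      using h_diff diff_F frag_of_F by (metis A.add.m_closed)
    then show ?thesis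
      using * closed by (simp add: hp add_left cancel)
  next
    fix a b b' assume *: "x = frag_of (a, b \<oplus>\<^bsub>B\<^esub> b') - frag_of (a, b) - frag_of (a, b')"
      "a \<in> carrier A" "b \<in> carrier B" "b' \<in> carrier B"
    then have "h x = h (frag_of (a, b \<oplus>\<^bsub>B\<^esub> b')) \<otimes>\<^bsub>D\<^esub> inv\<^bsub>D\<^esub> h (frag_of (a, b)) \<otimes>\<^bsub>D\<^esub> inv\<^bsub>D\<^esub> h (frag_of (a, b'))"
      using h_diff diff_F frag_of_F by (metis B.add.m_closed)
    then show ?thesis
      using * closed by (simp add: hp add_right cancel)
  next
    fix a r b assume *: "x = frag_of (rsmult A a r, b) - frag_of (a, r \<odot>\<^bsub>B\<^esub> b)"
      "a \<in> carrier A" "r \<in> carrier R" "b \<in> carrier B"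
    then have "h x = h (frag_of (rsmult A a r, b)) \<otimes>\<^bsub>D\<^esub> inv\<^bsub>D\<^esub> h (frag_of (a, r \<odot>\<^bsub>B\<^esub> b))"
      using h_diff frag_of_F rsmult_closed smult_closed by metis
    then show ?thesis
      using * closed by (simp add: hp balanced rsmult_closed smult_closed)
  qed
  then have "h ` K \<subseteq> {\<one>\<^bsub>D\<^esub>}"
    unfolding tensor_kernel_def
    by (intro hom_generate_subset[OF F.is_group D.is_group h relations_carrier D.triv_subgroup]) simp
  then obtain k where "k \<in> hom (F Mod K) D" "\<And>x. x \<in> carrier F \<Longrightarrow> k (K #>\<^bsub>F\<^esub> x) = h x"
    using quot_factor[OF normal_kernel D.is_group h] by blast
  then show ?thesis
    using that[of k] frag_of_F hp by (simp add: hom_tensor pure_tensor_def)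
qed

end

section \<open>Maps between tensor products\<close>

lemma frag_extend_hom:
  assumes "\<And>x. x \<in> E \<Longrightarrow> \<phi> x \<in> carrier (free_Abelian_group Y)"
  shows "frag_extend \<phi> \<in> hom (free_Abelian_group E) (free_Abelian_group Y)"
proof (rule homI)
  fix x assume "x \<in> carrier (free_Abelian_group E)"
  then show "frag_extend \<phi> x \<in> carrier (free_Abelian_group Y)"
    using keys_frag_extend[of \<phi> x] assms by fastforce
qed (simp add: frag_extend_add)

text \<open>Balance is asked for in the target tensor product only, and neither \<open>u\<close> nor
  \<open>v\<close> has to be linear over the middle ring. The secret action needs this freedom,
  since both of its components are semilinear with respect to the action of \<open>h\<close> on
  \<open>S'\<close>.\<close>

locale tensor_map_pair = D: tensor_pair R' A' B' + C: tensor_pair R A B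
  for R' :: "('r', 'x') ring_scheme" and A' :: "('t', 'a', 'r') bimodule" and B' :: "('r', 'b') module"
  and R :: "('r, 'x) ring_scheme" and A :: "('t, 'a, 'r) bimodule" and B :: "('r, 'b) module" +
  fixes u :: "'a' \<Rightarrow> 'a" and v :: "'b' \<Rightarrow> 'b"
  assumes u: "u \<in> hom (add_monoid A') (add_monoid A)"
    and v: "v \<in> hom (add_monoid B') (add_monoid B)"
    and uv_balanced: "\<lbrakk>a \<in> carrier A'; r \<in> carrier R'; b \<in> carrier B'\<rbrakk> \<Longrightarrow>
      C.pure (u (rsmult A' a r)) (v b) = C.pure (u a) (v (r \<odot>\<^bsub>B'\<^esub> b))"
begin

lemma u_closed: "a \<in> carrier A' \<Longrightarrow> u a \<in> carrier A" and v_closed: "b \<in> carrier B' \<Longrightarrow> v b \<in> carrier B"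
  using u v by (auto simp: hom_def)

lemma uv_hom: "frag_extend (\<lambda>(x, y). frag_of (u x, v y)) \<in> hom D.F C.F"
  by (rule frag_extend_hom) (auto simp: u_closed v_closed)

lemma uv_kernel: "frag_extend (\<lambda>(x, y). frag_of (u x, v y)) ` D.K \<subseteq> C.K"
proof -
  interpret F: comm_group D.F by (rule abelian_free_Abelian_group)
  interpret F': comm_group C.F by (rule abelian_free_Abelian_group)
  interpret N: normal C.K C.F by (rule C.normal_kernel)
  \<comment> \<open>\<open>uv_balanced\<close> is an equality of cosets, whereas preservation of
    kernels asks for a difference lying in \<open>C.K\<close>.\<close>
  have eqD: "x - y \<in> C.K" if "x \<in> carrier C.F" "C.K #>\<^bsub>C.F\<^esub> x = C.K #>\<^bsub>C.F\<^esub> y" for x y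
  proof -
    have "x \<in> C.K #>\<^bsub>C.F\<^esub> y" using that F'.rcos_self[OF _ N.subgroup_axioms, of x] by simp
    then obtain n where "n \<in> C.K" "x = n + y" by (auto simp: r_coset_def)
    then show ?thesis by simp
  qed
  show ?thesis
    unfolding tensor_kernel_def[of R']
  proof (rule hom_generate_subset[OF F.is_group F'.is_group uv_hom D.relations_carrier N.subgroup_axioms])
    fix x assume "x \<in> tensor_relations R' A' B'"
    then show "frag_extend (\<lambda>(x, y). frag_of (u x, v y)) x \<in> C.K"
      unfolding tensor_relations_def
    proof (elim UnE CollectE exE conjE)
      fix a a' b assume *: "x = frag_of (a \<oplus>\<^bsub>A'\<^esub> a', b) - frag_of (a, b) - frag_of (a', b)"
        "a \<in> carrier A'" "a' \<in> carrier A'" "b \<in> carrier B'"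
      have "u (a \<oplus>\<^bsub>A'\<^esub> a') = u a \<oplus>\<^bsub>A\<^esub> u a'" using u * by (auto simp: hom_def)
      then show ?thesis
        using * C.kernel_add_left[of "u a" "u a'" "v b"] by (simp add: frag_extend_diff u_closed v_closed)
    next
      fix a b b' assume *: "x = frag_of (a, b \<oplus>\<^bsub>B'\<^esub> b') - frag_of (a, b) - frag_of (a, b')"
        "a \<in> carrier A'" "b \<in> carrier B'" "b' \<in> carrier B'"
      have "v (b \<oplus>\<^bsub>B'\<^esub> b') = v b \<oplus>\<^bsub>B\<^esub> v b'" using v * by (auto simp: hom_def)
      then show ?thesis
        using * C.kernel_add_right[of "u a" "v b" "v b'"] by (simp add: frag_extend_diff u_closed v_closed)
    next
      fix a r b assume *: "x = frag_of (rsmult A' a r, b) - frag_of (a, r \<odot>\<^bsub>B'\<^esub> b)"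
        "a \<in> carrier A'" "r \<in> carrier R'" "b \<in> carrier B'"
      have "frag_of (u (rsmult A' a r), v b) - frag_of (u a, v (r \<odot>\<^bsub>B'\<^esub> b)) \<in> C.K"
        by (rule eqD[OF _ uv_balanced[OF *(2-4), unfolded pure_tensor_def]])
          (simp add: * u_closed v_closed D.rsmult_closed)
      then show ?thesis by (simp add: * frag_extend_diff)
    qed
  qed
qed

lemma tensor_map_pure:
  assumes "a \<in> carrier A'" "b \<in> carrier B'"
  shows "tensor_map R A B u v (D.pure a b) = C.pure (u a) (v b)"
  using quot_map_r_coset[OF D.normal_kernel C.normal_kernel uv_hom uv_kernel D.frag_of_F[OF assms]]
  by (simp only: tensor_map_def pure_tensor_def frag_extend_of prod.case)

lemma tensor_map_hom: "tensor_map R A B u v \<in> hom (add_monoid D.T) (add_monoid C.T)"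
  using quot_map_hom[OF D.normal_kernel C.normal_kernel uv_hom uv_kernel]
  by (simp only: tensor_map_def hom_tensor)

end

section \<open>Left modules\<close>

lemma left_module_smult_hom:
  assumes "left_module R M" "r \<in> carrier R"
  shows "(\<lambda>x. r \<odot>\<^bsub>M\<^esub> x) \<in> hom (add_monoid M) (add_monoid M)"
  using assms by (auto simp: hom_def left_module.lm_smult_closed left_module.lm_smult_r_distr)

lemma left_module_homD:
  assumes "h \<in> left_module_hom R M N"
  shows "h \<in> hom (add_monoid M) (add_monoid N)"
    and "\<And>r x. \<lbrakk>r \<in> carrier R; x \<in> carrier M\<rbrakk> \<Longrightarrow> h (r \<odot>\<^bsub>M\<^esub> x) = r \<odot>\<^bsub>N\<^esub> h x"
  using assms by (auto simp: hom_def left_module_hom_def)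

locale tensor_bimodule = tensor_pair R A B + T0: ring T0 + L: left_module T0 A
  for T0 :: "('t, 'w) ring_scheme" and R :: "('r, 'x) ring_scheme"
    and A :: "('t, 'a, 'r) bimodule" and B :: "('r, 'b) module" +
  assumes smult_rsmult: "\<lbrakk>t \<in> carrier T0; a \<in> carrier A; r \<in> carrier R\<rbrakk> \<Longrightarrow>
    rsmult A (t \<odot>\<^bsub>A\<^esub> a) r = t \<odot>\<^bsub>A\<^esub> rsmult A a r"
begin

text \<open>Left multiplication descends because the left and right multiplications of a bimodule
  commute.\<close>

lemma smult_tensor_map_pair:
  assumes "t \<in> carrier T0"
  shows "tensor_map_pair R A B R A B (\<lambda>a. t \<odot>\<^bsub>A\<^esub> a) (\<lambda>b. b)"
proof
  show "(\<lambda>a. t \<odot>\<^bsub>A\<^esub> a) \<in> hom (add_monoid A) (add_monoid A)"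
    by (rule left_module_smult_hom[OF L.left_module_axioms assms])
  show "(\<lambda>b. b) \<in> hom (add_monoid B) (add_monoid B)"
    by (auto simp: hom_def)
  fix a r b assume "a \<in> carrier A" "r \<in> carrier R" "b \<in> carrier B"
  then show "pure (t \<odot>\<^bsub>A\<^esub> rsmult A a r) b = pure (t \<odot>\<^bsub>A\<^esub> a) (r \<odot>\<^bsub>B\<^esub> b)"
    using pure_balanced[of "t \<odot>\<^bsub>A\<^esub> a" r b] assms by (simp add: smult_rsmult L.lm_smult_closed)
qed

lemma smult_pure:
  assumes "t \<in> carrier T0" "a \<in> carrier A" "b \<in> carrier B"
  shows "t \<odot>\<^bsub>T\<^esub> pure a b = pure (t \<odot>\<^bsub>A\<^esub> a) b"
  using tensor_map_pair.tensor_map_pure[OF smult_tensor_map_pair[OF assms(1)] assms(2,3)]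
  by (simp only: tensor_simps)

lemma smult_hom:
  assumes "t \<in> carrier T0"
  shows "(\<lambda>x. t \<odot>\<^bsub>T\<^esub> x) \<in> hom (add_monoid T) (add_monoid T)"
  using tensor_map_pair.tensor_map_hom[OF smult_tensor_map_pair[OF assms(1)]]
  unfolding tensor_simps(4) .

lemma left_module_tensor: "left_module T0 T"
proof
  fix a b x assume a: "a \<in> carrier T0" and b: "b \<in> carrier T0" and x: "x \<in> carrier T"
  show "a \<odot>\<^bsub>T\<^esub> x \<in> carrier T"
    using hom_in_carrier[OF smult_hom[OF a]] x by simp
  show "(a \<oplus>\<^bsub>T0\<^esub> b) \<odot>\<^bsub>T\<^esub> x = a \<odot>\<^bsub>T\<^esub> x \<oplus>\<^bsub>T\<^esub> b \<odot>\<^bsub>T\<^esub> x"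
  proof (rule tensor_hom_eqI'[OF T.a_group _ _ _ x, of "\<lambda>x. (a \<oplus>\<^bsub>T0\<^esub> b) \<odot>\<^bsub>T\<^esub> x"])
    show "(\<lambda>x. (a \<oplus>\<^bsub>T0\<^esub> b) \<odot>\<^bsub>T\<^esub> x) \<in> hom (add_monoid T) (add_monoid T)"
      using a b by (simp add: smult_hom)
    \<comment> \<open>A pointwise sum of additive maps is additive because the target is
      abelian.\<close>
    show "(\<lambda>x. a \<odot>\<^bsub>T\<^esub> x \<oplus>\<^bsub>T\<^esub> b \<odot>\<^bsub>T\<^esub> x) \<in> hom (add_monoid T) (add_monoid T)"
    proof (rule homI)
      note c = hom_in_carrier[OF smult_hom[OF a]] hom_in_carrier[OF smult_hom[OF b]]
      note m = hom_mult[OF smult_hom[OF a]] hom_mult[OF smult_hom[OF b]]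
      fix x y assume "x \<in> carrier (add_monoid T)" "y \<in> carrier (add_monoid T)"
      then show "a \<odot>\<^bsub>T\<^esub> (x \<otimes>\<^bsub>add_monoid T\<^esub> y) \<oplus>\<^bsub>T\<^esub> b \<odot>\<^bsub>T\<^esub> (x \<otimes>\<^bsub>add_monoid T\<^esub> y) =
        (a \<odot>\<^bsub>T\<^esub> x \<oplus>\<^bsub>T\<^esub> b \<odot>\<^bsub>T\<^esub> x) \<otimes>\<^bsub>add_monoid T\<^esub> (a \<odot>\<^bsub>T\<^esub> y \<oplus>\<^bsub>T\<^esub> b \<odot>\<^bsub>T\<^esub> y)"
        using c m by (simp add: T.a_ac)
    qed (use hom_in_carrier[OF smult_hom[OF a]] hom_in_carrier[OF smult_hom[OF b]] in simp)
  qed (use a b in \<open>simp add: smult_pure L.lm_smult_l_distr pure_add_left L.lm_smult_closed\<close>)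
  show "(a \<otimes>\<^bsub>T0\<^esub> b) \<odot>\<^bsub>T\<^esub> x = a \<odot>\<^bsub>T\<^esub> (b \<odot>\<^bsub>T\<^esub> x)"
  proof (rule tensor_hom_eqI'[OF T.a_group _ _ _ x, of "\<lambda>x. (a \<otimes>\<^bsub>T0\<^esub> b) \<odot>\<^bsub>T\<^esub> x"])
    show "(\<lambda>x. (a \<otimes>\<^bsub>T0\<^esub> b) \<odot>\<^bsub>T\<^esub> x) \<in> hom (add_monoid T) (add_monoid T)"
      using a b by (simp add: smult_hom)
    show "(\<lambda>x. a \<odot>\<^bsub>T\<^esub> (b \<odot>\<^bsub>T\<^esub> x)) \<in> hom (add_monoid T) (add_monoid T)"
      using hom_compose[OF smult_hom[OF b] smult_hom[OF a]] by (simp add: comp_def)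
  qed (use a b in \<open>simp add: smult_pure L.lm_smult_assoc L.lm_smult_closed\<close>)
  fix y assume y: "y \<in> carrier T"
  show "a \<odot>\<^bsub>T\<^esub> (x \<oplus>\<^bsub>T\<^esub> y) = a \<odot>\<^bsub>T\<^esub> x \<oplus>\<^bsub>T\<^esub> a \<odot>\<^bsub>T\<^esub> y"
    using hom_mult[OF smult_hom[OF a], of x y] x y by simp
next
  fix x assume x: "x \<in> carrier T"
  show "\<one>\<^bsub>T0\<^esub> \<odot>\<^bsub>T\<^esub> x = x"
  proof (rule tensor_hom_eqI'[OF T.a_group _ _ _ x, of "\<lambda>x. \<one>\<^bsub>T0\<^esub> \<odot>\<^bsub>T\<^esub> x"])
    show "(\<lambda>x. \<one>\<^bsub>T0\<^esub> \<odot>\<^bsub>T\<^esub> x) \<in> hom (add_monoid T) (add_monoid T)"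
      by (simp add: smult_hom)
    show "(\<lambda>x. x) \<in> hom (add_monoid T) (add_monoid T)"
      by (auto simp: hom_def)
  qed (simp add: smult_pure L.lm_smult_one)
qed

end

section \<open>Bimodules along ring homomorphisms\<close>

lemma bimodule_via_simps [simp]:
  "carrier (bimodule_via i A j) = carrier A"
  "add (bimodule_via i A j) = add A"
  "ring.zero (bimodule_via i A j) = ring.zero A"
  "t \<odot>\<^bsub>bimodule_via i A j\<^esub> x = i t \<otimes>\<^bsub>A\<^esub> x"
  "rsmult (bimodule_via i A j) x r = x \<otimes>\<^bsub>A\<^esub> j r"
  by (simp_all add: bimodule_via_def)

text \<open>Both sides of the theorem start from such a tensor product: for the induced module
  \<open>A\<close> is the crossed product over \<open>S\<close>, for the base change
  \<open>A\<close> is \<open>S\<close> itself with \<open>j\<close> equal to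
  \<open>f\<close>.\<close>

lemma tensor_bimodule_via:
  assumes "ring A" "ring T" "i \<in> ring_hom T A" "j \<in> ring_hom R A" "left_module R B"
  shows "tensor_bimodule T R (bimodule_via i A j) B"
proof -
  interpret A: ring A by fact
  interpret T: ring T by fact
  interpret B: left_module R B by fact
  have 1: "comm_group (add_monoid (bimodule_via i A j))"
    by (rule comm_group_cong[OF A.a_comm_group]) simp_all
  interpret V: abelian_group "bimodule_via i A j"
    by (rule comm_group_abelian_groupI[OF 1])
  note ij = ring_hom_memE[OF assms(3)] ring_hom_closed[OF assms(4)]
  show ?thesis
    by unfold_locales
      (simp_all add: ij A.m_assoc A.l_distr A.r_distr B.lm_smult_closed)
qed

section \<open>Quotients of left modules\<close>

lemma quot_module_simps:
  "carrier (quot_module M K) = carrier (add_monoid M Mod K)"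
  "add (quot_module M K) = monoid.mult (add_monoid M Mod K)"
  "ring.zero (quot_module M K) = one (add_monoid M Mod K)"
  by (simp_all add: quot_module_def FactGroup_def A_RCOSETS_def set_add_def)

lemma hom_quot_module:
  "hom (add_monoid (quot_module M K)) D = hom (add_monoid M Mod K) D"
  "hom D (add_monoid (quot_module M K)) = hom D (add_monoid M Mod K)"
  by (simp_all add: hom_def quot_module_simps)

locale submodule_quotient = ring R + M: left_module R M
  for R :: "('r, 'x) ring_scheme" (structure) and M :: "('r, 'm) module" and K :: "'m set" +
  assumes subgroup_K: "subgroup K (add_monoid M)"
    and smult_K: "\<lbrakk>r \<in> carrier R; x \<in> K\<rbrakk> \<Longrightarrow> r \<odot>\<^bsub>M\<^esub> x \<in> K"
begin

abbreviation Q where "Q \<equiv> quot_module M K"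
abbreviation cls where "cls x \<equiv> K #>\<^bsub>add_monoid M\<^esub> x"

lemma normal_K: "K \<lhd> add_monoid M"
  by (rule comm_group.subgroup_imp_normal[OF M.a_comm_group subgroup_K])

lemma comm_group_Q: "comm_group (add_monoid Q)"
  by (rule comm_group_cong[OF comm_group.abelian_FactGroup[OF M.a_comm_group subgroup_K]])
    (simp_all add: quot_module_simps)

sublocale Q: abelian_group Q by (rule comm_group_abelian_groupI[OF comm_group_Q])

lemma carrierE:
  assumes "C \<in> carrier Q" obtains x where "x \<in> carrier M" "C = cls x"
  using assms that by (auto simp: quot_module_def A_RCOSETS_def RCOSETS_def)

lemma cls_hom: "cls \<in> hom (add_monoid M) (add_monoid Q)"
  unfolding hom_quot_module by (rule normal.r_coset_hom_Mod[OF normal_K])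

lemma cls_closed: "x \<in> carrier M \<Longrightarrow> cls x \<in> carrier Q"
  using hom_in_carrier[OF cls_hom] by simp

lemma cls_add: "\<lbrakk>x \<in> carrier M; y \<in> carrier M\<rbrakk> \<Longrightarrow> cls (x \<oplus>\<^bsub>M\<^esub> y) = cls x \<oplus>\<^bsub>Q\<^esub> cls y"
  using hom_mult[OF cls_hom, of x y] by simp

lemma smult_cls:
  assumes "r \<in> carrier R" "x \<in> carrier M"
  shows "r \<odot>\<^bsub>Q\<^esub> cls x = cls (r \<odot>\<^bsub>M\<^esub> x)"
proof -
  have "r \<odot>\<^bsub>Q\<^esub> cls x = quot_map (add_monoid M) K (\<lambda>x. r \<odot>\<^bsub>M\<^esub> x) (cls x)"
    by (simp add: quot_module_def)
  also have "\<dots> = cls (r \<odot>\<^bsub>M\<^esub> x)"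
    by (rule quot_map_r_coset[OF normal_K normal_K left_module_smult_hom[OF M.left_module_axioms assms(1)]])
      (use smult_K assms in auto)
  finally show ?thesis .
qed

lemma left_module_quot: "left_module R Q"
proof
  fix a b C assume a: "a \<in> carrier R" and b: "b \<in> carrier R" and C: "C \<in> carrier Q"
  from C obtain x where x: "x \<in> carrier M" "C = cls x" by (rule carrierE)
  note simps = smult_cls M.lm_smult_closed M.lm_smult_l_distr M.lm_smult_r_distr M.lm_smult_assoc
  show "a \<odot>\<^bsub>Q\<^esub> C \<in> carrier Q"
    using a x by (simp add: simps cls_closed)
  show "(a \<oplus> b) \<odot>\<^bsub>Q\<^esub> C = a \<odot>\<^bsub>Q\<^esub> C \<oplus>\<^bsub>Q\<^esub> b \<odot>\<^bsub>Q\<^esub> C"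
    using a b x by (simp add: simps cls_add[symmetric])
  show "(a \<otimes> b) \<odot>\<^bsub>Q\<^esub> C = a \<odot>\<^bsub>Q\<^esub> (b \<odot>\<^bsub>Q\<^esub> C)"
    using a b x by (simp add: simps)
  fix D assume "D \<in> carrier Q"
  then obtain y where y: "y \<in> carrier M" "D = cls y" by (rule carrierE)
  show "a \<odot>\<^bsub>Q\<^esub> (C \<oplus>\<^bsub>Q\<^esub> D) = a \<odot>\<^bsub>Q\<^esub> C \<oplus>\<^bsub>Q\<^esub> a \<odot>\<^bsub>Q\<^esub> D"
    using a x y by (simp add: simps cls_add[symmetric])
next
  fix C assume "C \<in> carrier Q"
  then obtain x where x: "x \<in> carrier M" "C = cls x" by (rule carrierE)
  then show "\<one> \<odot>\<^bsub>Q\<^esub> C = C"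
    by (simp add: smult_cls M.lm_smult_one)
qed

end

section \<open>Restriction of scalars\<close>

lemma restrict_scalars_simps [simp]:
  "carrier (restrict_scalars i M) = carrier M"
  "add (restrict_scalars i M) = add M"
  "ring.zero (restrict_scalars i M) = ring.zero M"
  "t \<odot>\<^bsub>restrict_scalars i M\<^esub> x = i t \<odot>\<^bsub>M\<^esub> x"
  by (simp_all add: restrict_scalars_def)

lemma hom_restrict_scalars [simp]:
  "hom (add_monoid (restrict_scalars i M)) D = hom (add_monoid M) D"
  "hom D (add_monoid (restrict_scalars i M)) = hom D (add_monoid M)"
  by (simp_all add: hom_def)

lemma left_module_restrict_scalars:
  assumes "i \<in> ring_hom R' R" "left_module R M"
  shows "left_module R' (restrict_scalars i M)"
proof -
  interpret M: left_module R M by fact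
  interpret V: abelian_group "restrict_scalars i M"
    by (rule comm_group_abelian_groupI[OF comm_group_cong[OF M.a_comm_group]]) simp_all
  note i = ring_hom_memE[OF assms(1)]
  show ?thesis
    by unfold_locales
      (simp_all add: i M.lm_smult_closed M.lm_smult_l_distr M.lm_smult_r_distr M.lm_smult_assoc M.lm_smult_one)
qed

section \<open>Skew group rings\<close>

text \<open>The action in pointwise form: \<open>act_one\<close> and \<open>act_mult\<close> replace
  the homomorphism into the group of bijections of the carrier.\<close>

locale ring_action = S: ring S + G: group G
  for S :: "('s, 'x) ring_scheme" and G :: "('g, 'y) monoid_scheme" and act :: "'g \<Rightarrow> 's \<Rightarrow> 's" +
  assumes act_hom: "g \<in> carrier G \<Longrightarrow> act g \<in> ring_hom S S"
    and act_one: "s \<in> carrier S \<Longrightarrow> act \<one>\<^bsub>G\<^esub> s = s"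
    and act_mult: "\<lbrakk>g \<in> carrier G; h \<in> carrier G; s \<in> carrier S\<rbrakk> \<Longrightarrow>
      act (g \<otimes>\<^bsub>G\<^esub> h) s = act g (act h s)"
begin

abbreviation A where "A \<equiv> skew_group_ring S G act"
abbreviation single where "single \<equiv> skew_single S G"
abbreviation supp where "supp a \<equiv> {g \<in> carrier G. a g \<noteq> \<zero>\<^bsub>S\<^esub>}"

lemma act_closed: "\<lbrakk>g \<in> carrier G; s \<in> carrier S\<rbrakk> \<Longrightarrow> act g s \<in> carrier S"
  by (rule ring_hom_closed[OF act_hom])

lemma act_ring_hom_simps:
  assumes "g \<in> carrier G"
  shows "\<lbrakk>s \<in> carrier S; t \<in> carrier S\<rbrakk> \<Longrightarrow> act g (s \<oplus>\<^bsub>S\<^esub> t) = act g s \<oplus>\<^bsub>S\<^esub> act g t"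
    "\<lbrakk>s \<in> carrier S; t \<in> carrier S\<rbrakk> \<Longrightarrow> act g (s \<otimes>\<^bsub>S\<^esub> t) = act g s \<otimes>\<^bsub>S\<^esub> act g t"
    "act g \<one>\<^bsub>S\<^esub> = \<one>\<^bsub>S\<^esub>" "act g \<zero>\<^bsub>S\<^esub> = \<zero>\<^bsub>S\<^esub>"
  using ring_hom_memE[OF act_hom[OF assms]] ring_hom_zero[OF act_hom[OF assms] S.ring_axioms S.ring_axioms]
  by auto

lemma skew_simps:
  "carrier A = {a \<in> carrier G \<rightarrow>\<^sub>E carrier S. finite (supp a)}"
  "\<zero>\<^bsub>A\<^esub> = (\<lambda>k\<in>carrier G. \<zero>\<^bsub>S\<^esub>)"
  "\<one>\<^bsub>A\<^esub> = single \<one>\<^bsub>S\<^esub> \<one>\<^bsub>G\<^esub>"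
  "a \<oplus>\<^bsub>A\<^esub> b = (\<lambda>k\<in>carrier G. a k \<oplus>\<^bsub>S\<^esub> b k)"
  by (simp_all add: skew_group_ring_def)

lemma skewI: "\<lbrakk>\<And>g. g \<in> carrier G \<Longrightarrow> a g \<in> carrier S; a \<in> extensional (carrier G); finite (supp a)\<rbrakk> \<Longrightarrow> a \<in> carrier A"
  by (auto simp: skew_simps PiE_def)

lemma skewD:
  assumes "a \<in> carrier A"
  shows "g \<in> carrier G \<Longrightarrow> a g \<in> carrier S" "a \<in> extensional (carrier G)" "finite (supp a)"
  using assms by (auto simp: skew_simps PiE_def)

lemma skew_eqI:
  assumes "a \<in> extensional (carrier G)" "b \<in> extensional (carrier G)"
    and "\<And>g. g \<in> carrier G \<Longrightarrow> a g = b g"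
  shows "a = b"
  using assms by (rule extensionalityI)

lemma skew_add_closed: "\<lbrakk>a \<in> carrier A; b \<in> carrier A\<rbrakk> \<Longrightarrow> a \<oplus>\<^bsub>A\<^esub> b \<in> carrier A"
proof (rule skewI)
  assume ab: "a \<in> carrier A" "b \<in> carrier A"
  then have "supp (a \<oplus>\<^bsub>A\<^esub> b) \<subseteq> supp a \<union> supp b"
    by (auto simp: skew_simps)
  then show "finite (supp (a \<oplus>\<^bsub>A\<^esub> b))"
    by (rule finite_subset) (use ab skewD(3) in auto)
qed (auto simp: skew_simps)

lemma abelian_group_skew: "abelian_group A"
proof (rule abelian_groupI)
  fix a b c assume abc: "a \<in> carrier A" "b \<in> carrier A"
  show "a \<oplus>\<^bsub>A\<^esub> b \<in> carrier A" using abc by (rule skew_add_closed)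
  show "a \<oplus>\<^bsub>A\<^esub> b = b \<oplus>\<^bsub>A\<^esub> a"
    using abc[THEN skewD(1)] by (auto simp: skew_simps S.a_comm intro!: restrict_ext)
  show "\<zero>\<^bsub>A\<^esub> \<oplus>\<^bsub>A\<^esub> a = a"
    by (rule skew_eqI) (use skewD[OF abc(1)] in \<open>auto simp: skew_simps(2,4)\<close>)
  show "\<exists>y\<in>carrier A. y \<oplus>\<^bsub>A\<^esub> a = \<zero>\<^bsub>A\<^esub>"
  proof
    have "finite (supp (\<lambda>k\<in>carrier G. \<ominus>\<^bsub>S\<^esub> a k))"
      by (rule finite_subset[OF _ skewD(3)[OF abc(1)]]) (use skewD[OF abc(1)] in auto)
    then show "(\<lambda>k\<in>carrier G. \<ominus>\<^bsub>S\<^esub> a k) \<in> carrier A"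
      using skewD(1)[OF abc(1)] by (intro skewI) auto
    show "(\<lambda>k\<in>carrier G. \<ominus>\<^bsub>S\<^esub> a k) \<oplus>\<^bsub>A\<^esub> a = \<zero>\<^bsub>A\<^esub>"
      using skewD[OF abc(1)] by (auto simp: skew_simps(2,4) S.l_neg intro!: restrict_ext)
  qed
  assume "c \<in> carrier A"
  then show "a \<oplus>\<^bsub>A\<^esub> b \<oplus>\<^bsub>A\<^esub> c = a \<oplus>\<^bsub>A\<^esub> (b \<oplus>\<^bsub>A\<^esub> c)"
    using abc[THEN skewD(1)] skewD(1)[of c] by (auto simp: skew_simps(4) S.a_assoc intro!: restrict_ext)
qed (auto simp: skew_simps)

sublocale A: abelian_group A by (rule abelian_group_skew)

lemma single_apply: "k \<in> carrier G \<Longrightarrow> single s g k = (if k = g then s else \<zero>\<^bsub>S\<^esub>)"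
  by (simp add: skew_single_def)

text \<open>For \<open>g\<close> outside the group the restricted function is zero everywhere on
  \<open>carrier G\<close>, so membership holds for every index \<open>g\<close>.\<close>

lemma single_closed: "s \<in> carrier S \<Longrightarrow> single s g \<in> carrier A"
proof (rule skewI)
  have "supp (single s g) \<subseteq> {g}" by (auto simp: single_apply split: if_splits)
  then show "finite (supp (single s g))" by (rule finite_subset) simp
qed (auto simp: single_apply skew_single_def)

lemma single_add: "\<lbrakk>s \<in> carrier S; t \<in> carrier S\<rbrakk> \<Longrightarrow> single (s \<oplus>\<^bsub>S\<^esub> t) g = single s g \<oplus>\<^bsub>A\<^esub> single t g"
  by (auto simp: skew_simps skew_single_def intro!: restrict_ext)

text \<open>Induction on a finite set \<open>E\<close> that bounds the support, splitting off the
  coefficient at one \<open>g\<close> at a time. The bound may exceed the support, which spares a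
  case distinction on vanishing coefficients.\<close>

lemma skew_generated:
  "carrier A = generate (add_monoid A) {single s g | s g. s \<in> carrier S \<and> g \<in> carrier G}" (is "_ = ?gen")
proof
  have sub: "{single s g | s g. s \<in> carrier S \<and> g \<in> carrier G} \<subseteq> carrier (add_monoid A)"
    by (auto simp: single_closed)
  show "?gen \<subseteq> carrier A"
    using group.generate_incl[OF A.a_group sub] by simp
  have "a \<in> ?gen" if "finite E" "a \<in> carrier A" "supp a \<subseteq> E" for E a
    using that
  proof (induction E arbitrary: a)
    case empty
    have "a = \<zero>\<^bsub>A\<^esub>"
      by (rule skew_eqI) (use empty skewD in \<open>auto simp: skew_simps(2)\<close>)
    then show ?case using generate.one[of "add_monoid A"] by simp
  next
    case (insert g E)
    show ?case
    proof (cases "g \<in> carrier G")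
      case True
      define b where "b = (\<lambda>k\<in>carrier G. if k = g then \<zero>\<^bsub>S\<^esub> else a k)"
      have sub: "supp b \<subseteq> E" "supp b \<subseteq> supp a" using insert.prems by (auto simp: b_def)
      have b: "b \<in> carrier A"
        using skewD[OF insert.prems(1)] finite_subset[OF sub(2)] by (intro skewI) (auto simp: b_def)
      have "a = single (a g) g \<oplus>\<^bsub>A\<^esub> b"
        by (rule skew_eqI)
          (use skewD[OF insert.prems(1)] True in \<open>auto simp: skew_simps(4) single_apply b_def\<close>)
      moreover have "single (a g) g \<in> ?gen"
        by (rule generate.incl) (use True skewD[OF insert.prems(1)] in auto)
      ultimately show ?thesis
        using generate.eng[of "single (a g) g" "add_monoid A" _ b] insert.IH[OF b sub(1)] by simp
    next
      case False
      \<comment> \<open>Supports are taken inside \<open>carrier G\<close>, so \<open>E\<close>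
        without \<open>g\<close> already contains the support.\<close>
      then show ?thesis using insert by auto
    qed
  qed
  then show "carrier A \<subseteq> ?gen"
    using skewD(3) by blast
qed

lemma skew_hom_eqI:
  assumes "group D" "h \<in> hom (add_monoid A) D" "k \<in> hom (add_monoid A) D"
    and "\<And>s g. \<lbrakk>s \<in> carrier S; g \<in> carrier G\<rbrakk> \<Longrightarrow> h (single s g) = k (single s g)"
    and "a \<in> carrier A"
  shows "h a = k a"
  by (rule hom_eq_on_generate[OF A.a_group assms(1-3),
        of "{single s g | s g. s \<in> carrier S \<and> g \<in> carrier G}"])
    (use assms(4,5) single_closed skew_generated in auto)

text \<open>The definition sums over the exact support of the left factor. Any larger finite index
  set gives the same value, so that products with different left factors can be compared term by
  term.\<close>

lemma mult_apply:
  assumes "a \<in> carrier A" "b \<in> carrier A" "k \<in> carrier G" "finite E" "supp a \<subseteq> E" "E \<subseteq> carrier G"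
  shows "(a \<otimes>\<^bsub>A\<^esub> b) k = (\<Oplus>\<^bsub>S\<^esub>g\<in>E. a g \<otimes>\<^bsub>S\<^esub> act g (b (inv\<^bsub>G\<^esub> g \<otimes>\<^bsub>G\<^esub> k)))"
proof -
  have c: "a g \<otimes>\<^bsub>S\<^esub> act g (b (inv\<^bsub>G\<^esub> g \<otimes>\<^bsub>G\<^esub> k)) \<in> carrier S" if "g \<in> E" for g
    using that assms(3,6) by (intro S.m_closed act_closed skewD(1)[OF assms(1)] skewD(1)[OF assms(2)]) auto
  have "(a \<otimes>\<^bsub>A\<^esub> b) k = (\<Oplus>\<^bsub>S\<^esub>g\<in>supp a. a g \<otimes>\<^bsub>S\<^esub> act g (b (inv\<^bsub>G\<^esub> g \<otimes>\<^bsub>G\<^esub> k)))"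
    using assms(3) by (simp add: skew_group_ring_def)
  also have "\<dots> = (\<Oplus>\<^bsub>S\<^esub>g\<in>E. a g \<otimes>\<^bsub>S\<^esub> act g (b (inv\<^bsub>G\<^esub> g \<otimes>\<^bsub>G\<^esub> k)))"
  proof (rule S.add.finprod_mono_neutral_cong_left[OF assms(4,5)])
    fix g assume g: "g \<in> E - supp a"
    then have "act g (b (inv\<^bsub>G\<^esub> g \<otimes>\<^bsub>G\<^esub> k)) \<in> carrier S"
      using assms(3,6) by (intro act_closed skewD(1)[OF assms(2)]) auto
    then show "a g \<otimes>\<^bsub>S\<^esub> act g (b (inv\<^bsub>G\<^esub> g \<otimes>\<^bsub>G\<^esub> k)) = \<zero>\<^bsub>S\<^esub>" using g assms(6) by auto
  qed (use c in auto)
  finally show ?thesis .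
qed

lemma mult_extensional: "a \<otimes>\<^bsub>A\<^esub> b \<in> extensional (carrier G)"
  by (simp add: skew_group_ring_def)

text \<open>The support of a product lies in the finite product set of the supports: if
  \<open>k\<close> is not a product of elements of the two supports, every summand at
  \<open>k\<close> vanishes.\<close>

lemma mult_closed:
  assumes a: "a \<in> carrier A" and b: "b \<in> carrier A"
  shows "a \<otimes>\<^bsub>A\<^esub> b \<in> carrier A"
proof (rule skewI)
  note ap = mult_apply[OF a b _ skewD(3)[OF a] subset_refl]
  show "(a \<otimes>\<^bsub>A\<^esub> b) k \<in> carrier S" if "k \<in> carrier G" for k
    using that by (subst ap) (auto intro!: S.finsum_closed S.m_closed act_closed skewD(1)[OF a] skewD(1)[OF b])
  have "supp (a \<otimes>\<^bsub>A\<^esub> b) \<subseteq> (\<lambda>(g, h). g \<otimes>\<^bsub>G\<^esub> h) ` (supp a \<times> supp b)"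
  proof
    fix k assume k: "k \<in> supp (a \<otimes>\<^bsub>A\<^esub> b)"
    show "k \<in> (\<lambda>(g, h). g \<otimes>\<^bsub>G\<^esub> h) ` (supp a \<times> supp b)"
    proof (rule ccontr)
      assume no: "\<not> ?thesis"
      have zero: "b (inv\<^bsub>G\<^esub> g \<otimes>\<^bsub>G\<^esub> k) = \<zero>\<^bsub>S\<^esub>" if "g \<in> supp a" for g
      proof (rule ccontr)
        assume "b (inv\<^bsub>G\<^esub> g \<otimes>\<^bsub>G\<^esub> k) \<noteq> \<zero>\<^bsub>S\<^esub>"
        then have "(g, inv\<^bsub>G\<^esub> g \<otimes>\<^bsub>G\<^esub> k) \<in> supp a \<times> supp b" "k = g \<otimes>\<^bsub>G\<^esub> (inv\<^bsub>G\<^esub> g \<otimes>\<^bsub>G\<^esub> k)"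
          using k that by (auto simp: G.m_assoc[symmetric])
        then show False using no by (metis (mono_tags, lifting) image_eqI case_prod_conv)
      qed
      have "(\<Oplus>\<^bsub>S\<^esub>g\<in>supp a. a g \<otimes>\<^bsub>S\<^esub> act g (b (inv\<^bsub>G\<^esub> g \<otimes>\<^bsub>G\<^esub> k))) = (\<Oplus>\<^bsub>S\<^esub>g\<in>supp a. \<zero>\<^bsub>S\<^esub>)"
        by (rule S.finsum_cong') (auto simp: zero act_ring_hom_simps(4) skewD(1)[OF a])
      then have "(a \<otimes>\<^bsub>A\<^esub> b) k = \<zero>\<^bsub>S\<^esub>"
        using k ap[of k] by simp
      then show False using k by simp
    qed
  qed
  then show "finite (supp (a \<otimes>\<^bsub>A\<^esub> b))"
    by (rule finite_subset) (use skewD(3)[OF a] skewD(3)[OF b] in auto)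
qed (rule mult_extensional)

lemma mult_add_left:
  assumes a: "a \<in> carrier A" "a' \<in> carrier A" and b: "b \<in> carrier A"
  shows "(a \<oplus>\<^bsub>A\<^esub> a') \<otimes>\<^bsub>A\<^esub> b = a \<otimes>\<^bsub>A\<^esub> b \<oplus>\<^bsub>A\<^esub> a' \<otimes>\<^bsub>A\<^esub> b"
proof (rule skew_eqI)
  fix k assume k: "k \<in> carrier G"
  \<comment> \<open>Cancellation can shrink the support of the sum, so all three products are
    expanded over the union.\<close>
  let ?E = "supp a \<union> supp a'"
  have E: "finite ?E" "supp a \<subseteq> ?E" "supp a' \<subseteq> ?E" "supp (a \<oplus>\<^bsub>A\<^esub> a') \<subseteq> ?E" "?E \<subseteq> carrier G"
    using a skewD(3) by (auto simp: skew_simps(4))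
  have "((a \<oplus>\<^bsub>A\<^esub> a') \<otimes>\<^bsub>A\<^esub> b) k =
      (\<Oplus>\<^bsub>S\<^esub>g\<in>?E. a g \<otimes>\<^bsub>S\<^esub> act g (b (inv\<^bsub>G\<^esub> g \<otimes>\<^bsub>G\<^esub> k)) \<oplus>\<^bsub>S\<^esub> a' g \<otimes>\<^bsub>S\<^esub> act g (b (inv\<^bsub>G\<^esub> g \<otimes>\<^bsub>G\<^esub> k)))"
    unfolding mult_apply[OF A.a_closed[OF a] b k E(1,4,5)]
    by (rule S.finsum_cong')
      (use k skewD(1)[OF a(1)] skewD(1)[OF a(2)] skewD(1)[OF b] in
        \<open>auto simp: skew_simps(4) S.l_distr act_closed\<close>)
  also have "\<dots> = (a \<otimes>\<^bsub>A\<^esub> b) k \<oplus>\<^bsub>S\<^esub> (a' \<otimes>\<^bsub>A\<^esub> b) k"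
    unfolding mult_apply[OF a(1) b k E(1,2,5)] mult_apply[OF a(2) b k E(1,3,5)]
    by (rule S.finsum_addf)
      (use k skewD(1)[OF a(1)] skewD(1)[OF a(2)] skewD(1)[OF b] in \<open>auto simp: act_closed\<close>)
  finally show "((a \<oplus>\<^bsub>A\<^esub> a') \<otimes>\<^bsub>A\<^esub> b) k = (a \<otimes>\<^bsub>A\<^esub> b \<oplus>\<^bsub>A\<^esub> a' \<otimes>\<^bsub>A\<^esub> b) k"
    using k by (simp add: skew_simps(4))
qed (auto simp: mult_extensional skew_simps(4))

lemma mult_add_right:
  assumes a: "a \<in> carrier A" and b: "b \<in> carrier A" "b' \<in> carrier A"
  shows "a \<otimes>\<^bsub>A\<^esub> (b \<oplus>\<^bsub>A\<^esub> b') = a \<otimes>\<^bsub>A\<^esub> b \<oplus>\<^bsub>A\<^esub> a \<otimes>\<^bsub>A\<^esub> b'"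
proof (rule skew_eqI)
  fix k assume k: "k \<in> carrier G"
  have E: "supp a \<subseteq> carrier G" by auto
  note ap = mult_apply[OF a _ k skewD(3)[OF a] subset_refl E]
  have "(a \<otimes>\<^bsub>A\<^esub> (b \<oplus>\<^bsub>A\<^esub> b')) k =
      (\<Oplus>\<^bsub>S\<^esub>g\<in>supp a. a g \<otimes>\<^bsub>S\<^esub> act g (b (inv\<^bsub>G\<^esub> g \<otimes>\<^bsub>G\<^esub> k)) \<oplus>\<^bsub>S\<^esub> a g \<otimes>\<^bsub>S\<^esub> act g (b' (inv\<^bsub>G\<^esub> g \<otimes>\<^bsub>G\<^esub> k)))"
    unfolding ap[OF A.a_closed[OF b]]
    by (rule S.finsum_cong')
      (use k skewD(1)[OF a] skewD(1)[OF b(1)] skewD(1)[OF b(2)] in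
        \<open>auto simp: skew_simps(4) S.r_distr act_closed act_ring_hom_simps\<close>)
  also have "\<dots> = (a \<otimes>\<^bsub>A\<^esub> b) k \<oplus>\<^bsub>S\<^esub> (a \<otimes>\<^bsub>A\<^esub> b') k"
    unfolding ap[OF b(1)] ap[OF b(2)]
    by (rule S.finsum_addf)
      (use k skewD(1)[OF a] skewD(1)[OF b(1)] skewD(1)[OF b(2)] in \<open>auto simp: act_closed\<close>)
  finally show "(a \<otimes>\<^bsub>A\<^esub> (b \<oplus>\<^bsub>A\<^esub> b')) k = (a \<otimes>\<^bsub>A\<^esub> b \<oplus>\<^bsub>A\<^esub> a \<otimes>\<^bsub>A\<^esub> b') k"
    using k by (simp add: skew_simps(4))
qed (auto simp: mult_extensional skew_simps(4))

lemma mult_single: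
  assumes "s \<in> carrier S" "t \<in> carrier S" "g \<in> carrier G" "h \<in> carrier G"
  shows "single s g \<otimes>\<^bsub>A\<^esub> single t h = single (s \<otimes>\<^bsub>S\<^esub> act g t) (g \<otimes>\<^bsub>G\<^esub> h)"
proof (rule skew_eqI)
  fix k assume k: "k \<in> carrier G"
  have "inv\<^bsub>G\<^esub> g \<otimes>\<^bsub>G\<^esub> k = h \<longleftrightarrow> k = g \<otimes>\<^bsub>G\<^esub> h"
    using assms k by (metis G.inv_solve_left)
  \<comment> \<open>The index set is \<open>{g}\<close> and not the support, which is empty when
    \<open>s\<close> is zero.\<close>
  moreover have "(single s g \<otimes>\<^bsub>A\<^esub> single t h) k =
      (\<Oplus>\<^bsub>S\<^esub>g'\<in>{g}. single s g g' \<otimes>\<^bsub>S\<^esub> act g' (single t h (inv\<^bsub>G\<^esub> g' \<otimes>\<^bsub>G\<^esub> k)))"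
    by (rule mult_apply) (use assms k in \<open>auto simp: single_closed single_apply split: if_splits\<close>)
  ultimately show "(single s g \<otimes>\<^bsub>A\<^esub> single t h) k = single (s \<otimes>\<^bsub>S\<^esub> act g t) (g \<otimes>\<^bsub>G\<^esub> h) k"
    using assms k by (simp add: single_apply act_closed act_ring_hom_simps(4))
qed (auto simp: mult_extensional skew_single_def)

lemma mult_hom_left: "b \<in> carrier A \<Longrightarrow> (\<lambda>a. a \<otimes>\<^bsub>A\<^esub> b) \<in> hom (add_monoid A) (add_monoid A)"
  by (auto simp: hom_def mult_closed mult_add_left)

lemma mult_hom_right: "a \<in> carrier A \<Longrightarrow> (\<lambda>b. a \<otimes>\<^bsub>A\<^esub> b) \<in> hom (add_monoid A) (add_monoid A)"
  by (auto simp: hom_def mult_closed mult_add_right)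

lemma skew_mult_assoc:
  assumes a: "a \<in> carrier A" and b: "b \<in> carrier A" and c: "c \<in> carrier A"
  shows "a \<otimes>\<^bsub>A\<^esub> b \<otimes>\<^bsub>A\<^esub> c = a \<otimes>\<^bsub>A\<^esub> (b \<otimes>\<^bsub>A\<^esub> c)"
proof (rule skew_hom_eqI[OF A.a_group _ _ _ a, of "\<lambda>a. a \<otimes>\<^bsub>A\<^esub> b \<otimes>\<^bsub>A\<^esub> c"])
  show "(\<lambda>a. a \<otimes>\<^bsub>A\<^esub> b \<otimes>\<^bsub>A\<^esub> c) \<in> hom (add_monoid A) (add_monoid A)"
    using hom_compose[OF mult_hom_left[OF b] mult_hom_left[OF c]] by (simp add: comp_def)
  show "(\<lambda>a. a \<otimes>\<^bsub>A\<^esub> (b \<otimes>\<^bsub>A\<^esub> c)) \<in> hom (add_monoid A) (add_monoid A)"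
    using mult_hom_left[OF mult_closed[OF b c]] .
  fix s g assume s: "s \<in> carrier S" and g: "g \<in> carrier G"
  note sg = single_closed[OF s]
  show "single s g \<otimes>\<^bsub>A\<^esub> b \<otimes>\<^bsub>A\<^esub> c = single s g \<otimes>\<^bsub>A\<^esub> (b \<otimes>\<^bsub>A\<^esub> c)"
  proof (rule skew_hom_eqI[OF A.a_group _ _ _ b, of "\<lambda>b. single s g \<otimes>\<^bsub>A\<^esub> b \<otimes>\<^bsub>A\<^esub> c"])
    show "(\<lambda>b. single s g \<otimes>\<^bsub>A\<^esub> b \<otimes>\<^bsub>A\<^esub> c) \<in> hom (add_monoid A) (add_monoid A)"
      using hom_compose[OF mult_hom_right[OF sg] mult_hom_left[OF c]] by (simp add: comp_def)
    show "(\<lambda>b. single s g \<otimes>\<^bsub>A\<^esub> (b \<otimes>\<^bsub>A\<^esub> c)) \<in> hom (add_monoid A) (add_monoid A)"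
      using hom_compose[OF mult_hom_left[OF c] mult_hom_right[OF sg]] by (simp add: comp_def)
    fix t h assume t: "t \<in> carrier S" and h: "h \<in> carrier G"
    note th = single_closed[OF t]
    show "single s g \<otimes>\<^bsub>A\<^esub> single t h \<otimes>\<^bsub>A\<^esub> c = single s g \<otimes>\<^bsub>A\<^esub> (single t h \<otimes>\<^bsub>A\<^esub> c)"
    proof (rule skew_hom_eqI[OF A.a_group _ _ _ c, of "\<lambda>c. single s g \<otimes>\<^bsub>A\<^esub> single t h \<otimes>\<^bsub>A\<^esub> c"])
      show "(\<lambda>c. single s g \<otimes>\<^bsub>A\<^esub> single t h \<otimes>\<^bsub>A\<^esub> c) \<in> hom (add_monoid A) (add_monoid A)"
        using mult_hom_right[OF mult_closed[OF sg th]] .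
      show "(\<lambda>c. single s g \<otimes>\<^bsub>A\<^esub> (single t h \<otimes>\<^bsub>A\<^esub> c)) \<in> hom (add_monoid A) (add_monoid A)"
        using hom_compose[OF mult_hom_right[OF th] mult_hom_right[OF sg]] by (simp add: comp_def)
      \<comment> \<open>Both sides are the monomial with coefficient
        \<open>s (g \<cdot> t) (gh \<cdot> u)\<close> at \<open>ghk\<close>, by multiplicativity of
        \<open>act g\<close> and \<open>act_mult\<close>.\<close>
      fix u k assume "u \<in> carrier S" "k \<in> carrier G"
      then show "single s g \<otimes>\<^bsub>A\<^esub> single t h \<otimes>\<^bsub>A\<^esub> single u k =
          single s g \<otimes>\<^bsub>A\<^esub> (single t h \<otimes>\<^bsub>A\<^esub> single u k)"
        using s t g h
        by (simp add: mult_single act_closed act_ring_hom_simps act_mult S.m_assoc G.m_assoc)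
    qed
  qed
qed

lemma ring_skew: "ring A"
proof (rule ringI[OF abelian_group_skew])
  have id: "(\<lambda>a. a) \<in> hom (add_monoid A) (add_monoid A)" by (auto simp: hom_def)
  have one: "\<one>\<^bsub>A\<^esub> \<in> carrier A" by (simp add: skew_simps(3) single_closed)
  show "monoid A"
  proof (rule monoidI[OF mult_closed one skew_mult_assoc])
    fix a assume a: "a \<in> carrier A"
    show "\<one>\<^bsub>A\<^esub> \<otimes>\<^bsub>A\<^esub> a = a"
      by (rule skew_hom_eqI[OF A.a_group mult_hom_right[OF one] id _ a])
        (simp add: skew_simps(3) mult_single act_one)
    show "a \<otimes>\<^bsub>A\<^esub> \<one>\<^bsub>A\<^esub> = a"
      by (rule skew_hom_eqI[OF A.a_group mult_hom_left[OF one] id _ a])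
        (simp add: skew_simps(3) mult_single act_ring_hom_simps)
  qed
qed (rule mult_add_left mult_add_right; assumption)+

sublocale A: ring A by (rule ring_skew)

text \<open>Additively the skew group ring is a direct sum of copies of \<open>S\<close> indexed by
  \<open>G\<close>, so a family of additive maps on \<open>S\<close> extends to it.\<close>

lemma skew_lift:
  assumes D: "comm_group D"
    and closed: "\<And>s g. \<lbrakk>s \<in> carrier S; g \<in> carrier G\<rbrakk> \<Longrightarrow> \<psi> s g \<in> carrier D"
    and add: "\<And>s t g. \<lbrakk>s \<in> carrier S; t \<in> carrier S; g \<in> carrier G\<rbrakk> \<Longrightarrow>
      \<psi> (s \<oplus>\<^bsub>S\<^esub> t) g = \<psi> s g \<otimes>\<^bsub>D\<^esub> \<psi> t g"
  obtains h where "h \<in> hom (add_monoid A) D"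
    "\<And>s g. \<lbrakk>s \<in> carrier S; g \<in> carrier G\<rbrakk> \<Longrightarrow> h (single s g) = \<psi> s g"
proof -
  interpret D: comm_group D by fact
  \<comment> \<open>Additivity at zero gives an idempotent of the group \<open>D\<close>. Hence all
    but finitely many factors of the product over \<open>carrier G\<close> are trivial, and
    \<open>gfinprod\<close> over this possibly infinite index set has its intended meaning.\<close>
  have zero: "\<psi> \<zero>\<^bsub>S\<^esub> g = \<one>\<^bsub>D\<^esub>" if "g \<in> carrier G" for g
    using add[of "\<zero>\<^bsub>S\<^esub>" "\<zero>\<^bsub>S\<^esub>" g] closed[of "\<zero>\<^bsub>S\<^esub>" g] that by (simp add: D.l_cancel_one)
  define h where "h = (\<lambda>a. gfinprod D (\<lambda>g. \<psi> (a g) g) (carrier G))"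
  have fin: "finite {g \<in> carrier G. \<psi> (a g) g \<noteq> \<one>\<^bsub>D\<^esub>}" if "a \<in> carrier A" for a
    by (rule finite_subset[OF _ skewD(3)[OF that]]) (use zero in force)
  have cl: "(\<lambda>g. \<psi> (a g) g) \<in> carrier G \<rightarrow> carrier D" if "a \<in> carrier A" for a
    using closed skewD(1)[OF that] by auto
  have "h \<in> hom (add_monoid A) D"
  proof (rule homI)
    fix a b assume "a \<in> carrier (add_monoid A)" "b \<in> carrier (add_monoid A)"
    then have a: "a \<in> carrier A" and b: "b \<in> carrier A" by auto
    have "h (a \<oplus>\<^bsub>A\<^esub> b) = gfinprod D (\<lambda>g. \<psi> (a g) g \<otimes>\<^bsub>D\<^esub> \<psi> (b g) g) (carrier G)"
      unfolding h_def
      by (rule D.gfinprod_cong) (use closed skewD(1)[OF a] skewD(1)[OF b] add in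
          \<open>auto simp: skew_simps(4) simp_implies_def\<close>)
    then show "h (a \<otimes>\<^bsub>add_monoid A\<^esub> b) = h a \<otimes>\<^bsub>D\<^esub> h b"
      using D.gfinprod_distrib[OF fin[OF a] fin[OF b] cl[OF a] cl[OF b]] by (simp add: h_def)
  qed (use cl in \<open>simp add: h_def\<close>)
  moreover have "h (single s g) = \<psi> s g" if sg: "s \<in> carrier S" "g \<in> carrier G" for s g
  proof -
    have "h (single s g) = gfinprod D (\<lambda>k. \<psi> (single s g k) k) {g}"
      unfolding h_def
      by (rule D.gfinprod_mono_neutral_cong_right)
        (use sg closed zero in \<open>auto simp: single_apply\<close>)
    then show ?thesis using sg closed by (simp add: single_apply)
  qed
  ultimately show ?thesis using that by blast
qed

end

section \<open>Differences and units in rings\<close>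

lemma (in ring) minus_mult_left:
  "\<lbrakk>x \<in> carrier R; y \<in> carrier R; z \<in> carrier R\<rbrakk> \<Longrightarrow> (x \<ominus> y) \<otimes> z = x \<otimes> z \<ominus> y \<otimes> z"
  by (simp add: minus_eq l_distr l_minus)

lemma (in ring) minus_mult_right:
  "\<lbrakk>x \<in> carrier R; y \<in> carrier R; z \<in> carrier R\<rbrakk> \<Longrightarrow> z \<otimes> (x \<ominus> y) = z \<otimes> x \<ominus> z \<otimes> y"
  by (simp add: minus_eq r_distr r_minus)

text \<open>Both inverse equations are preserved, and two-sided inverses are unique. The maps in
  question are \<open>act g\<close> and \<open>f\<close>, which have to transport inverses of values
  of a trivialisation.\<close>

lemma (in ring) ring_hom_inv_Units:
  assumes "h \<in> ring_hom R T" "ring T" "u \<in> Units R"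
  shows "h (inv u) = inv\<^bsub>T\<^esub> h u"
proof -
  interpret T: ring T by fact
  note h = ring_hom_memE[OF assms(1)]
  have u: "u \<in> carrier R" "inv u \<in> carrier R" using assms(3) by auto
  have "h (inv u) \<otimes>\<^bsub>T\<^esub> h u = \<one>\<^bsub>T\<^esub>" "h u \<otimes>\<^bsub>T\<^esub> h (inv u) = \<one>\<^bsub>T\<^esub>"
    using h(2)[OF u(2,1)] h(2)[OF u] h(4) assms(3) by simp_all
  then show ?thesis
    using T.inv_char[of "h u" "h (inv u)"] h(1) u by simp
qed

lemma hom_a_minus:
  assumes "abelian_group A" "group D" "h \<in> hom (add_monoid A) D" "x \<in> carrier A" "y \<in> carrier A"
  shows "h (x \<ominus>\<^bsub>A\<^esub> y) = h x \<otimes>\<^bsub>D\<^esub> inv\<^bsub>D\<^esub> h y"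
proof -
  interpret A: abelian_group A by fact
  interpret h: group_hom "add_monoid A" D h
    using assms A.a_group by (simp add: group_hom_def group_hom_axioms_def)
  show ?thesis
    using h.hom_mult[of x "\<ominus>\<^bsub>A\<^esub> y"] h.hom_inv[of y] assms(4,5) by (simp add: A.minus_eq a_inv_def)
qed

section \<open>Crossed products\<close>

locale crossed = ring_action S G act + N: equivariant_trivialisation G S act N \<beta>
  for S :: "('s, 'x) ring_scheme" and G :: "('g, 'y) monoid_scheme"
    and act :: "'g \<Rightarrow> 's \<Rightarrow> 's" and N :: "'g set" and \<beta> :: "'g \<Rightarrow> 's"
begin

abbreviation I where "I \<equiv> crossed_ideal S G act N \<beta>"
abbreviation C where "C \<equiv> crossed_product S G act N \<beta>"
abbreviation csingle where "csingle \<equiv> crossed_single S G act N \<beta>"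
abbreviation igen where "igen n \<equiv> single (inv\<^bsub>S\<^esub> \<beta> n) n \<ominus>\<^bsub>A\<^esub> \<one>\<^bsub>A\<^esub>"

lemma beta_Units: "n \<in> N \<Longrightarrow> \<beta> n \<in> Units S"
  using hom_in_carrier[OF N.triv_hom, of n] by (simp add: units_of_def)

lemma beta_closed: "n \<in> N \<Longrightarrow> \<beta> n \<in> carrier S"
  using beta_Units by blast

lemma beta_inv_closed: "n \<in> N \<Longrightarrow> inv\<^bsub>S\<^esub> \<beta> n \<in> carrier S"
  using beta_Units by blast

lemma N_carrier: "n \<in> N \<Longrightarrow> n \<in> carrier G"
  using N.subset by blast

lemma act_inv_beta:
  assumes "g \<in> carrier G" "n \<in> N"
  shows "act g (inv\<^bsub>S\<^esub> \<beta> n) = inv\<^bsub>S\<^esub> \<beta> (g \<otimes>\<^bsub>G\<^esub> n \<otimes>\<^bsub>G\<^esub> inv\<^bsub>G\<^esub> g)"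
  using S.ring_hom_inv_Units[OF act_hom[OF assms(1)] S.ring_axioms beta_Units[OF assms(2)]]
    N.triv_equivariant[OF assms] by simp

text \<open>Substituting \<open>\<beta> n s (\<beta> n)\<^sup>-\<^sup>1\<close> for
  \<open>act n s\<close> cancels the left factor. The commutation rule serves both the two-sidedness
  of the ideal and the balance of the secret action.\<close>

lemma inv_beta_act:
  assumes "n \<in> N" "s \<in> carrier S"
  shows "inv\<^bsub>S\<^esub> \<beta> n \<otimes>\<^bsub>S\<^esub> act n s = s \<otimes>\<^bsub>S\<^esub> inv\<^bsub>S\<^esub> \<beta> n"
proof -
  have "inv\<^bsub>S\<^esub> \<beta> n \<otimes>\<^bsub>S\<^esub> act n s = (inv\<^bsub>S\<^esub> \<beta> n \<otimes>\<^bsub>S\<^esub> \<beta> n) \<otimes>\<^bsub>S\<^esub> (s \<otimes>\<^bsub>S\<^esub> inv\<^bsub>S\<^esub> \<beta> n)"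
    using assms beta_closed beta_inv_closed by (simp add: N.triv_conj[symmetric] S.m_assoc)
  then show ?thesis
    using assms beta_Units beta_inv_closed by simp
qed

lemma igen_closed: "n \<in> N \<Longrightarrow> igen n \<in> carrier A"
  by (simp add: single_closed beta_inv_closed)

text \<open>Moving \<open>g\<close> past the inverse of \<open>\<beta> n\<close> conjugates
  \<open>n\<close>, by equivariance of \<open>\<beta>\<close>.\<close>

lemma single_mult_igen:
  assumes "s \<in> carrier S" "g \<in> carrier G" "n \<in> N"
  shows "single s g \<otimes>\<^bsub>A\<^esub> igen n =
    single (s \<otimes>\<^bsub>S\<^esub> inv\<^bsub>S\<^esub> \<beta> (g \<otimes>\<^bsub>G\<^esub> n \<otimes>\<^bsub>G\<^esub> inv\<^bsub>G\<^esub> g)) (g \<otimes>\<^bsub>G\<^esub> n) \<ominus>\<^bsub>A\<^esub> single s g"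
  using assms
  by (simp add: A.minus_mult_right single_closed beta_inv_closed mult_single act_inv_beta N_carrier)

text \<open>Generators pass monomials up to conjugation of \<open>n\<close>, which stays in the
  normal subgroup. Both sides equal \<open>s \<beta>(n)\<^sup>-\<^sup>1 n g - s g\<close>, the left
  by the conjugation axiom and the right by equivariance.\<close>

lemma igen_mult_single:
  assumes "s \<in> carrier S" "g \<in> carrier G" "n \<in> N"
  shows "igen n \<otimes>\<^bsub>A\<^esub> single s g = single s g \<otimes>\<^bsub>A\<^esub> igen (inv\<^bsub>G\<^esub> g \<otimes>\<^bsub>G\<^esub> n \<otimes>\<^bsub>G\<^esub> g)"
proof -
  let ?m = "inv\<^bsub>G\<^esub> g \<otimes>\<^bsub>G\<^esub> n \<otimes>\<^bsub>G\<^esub> g"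
  have m: "?m \<in> N" using assms N.inv_op_closed1 by simp
  have gm: "g \<otimes>\<^bsub>G\<^esub> ?m = n \<otimes>\<^bsub>G\<^esub> g"
    using assms by (simp add: N_carrier G.m_assoc[symmetric])
  have gmg: "g \<otimes>\<^bsub>G\<^esub> ?m \<otimes>\<^bsub>G\<^esub> inv\<^bsub>G\<^esub> g = n"
    unfolding gm using assms by (simp add: N_carrier G.m_assoc)
  have "igen n \<otimes>\<^bsub>A\<^esub> single s g = single (s \<otimes>\<^bsub>S\<^esub> inv\<^bsub>S\<^esub> \<beta> n) (n \<otimes>\<^bsub>G\<^esub> g) \<ominus>\<^bsub>A\<^esub> single s g"
    using assms by (simp add: A.minus_mult_left single_closed beta_inv_closed mult_single inv_beta_act N_carrier)
  also have "\<dots> = single s g \<otimes>\<^bsub>A\<^esub> igen ?m"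
    unfolding single_mult_igen[OF assms(1,2) m] gmg by (simp only: gm)
  finally show ?thesis .
qed

lemma I_subset: "{a \<otimes>\<^bsub>A\<^esub> igen n | a n. a \<in> carrier A \<and> n \<in> N} \<subseteq> carrier (add_monoid A)"
  using igen_closed by auto

lemma I_eq: "I = generate (add_monoid A) {a \<otimes>\<^bsub>A\<^esub> igen n | a n. a \<in> carrier A \<and> n \<in> N}"
  unfolding crossed_ideal_def left_ideal_gen_def
  by (rule arg_cong[of _ _ "generate (add_monoid A)"]) blast

lemma I_subgroup: "subgroup I (add_monoid A)"
  unfolding I_eq by (rule group.generate_is_subgroup[OF A.a_group I_subset])

lemma igen_mult_I: "\<lbrakk>a \<in> carrier A; n \<in> N\<rbrakk> \<Longrightarrow> a \<otimes>\<^bsub>A\<^esub> igen n \<in> I"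
  unfolding I_eq by (rule generate.incl) blast

text \<open>The point is closure under right multiplication, because \<open>crossed_ideal\<close> is
  generated as a left ideal only.\<close>

lemma ideal_I: "ideal I A"
proof (rule idealI[OF A.ring_axioms I_subgroup])
  fix i b assume i: "i \<in> I" and b: "b \<in> carrier A"
  have "(\<lambda>i. b \<otimes>\<^bsub>A\<^esub> i) ` I \<subseteq> I"
    \<comment> \<open>Only the \<open>I\<close> under the image is expanded into generators; the one
      on the right stays folded as a subgroup.\<close>
    unfolding I_eq[THEN arg_cong[of _ _ "image (\<lambda>i. b \<otimes>\<^bsub>A\<^esub> i)"]]
  proof (rule hom_generate_subset[OF A.a_group A.a_group mult_hom_right[OF b] I_subset I_subgroup])
    fix x assume "x \<in> {a \<otimes>\<^bsub>A\<^esub> igen n | a n. a \<in> carrier A \<and> n \<in> N}"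
    then obtain a n where x: "x = a \<otimes>\<^bsub>A\<^esub> igen n" "a \<in> carrier A" "n \<in> N" by blast
    then have "b \<otimes>\<^bsub>A\<^esub> x = (b \<otimes>\<^bsub>A\<^esub> a) \<otimes>\<^bsub>A\<^esub> igen n"
      using b igen_closed by (simp add: A.m_assoc)
    then show "b \<otimes>\<^bsub>A\<^esub> x \<in> I" using b x igen_mult_I by simp
  qed
  then show "b \<otimes>\<^bsub>A\<^esub> i \<in> I" using i by blast
  have "(\<lambda>i. i \<otimes>\<^bsub>A\<^esub> b) ` I \<subseteq> I"
    unfolding I_eq[THEN arg_cong[of _ _ "image (\<lambda>i. i \<otimes>\<^bsub>A\<^esub> b)"]]
  proof (rule hom_generate_subset[OF A.a_group A.a_group mult_hom_left[OF b] I_subset I_subgroup])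
    fix x assume "x \<in> {a \<otimes>\<^bsub>A\<^esub> igen n | a n. a \<in> carrier A \<and> n \<in> N}"
    then obtain a n where x: "x = a \<otimes>\<^bsub>A\<^esub> igen n" "a \<in> carrier A" "n \<in> N" by blast
    have xA: "x \<in> carrier A" using x igen_closed by simp
    have sub: "{single s g | s g. s \<in> carrier S \<and> g \<in> carrier G} \<subseteq> carrier (add_monoid A)"
      by (auto simp: single_closed)
    \<comment> \<open>\<open>igen_mult_single\<close> speaks of monomials, so the right factor has
      to be reduced to generators as well.\<close>
    have "(\<lambda>b. x \<otimes>\<^bsub>A\<^esub> b) ` generate (add_monoid A) {single s g | s g. s \<in> carrier S \<and> g \<in> carrier G} \<subseteq> I"
    proof (rule hom_generate_subset[OF A.a_group A.a_group mult_hom_right[OF xA] sub I_subgroup])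
      fix y assume "y \<in> {single s g | s g. s \<in> carrier S \<and> g \<in> carrier G}"
      then obtain s g where y: "y = single s g" "s \<in> carrier S" "g \<in> carrier G" by blast
      have "x \<otimes>\<^bsub>A\<^esub> y = (a \<otimes>\<^bsub>A\<^esub> single s g) \<otimes>\<^bsub>A\<^esub> igen (inv\<^bsub>G\<^esub> g \<otimes>\<^bsub>G\<^esub> n \<otimes>\<^bsub>G\<^esub> g)"
        using x y igen_closed N.inv_op_closed1 by (simp add: A.m_assoc single_closed igen_mult_single)
      then show "x \<otimes>\<^bsub>A\<^esub> y \<in> I"
        using x y N.inv_op_closed1 by (simp add: igen_mult_I single_closed)
    qed
    then show "x \<otimes>\<^bsub>A\<^esub> b \<in> I" using b skew_generated by auto
  qed
  then show "i \<otimes>\<^bsub>A\<^esub> b \<in> I" using i by blast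
qed

sublocale I: ideal I A by (rule ideal_I)

lemma I_normal: "I \<lhd> add_monoid A"
  by (rule A.ideal_is_normal[OF ideal_I])

lemma C_eq: "C = A Quot I"
  by (simp add: crossed_product_def)

lemma ring_C: "ring C"
  unfolding C_eq by (rule I.quotient_is_ring)

sublocale C: ring C by (rule ring_C)

lemma coset_ring_hom: "(\<lambda>a. I +>\<^bsub>A\<^esub> a) \<in> ring_hom A C"
  unfolding C_eq by (rule I.rcos_ring_hom)

lemma hom_C:
  "hom (add_monoid C) D = hom (add_monoid A Mod I) D"
  "hom D (add_monoid C) = hom D (add_monoid A Mod I)"
  by (simp_all add: C_eq hom_def FactRing_def FactGroup_def A_RCOSETS_def set_add_def)

lemma csingle_coset: "csingle s g = I +>\<^bsub>A\<^esub> single s g"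
  by (simp add: crossed_single_def)

lemma csingle_closed: "s \<in> carrier S \<Longrightarrow> csingle s g \<in> carrier C"
  unfolding csingle_coset by (rule ring_hom_closed[OF coset_ring_hom]) (rule single_closed)

lemma csingle_add:
  "\<lbrakk>s \<in> carrier S; t \<in> carrier S\<rbrakk> \<Longrightarrow> csingle (s \<oplus>\<^bsub>S\<^esub> t) g = csingle s g \<oplus>\<^bsub>C\<^esub> csingle t g"
  unfolding csingle_coset by (simp add: single_add ring_hom_add[OF coset_ring_hom] single_closed)

lemma csingle_mult:
  "\<lbrakk>s \<in> carrier S; t \<in> carrier S; g \<in> carrier G; h \<in> carrier G\<rbrakk> \<Longrightarrow>
    csingle s g \<otimes>\<^bsub>C\<^esub> csingle t h = csingle (s \<otimes>\<^bsub>S\<^esub> act g t) (g \<otimes>\<^bsub>G\<^esub> h)"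
  unfolding csingle_coset
  by (simp add: mult_single[symmetric] ring_hom_mult[OF coset_ring_hom] single_closed)

lemma csingle_one: "csingle \<one>\<^bsub>S\<^esub> \<one>\<^bsub>G\<^esub> = \<one>\<^bsub>C\<^esub>"
  unfolding csingle_coset skew_simps(3)[symmetric] by (rule ring_hom_one[OF coset_ring_hom])

lemma csingle_beta:
  assumes "n \<in> N"
  shows "csingle (inv\<^bsub>S\<^esub> \<beta> n) n = \<one>\<^bsub>C\<^esub>"
proof -
  have "igen n \<in> I"
    using igen_mult_I[OF A.one_closed assms] igen_closed[OF assms] by simp
  then have "I +>\<^bsub>A\<^esub> single (inv\<^bsub>S\<^esub> \<beta> n) n = I +>\<^bsub>A\<^esub> \<one>\<^bsub>A\<^esub>"
    using A.quotient_eq_iff_same_a_r_cos[OF ideal_I, of "single (inv\<^bsub>S\<^esub> \<beta> n) n" "\<one>\<^bsub>A\<^esub>"] assms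
    by (simp add: single_closed beta_inv_closed)
  then show ?thesis
    using ring_hom_one[OF coset_ring_hom] by (simp add: csingle_coset)
qed

lemma scalar_ring_hom: "(\<lambda>s. csingle s \<one>\<^bsub>G\<^esub>) \<in> ring_hom S C"
  by (rule ring_hom_memI)
    (simp_all add: csingle_closed csingle_mult csingle_add csingle_one act_one)

lemma C_generated:
  "carrier C = generate (add_monoid C) {csingle s g | s g. s \<in> carrier S \<and> g \<in> carrier G}"
proof -
  have "(\<lambda>x. I #>\<^bsub>add_monoid A\<^esub> x) ` {single s g | s g. s \<in> carrier S \<and> g \<in> carrier G}
      = {csingle s g | s g. s \<in> carrier S \<and> g \<in> carrier G}"
    by (auto simp: csingle_coset a_r_coset_def)
  moreover have "{single s g | s g. s \<in> carrier S \<and> g \<in> carrier G} \<subseteq> carrier (add_monoid A)"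
    by (auto simp: single_closed)
  moreover have "carrier (add_monoid A) = generate (add_monoid A) {single s g | s g. s \<in> carrier S \<and> g \<in> carrier G}"
    using skew_generated by simp
  ultimately have "carrier (add_monoid A Mod I)
      = generate (add_monoid A Mod I) {csingle s g | s g. s \<in> carrier S \<and> g \<in> carrier G}"
    using quot_generate[OF I_normal, of "{single s g | s g. s \<in> carrier S \<and> g \<in> carrier G}"] by simp
  \<comment> \<open>Here the two structures are equal: the extension of a plain ring record has type
    \<open>unit\<close>, so no unspecified field remains.\<close>
  moreover have "add_monoid C = add_monoid A Mod I"
    by (simp add: C_eq FactRing_def FactGroup_def A_RCOSETS_def set_add_def)
  ultimately show ?thesis by (metis partial_object.select_convs(1))
qed

lemma scalar_mult_csingle:
  "\<lbrakk>s \<in> carrier S; t \<in> carrier S; g \<in> carrier G\<rbrakk> \<Longrightarrow>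
    csingle s \<one>\<^bsub>G\<^esub> \<otimes>\<^bsub>C\<^esub> csingle t g = csingle (s \<otimes>\<^bsub>S\<^esub> t) g"
  by (simp add: csingle_mult act_one)

lemma C_hom_eqI:
  assumes "group D" "h \<in> hom (add_monoid C) D" "k \<in> hom (add_monoid C) D"
    and "\<And>s g. \<lbrakk>s \<in> carrier S; g \<in> carrier G\<rbrakk> \<Longrightarrow> h (csingle s g) = k (csingle s g)"
    and "c \<in> carrier C"
  shows "h c = k c"
  by (rule hom_eq_on_generate[OF C.a_group assms(1-3),
        of "{csingle s g | s g. s \<in> carrier S \<and> g \<in> carrier G}"])
    (use assms(4,5) csingle_closed C_generated in auto)

text \<open>A family that extends to the skew group ring descends to the crossed product if it is
  invariant under replacing \<open>(s, g)\<close> by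
  \<open>(s \<beta>(n)\<^sup>-\<^sup>1, n g)\<close>. Writing \<open>n\<close> to the left of
  \<open>g\<close> absorbs the conjugation in \<open>single_mult_igen\<close> and matches the form
  of the secret action.\<close>

lemma crossed_lift:
  assumes D: "comm_group D"
    and closed: "\<And>s g. \<lbrakk>s \<in> carrier S; g \<in> carrier G\<rbrakk> \<Longrightarrow> \<psi> s g \<in> carrier D"
    and add: "\<And>s t g. \<lbrakk>s \<in> carrier S; t \<in> carrier S; g \<in> carrier G\<rbrakk> \<Longrightarrow>
      \<psi> (s \<oplus>\<^bsub>S\<^esub> t) g = \<psi> s g \<otimes>\<^bsub>D\<^esub> \<psi> t g"
    and inv: "\<And>s g n. \<lbrakk>s \<in> carrier S; g \<in> carrier G; n \<in> N\<rbrakk> \<Longrightarrow>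
      \<psi> (s \<otimes>\<^bsub>S\<^esub> inv\<^bsub>S\<^esub> \<beta> n) (n \<otimes>\<^bsub>G\<^esub> g) = \<psi> s g"
  obtains h where "h \<in> hom (add_monoid C) D"
    "\<And>s g. \<lbrakk>s \<in> carrier S; g \<in> carrier G\<rbrakk> \<Longrightarrow> h (csingle s g) = \<psi> s g"
proof -
  interpret D: comm_group D by fact
  obtain h where h: "h \<in> hom (add_monoid A) D"
    and hs: "\<And>s g. \<lbrakk>s \<in> carrier S; g \<in> carrier G\<rbrakk> \<Longrightarrow> h (single s g) = \<psi> s g"
    by (rule skew_lift[OF D, of \<psi>]) (use closed add in auto)
  have "h (a \<otimes>\<^bsub>A\<^esub> igen n) = \<one>\<^bsub>D\<^esub>" if a: "a \<in> carrier A" and n: "n \<in> N" for a n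
  proof (rule skew_hom_eqI[OF D.is_group _ _ _ a, of "\<lambda>a. h (a \<otimes>\<^bsub>A\<^esub> igen n)" "\<lambda>_. \<one>\<^bsub>D\<^esub>"])
    show "(\<lambda>a. h (a \<otimes>\<^bsub>A\<^esub> igen n)) \<in> hom (add_monoid A) D"
      using hom_compose[OF mult_hom_left[OF igen_closed[OF n]] h] by (simp add: comp_def)
    show "(\<lambda>_. \<one>\<^bsub>D\<^esub>) \<in> hom (add_monoid A) D" by (simp add: hom_def)
    fix s g assume s: "s \<in> carrier S" and g: "g \<in> carrier G"
    let ?m = "g \<otimes>\<^bsub>G\<^esub> n \<otimes>\<^bsub>G\<^esub> inv\<^bsub>G\<^esub> g"
    have m: "?m \<in> N" using g n N.inv_op_closed2 by simp
    have "g \<otimes>\<^bsub>G\<^esub> n = ?m \<otimes>\<^bsub>G\<^esub> g" using g n N_carrier by (simp add: G.m_assoc)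
    then have "\<psi> (s \<otimes>\<^bsub>S\<^esub> inv\<^bsub>S\<^esub> \<beta> ?m) (g \<otimes>\<^bsub>G\<^esub> n) = \<psi> s g"
      using inv[OF s g m] by simp
    then show "h (single s g \<otimes>\<^bsub>A\<^esub> igen n) = \<one>\<^bsub>D\<^esub>"
      using s g n m closed[OF s g]
      by (simp add: single_mult_igen hom_a_minus[OF A.abelian_group_axioms D.is_group h]
          single_closed beta_inv_closed N_carrier hs)
  qed
  then have "h ` I \<subseteq> {\<one>\<^bsub>D\<^esub>}"
    unfolding I_eq[THEN arg_cong[of _ _ "image h"]]
    by (intro hom_generate_subset[OF A.a_group D.is_group h I_subset D.triv_subgroup]) auto
  then obtain k where k: "k \<in> hom (add_monoid A Mod I) D"
    "\<And>x. x \<in> carrier (add_monoid A) \<Longrightarrow> k (I #>\<^bsub>add_monoid A\<^esub> x) = h x"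
    using quot_factor[OF I_normal D.is_group h] by blast
  show ?thesis
  proof (rule that)
    show "k \<in> hom (add_monoid C) D" using k(1) unfolding hom_C .
    show "k (csingle s g) = \<psi> s g" if "s \<in> carrier S" "g \<in> carrier G" for s g
      using k(2) hs single_closed that by (simp add: csingle_coset a_r_coset_def)
  qed
qed

end

section \<open>The ring homomorphism of crossed products induced by \<open>f\<close>\<close>

locale crossed_hom = P: crossed S' G act' H' \<beta>' + Q: crossed S G act H \<beta>
  for S' :: "('t, 'z) ring_scheme" and act' :: "'g \<Rightarrow> 't \<Rightarrow> 't" and H' :: "'g set" and \<beta>' :: "'g \<Rightarrow> 't"
    and G :: "('g, 'y) monoid_scheme"
    and S :: "('s, 'x) ring_scheme" and act :: "'g \<Rightarrow> 's \<Rightarrow> 's" and H :: "'g set" and \<beta> :: "'g \<Rightarrow> 's" +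
  fixes f :: "'t \<Rightarrow> 's"
  assumes f_hom: "f \<in> ring_hom S' S"
    and f_equivariant: "\<lbrakk>g \<in> carrier G; x \<in> carrier S'\<rbrakk> \<Longrightarrow> f (act' g x) = act g (f x)"
    and H'_le_H: "H' \<subseteq> H"
    and f_beta: "h \<in> H' \<Longrightarrow> f (\<beta>' h) = \<beta> h"
begin

abbreviation skew_map where "skew_map \<equiv> (\<lambda>a. \<lambda>g\<in>carrier G. f (a g))"
abbreviation cmap where "cmap \<equiv> crossed_map S G act H \<beta> f"

lemmas f_simps = ring_hom_memE[OF f_hom] ring_hom_zero[OF f_hom P.S.ring_axioms Q.S.ring_axioms]

lemma skew_map_single: "skew_map (P.single s g) = Q.single (f s) g"
  by (auto simp: skew_single_def f_simps intro!: restrict_ext)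

lemma skew_map_hom: "skew_map \<in> hom (add_monoid P.A) (add_monoid Q.A)"
proof (rule homI)
  fix a assume "a \<in> carrier (add_monoid P.A)"
  then have a: "a \<in> carrier P.A" by simp
  have "finite (Q.supp (skew_map a))"
    by (rule finite_subset[OF _ P.skewD(3)[OF a]]) (auto simp: f_simps)
  then show "skew_map a \<in> carrier (add_monoid Q.A)"
    using P.skewD(1)[OF a] f_simps by (simp add: Q.skewI)
  fix b assume "b \<in> carrier (add_monoid P.A)"
  then have b: "b \<in> carrier P.A" by simp
  show "skew_map (a \<otimes>\<^bsub>add_monoid P.A\<^esub> b) = skew_map a \<otimes>\<^bsub>add_monoid Q.A\<^esub> skew_map b"
    using P.skewD(1)[OF a] P.skewD(1)[OF b]
    by (auto simp: P.skew_simps(4) Q.skew_simps(4) f_simps intro!: restrict_ext)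
qed

lemma skew_map_closed: "a \<in> carrier P.A \<Longrightarrow> skew_map a \<in> carrier Q.A"
  using hom_in_carrier[OF skew_map_hom] by simp

lemma skew_map_mult:
  assumes a: "a \<in> carrier P.A" and b: "b \<in> carrier P.A"
  shows "skew_map (a \<otimes>\<^bsub>P.A\<^esub> b) = skew_map a \<otimes>\<^bsub>Q.A\<^esub> skew_map b"
proof (rule P.skew_hom_eqI[OF Q.A.a_group _ _ _ a, of "\<lambda>a. skew_map (a \<otimes>\<^bsub>P.A\<^esub> b)" "\<lambda>a. skew_map a \<otimes>\<^bsub>Q.A\<^esub> skew_map b"])
  show "(\<lambda>a. skew_map (a \<otimes>\<^bsub>P.A\<^esub> b)) \<in> hom (add_monoid P.A) (add_monoid Q.A)"
    using hom_compose[OF P.mult_hom_left[OF b] skew_map_hom] by (simp only: comp_def)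
  show "(\<lambda>a. skew_map a \<otimes>\<^bsub>Q.A\<^esub> skew_map b) \<in> hom (add_monoid P.A) (add_monoid Q.A)"
    using hom_compose[OF skew_map_hom Q.mult_hom_left[OF skew_map_closed[OF b]]] by (simp only: comp_def)
  fix s g assume s: "s \<in> carrier S'" and g: "g \<in> carrier G"
  note sg = P.single_closed[OF s, of g]
  show "skew_map (P.single s g \<otimes>\<^bsub>P.A\<^esub> b) = skew_map (P.single s g) \<otimes>\<^bsub>Q.A\<^esub> skew_map b"
  proof (rule P.skew_hom_eqI[OF Q.A.a_group _ _ _ b, of "\<lambda>b. skew_map (P.single s g \<otimes>\<^bsub>P.A\<^esub> b)"])
    show "(\<lambda>b. skew_map (P.single s g \<otimes>\<^bsub>P.A\<^esub> b)) \<in> hom (add_monoid P.A) (add_monoid Q.A)"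
      using hom_compose[OF P.mult_hom_right[OF sg] skew_map_hom] by (simp only: comp_def)
    show "(\<lambda>b. skew_map (P.single s g) \<otimes>\<^bsub>Q.A\<^esub> skew_map b) \<in> hom (add_monoid P.A) (add_monoid Q.A)"
      using hom_compose[OF skew_map_hom Q.mult_hom_right[OF skew_map_closed[OF sg]]] by (simp only: comp_def)
    \<comment> \<open>On monomials this is \<open>f (s (g \<cdot> t)) = f s (g \<cdot> f t)\<close>,
      that is, equivariance of \<open>f\<close>.\<close>
    fix t h assume "t \<in> carrier S'" "h \<in> carrier G"
    then show "skew_map (P.single s g \<otimes>\<^bsub>P.A\<^esub> P.single t h) = skew_map (P.single s g) \<otimes>\<^bsub>Q.A\<^esub> skew_map (P.single t h)"
      using s g by (simp only: skew_map_single P.mult_single Q.mult_single f_simps f_equivariant P.act_closed)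
  qed
qed

text \<open>Compatibility of the trivialisations enters here: \<open>f\<close> carries the inverse
  of \<open>\<beta>' n\<close> to the inverse of \<open>\<beta> n\<close>. Generators of one ideal
  thus become generators of the other as soon as \<open>H'\<close> lies in \<open>H\<close>.\<close>

lemma skew_map_igen:
  assumes "n \<in> H'"
  shows "skew_map (P.igen n) = Q.igen n"
proof -
  have c: "P.single (inv\<^bsub>S'\<^esub> \<beta>' n) n \<in> carrier P.A" "\<one>\<^bsub>P.A\<^esub> \<in> carrier P.A"
    using assms by (auto simp: P.single_closed P.beta_inv_closed)
  have "skew_map (P.igen n) = skew_map (P.single (inv\<^bsub>S'\<^esub> \<beta>' n) n) \<ominus>\<^bsub>Q.A\<^esub> skew_map \<one>\<^bsub>P.A\<^esub>"
    using hom_a_minus[OF P.A.abelian_group_axioms Q.A.a_group skew_map_hom c]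
    by (simp only: a_minus_def a_inv_def monoid.simps)
  also have "\<dots> = Q.igen n"
    unfolding P.skew_simps(3) Q.skew_simps(3) skew_map_single
    using P.S.ring_hom_inv_Units[OF f_hom Q.S.ring_axioms P.beta_Units[OF assms]] f_beta[OF assms]
    by (simp only: f_simps)
  finally show ?thesis .
qed

lemma skew_map_I: "skew_map ` P.I \<subseteq> Q.I"
  unfolding P.I_eq
proof (rule hom_generate_subset[OF P.A.a_group Q.A.a_group skew_map_hom P.I_subset Q.I_subgroup])
  fix x assume "x \<in> {a \<otimes>\<^bsub>P.A\<^esub> P.igen n | a n. a \<in> carrier P.A \<and> n \<in> H'}"
  then obtain a n where x: "x = a \<otimes>\<^bsub>P.A\<^esub> P.igen n" "a \<in> carrier P.A" "n \<in> H'" by blast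
  have "skew_map x = skew_map a \<otimes>\<^bsub>Q.A\<^esub> Q.igen n"
    using x skew_map_mult[OF x(2) P.igen_closed[OF x(3)]] skew_map_igen[OF x(3)] by simp
  then show "skew_map x \<in> Q.I"
    using Q.igen_mult_I[OF skew_map_closed[OF x(2)], of n] x(3) H'_le_H by auto
qed

lemma cmap_coset:
  assumes "a \<in> carrier P.A"
  shows "cmap (P.I +>\<^bsub>P.A\<^esub> a) = Q.I +>\<^bsub>Q.A\<^esub> skew_map a"
  using quot_map_r_coset[OF P.I_normal Q.I_normal skew_map_hom skew_map_I, of a] assms
  by (simp add: crossed_map_def a_r_coset_def)

lemma cmap_csingle: "s \<in> carrier S' \<Longrightarrow> cmap (P.csingle s g) = Q.csingle (f s) g"
  by (simp only: P.csingle_coset Q.csingle_coset cmap_coset P.single_closed skew_map_single)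

lemma cmap_ring_hom: "cmap \<in> ring_hom P.C Q.C"
proof (rule ring_hom_memI)
  have ex: "\<exists>a\<in>carrier P.A. x = P.I +>\<^bsub>P.A\<^esub> a" if "x \<in> carrier P.C" for x
    using that unfolding P.C_eq FactRing_def by (auto simp: A_RCOSETS_defs a_r_coset_def)
  fix x y assume "x \<in> carrier P.C" "y \<in> carrier P.C"
  then obtain a b where a: "a \<in> carrier P.A" "x = P.I +>\<^bsub>P.A\<^esub> a" and b: "b \<in> carrier P.A" "y = P.I +>\<^bsub>P.A\<^esub> b"
    using ex by metis
  show "cmap x \<in> carrier Q.C"
    unfolding a(2) cmap_coset[OF a(1)]
    by (rule ring_hom_closed[OF Q.coset_ring_hom skew_map_closed[OF a(1)]])
  have "x \<otimes>\<^bsub>P.C\<^esub> y = P.I +>\<^bsub>P.A\<^esub> (a \<otimes>\<^bsub>P.A\<^esub> b)" "x \<oplus>\<^bsub>P.C\<^esub> y = P.I +>\<^bsub>P.A\<^esub> (a \<oplus>\<^bsub>P.A\<^esub> b)"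
    using ring_hom_mult[OF P.coset_ring_hom a(1) b(1)] ring_hom_add[OF P.coset_ring_hom a(1) b(1)] a b by simp_all
  moreover have "skew_map (a \<oplus>\<^bsub>P.A\<^esub> b) = skew_map a \<oplus>\<^bsub>Q.A\<^esub> skew_map b"
    using hom_mult[OF skew_map_hom, of a b] a b by simp
  ultimately show "cmap (x \<otimes>\<^bsub>P.C\<^esub> y) = cmap x \<otimes>\<^bsub>Q.C\<^esub> cmap y" "cmap (x \<oplus>\<^bsub>P.C\<^esub> y) = cmap x \<oplus>\<^bsub>Q.C\<^esub> cmap y"
    using a b skew_map_mult[OF a(1) b(1)] skew_map_closed[OF a(1)] skew_map_closed[OF b(1)]
    by (simp_all only: cmap_coset P.A.m_closed P.A.a_closed ring_hom_mult[OF Q.coset_ring_hom] ring_hom_add[OF Q.coset_ring_hom])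
next
  show "cmap \<one>\<^bsub>P.C\<^esub> = \<one>\<^bsub>Q.C\<^esub>"
    using cmap_csingle[OF P.S.one_closed, of "\<one>\<^bsub>G\<^esub>"] by (simp only: P.csingle_one Q.csingle_one f_simps)
qed

end

section \<open>Induction along a map of crossed products\<close>

locale crossed_module = crossed_hom S' act' H' \<beta>' G S act H \<beta> f
  for S' :: "('t, 'z) ring_scheme" and act' :: "'g \<Rightarrow> 't \<Rightarrow> 't" and H' :: "'g set" and \<beta>' :: "'g \<Rightarrow> 't"
    and G :: "('g, 'y) monoid_scheme"
    and S :: "('s, 'x) ring_scheme" and act :: "'g \<Rightarrow> 's \<Rightarrow> 's" and H :: "'g set" and \<beta> :: "'g \<Rightarrow> 's"
    and f :: "'t \<Rightarrow> 's" +
  fixes M :: "(('g \<Rightarrow> 't) set, 'm) module"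
  assumes left_module_M: "left_module (crossed_product S' G act' H' \<beta>') M"
begin

sublocale M: left_module P.C M by (rule left_module_M)

text \<open>From here on \<open>ind.T\<close> is the induced module, and \<open>V.T\<close>, set up
  next, is the base change \<open>S \<otimes> M\<close> over \<open>S'\<close>, whose scalars act on
  \<open>M\<close> through the classes of the monomials \<open>s1\<close>.\<close>

sublocale ind: tensor_bimodule S P.C "crossed_bimodule S G act H \<beta> f" M
  unfolding crossed_bimodule_def
  by (rule tensor_bimodule_via[OF Q.C.ring_axioms Q.S.ring_axioms Q.scalar_ring_hom cmap_ring_hom left_module_M])

sublocale V: tensor_bimodule S S' "bimodule_via (\<lambda>s. s) S f" "restrict_scalars (\<lambda>s. P.csingle s \<one>\<^bsub>G\<^esub>) M"
proof (rule tensor_bimodule_via[OF Q.S.ring_axioms Q.S.ring_axioms _ f_hom])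
  show "(\<lambda>s. s) \<in> ring_hom S S" by (simp add: ring_hom_def)
  show "left_module S' (restrict_scalars (\<lambda>s. P.csingle s \<one>\<^bsub>G\<^esub>) M)"
    by (rule left_module_restrict_scalars[OF P.scalar_ring_hom left_module_M])
qed

lemma ind_eq: "crossed_induced G S' act' H' \<beta>' S act H \<beta> f M = ind.T"
  by (simp add: crossed_induced_def)

lemma V_eq: "base_change G S' act' H' \<beta>' S f M = V.T"
  by (simp add: base_change_def)

section \<open>The group action on \<open>M\<close> and the secret action\<close>

abbreviation gact where "gact g m \<equiv> P.csingle \<one>\<^bsub>S'\<^esub> g \<odot>\<^bsub>M\<^esub> m"
abbreviation star where "star \<equiv> secret_action G S' act' H' \<beta>' S \<beta> f M"

lemma csingle_smult_closed: "\<lbrakk>s \<in> carrier S'; m \<in> carrier M\<rbrakk> \<Longrightarrow> P.csingle s g \<odot>\<^bsub>M\<^esub> m \<in> carrier M"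
  by (simp add: M.lm_smult_closed P.csingle_closed)

lemma gact_closed: "m \<in> carrier M \<Longrightarrow> gact g m \<in> carrier M"
  by (simp add: csingle_smult_closed)

lemma gact_hom: "gact g \<in> hom (add_monoid M) (add_monoid M)"
  by (rule left_module_smult_hom[OF left_module_M]) (simp add: P.csingle_closed)

lemma csingle_smult_smult:
  assumes "s \<in> carrier S'" "t \<in> carrier S'" "g \<in> carrier G" "h \<in> carrier G" "m \<in> carrier M"
  shows "P.csingle s g \<odot>\<^bsub>M\<^esub> (P.csingle t h \<odot>\<^bsub>M\<^esub> m) = P.csingle (s \<otimes>\<^bsub>S'\<^esub> act' g t) (g \<otimes>\<^bsub>G\<^esub> h) \<odot>\<^bsub>M\<^esub> m"
  using assms by (simp add: M.lm_smult_assoc[symmetric] P.csingle_closed P.csingle_mult)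

lemma gact_mult:
  "\<lbrakk>g \<in> carrier G; h \<in> carrier G; m \<in> carrier M\<rbrakk> \<Longrightarrow> gact (g \<otimes>\<^bsub>G\<^esub> h) m = gact g (gact h m)"
  by (simp add: csingle_smult_smult P.act_ring_hom_simps)

lemma gact_one: "m \<in> carrier M \<Longrightarrow> gact \<one>\<^bsub>G\<^esub> m = m"
  by (simp add: P.csingle_one M.lm_smult_one)

text \<open>Well-definedness of the secret action. In the left factor \<open>f(r)
  \<beta>(h)\<^sup>-\<^sup>1 = \<beta>(h)\<^sup>-\<^sup>1 f(h \<cdot> r)\<close>, and in the right
  factor \<open>h\<close> applied to \<open>r m\<close> is \<open>h \<cdot> r\<close> applied to
  \<open>h m\<close>. Balance for the twisted scalar \<open>act' h r\<close> identifies the two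
  results.\<close>

lemma star_tensor_map_pair:
  assumes h: "h \<in> H"
  shows "tensor_map_pair S' (bimodule_via (\<lambda>s. s) S f) (restrict_scalars (\<lambda>s. P.csingle s \<one>\<^bsub>G\<^esub>) M)
    S' (bimodule_via (\<lambda>s. s) S f) (restrict_scalars (\<lambda>s. P.csingle s \<one>\<^bsub>G\<^esub>) M)
    (\<lambda>s. s \<otimes>\<^bsub>S\<^esub> inv\<^bsub>S\<^esub> \<beta> h) (gact h)"
proof
  show "(\<lambda>s. s \<otimes>\<^bsub>S\<^esub> inv\<^bsub>S\<^esub> \<beta> h) \<in>
      hom (add_monoid (bimodule_via (\<lambda>s. s) S f)) (add_monoid (bimodule_via (\<lambda>s. s) S f))"
    using Q.beta_inv_closed[OF h] by (auto simp: hom_def Q.S.l_distr)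
  show "gact h \<in> hom (add_monoid (restrict_scalars (\<lambda>s. P.csingle s \<one>\<^bsub>G\<^esub>) M))
      (add_monoid (restrict_scalars (\<lambda>s. P.csingle s \<one>\<^bsub>G\<^esub>) M))"
    unfolding hom_restrict_scalars by (rule gact_hom)
  fix s r m assume "s \<in> carrier (bimodule_via (\<lambda>s. s) S f)" and r: "r \<in> carrier S'"
    and "m \<in> carrier (restrict_scalars (\<lambda>s. P.csingle s \<one>\<^bsub>G\<^esub>) M)"
  then have s: "s \<in> carrier S" and m: "m \<in> carrier M" by auto
  note hG = Q.N_carrier[OF h] and b = Q.beta_inv_closed[OF h]
  have "(s \<otimes>\<^bsub>S\<^esub> f r) \<otimes>\<^bsub>S\<^esub> inv\<^bsub>S\<^esub> \<beta> h = (s \<otimes>\<^bsub>S\<^esub> inv\<^bsub>S\<^esub> \<beta> h) \<otimes>\<^bsub>S\<^esub> f (act' h r)"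
    using s r b hG h
    by (simp add: Q.S.m_assoc f_simps f_equivariant Q.inv_beta_act Q.act_closed)
  moreover have "gact h (P.csingle r \<one>\<^bsub>G\<^esub> \<odot>\<^bsub>M\<^esub> m) = P.csingle (act' h r) \<one>\<^bsub>G\<^esub> \<odot>\<^bsub>M\<^esub> gact h m"
    using r m hG by (simp add: csingle_smult_smult P.act_ring_hom_simps P.act_closed)
  ultimately show "V.pure (rsmult (bimodule_via (\<lambda>s. s) S f) s r \<otimes>\<^bsub>S\<^esub> inv\<^bsub>S\<^esub> \<beta> h) (gact h m) =
      V.pure (s \<otimes>\<^bsub>S\<^esub> inv\<^bsub>S\<^esub> \<beta> h) (gact h (r \<odot>\<^bsub>restrict_scalars (\<lambda>s. P.csingle s \<one>\<^bsub>G\<^esub>) M\<^esub> m))"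
    using V.pure_balanced[of "s \<otimes>\<^bsub>S\<^esub> inv\<^bsub>S\<^esub> \<beta> h" "act' h r" "gact h m"] s r m b hG
    by (simp add: P.act_closed gact_closed)
qed

lemma star_pure:
  assumes "h \<in> H" "s \<in> carrier S" "m \<in> carrier M"
  shows "star h (V.pure s m) = V.pure (s \<otimes>\<^bsub>S\<^esub> inv\<^bsub>S\<^esub> \<beta> h) (gact h m)"
  using tensor_map_pair.tensor_map_pure[OF star_tensor_map_pair[OF assms(1)], of s m] assms(2,3)
  by (simp add: secret_action_def base_change_map_def)

lemma star_hom: "h \<in> H \<Longrightarrow> star h \<in> hom (add_monoid V.T) (add_monoid V.T)"
  using tensor_map_pair.tensor_map_hom[OF star_tensor_map_pair]
  by (simp only: secret_action_def base_change_map_def)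

lemma star_closed: "\<lbrakk>h \<in> H; v \<in> carrier V.T\<rbrakk> \<Longrightarrow> star h v \<in> carrier V.T"
  using hom_in_carrier[OF star_hom] by simp

text \<open>Scalars multiply from the left and the inverse of \<open>\<beta> h\<close> from the
  right, so on pure tensors this is associativity in \<open>S\<close>.\<close>

lemma star_smult:
  assumes h: "h \<in> H" and s: "s \<in> carrier S" and v: "v \<in> carrier V.T"
  shows "star h (s \<odot>\<^bsub>V.T\<^esub> v) = s \<odot>\<^bsub>V.T\<^esub> star h v"
proof (rule V.tensor_hom_eqI'[OF V.T.a_group _ _ _ v, of "\<lambda>v. star h (s \<odot>\<^bsub>V.T\<^esub> v)"])
  show "(\<lambda>v. star h (s \<odot>\<^bsub>V.T\<^esub> v)) \<in> hom (add_monoid V.T) (add_monoid V.T)"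
    using hom_compose[OF V.smult_hom[OF s] star_hom[OF h]] by (simp only: comp_def)
  show "(\<lambda>v. s \<odot>\<^bsub>V.T\<^esub> star h v) \<in> hom (add_monoid V.T) (add_monoid V.T)"
    using hom_compose[OF star_hom[OF h] V.smult_hom[OF s]] by (simp only: comp_def)
  fix t m assume "t \<in> carrier (bimodule_via (\<lambda>s. s) S f)" "m \<in> carrier (restrict_scalars (\<lambda>s. P.csingle s \<one>\<^bsub>G\<^esub>) M)"
  then show "star h (s \<odot>\<^bsub>V.T\<^esub> V.pure t m) = s \<odot>\<^bsub>V.T\<^esub> star h (V.pure t m)"
    using h s Q.beta_inv_closed[OF h]
    by (simp add: V.smult_pure star_pure gact_closed Q.S.m_assoc)
qed

section \<open>Coinvariants of the secret action\<close>

abbreviation coker where "coker \<equiv> coinvariants_kernel V.T H star"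

lemma coker_gens: "{star h v \<ominus>\<^bsub>V.T\<^esub> v | h v. h \<in> H \<and> v \<in> carrier V.T} \<subseteq> carrier (add_monoid V.T)"
  using star_closed by auto

lemma coker_subgroup: "subgroup coker (add_monoid V.T)"
  unfolding coinvariants_kernel_def by (rule group.generate_is_subgroup[OF V.T.a_group coker_gens])

lemma coker_mem: "\<lbrakk>h \<in> H; v \<in> carrier V.T\<rbrakk> \<Longrightarrow> star h v \<ominus>\<^bsub>V.T\<^esub> v \<in> coker"
  unfolding coinvariants_kernel_def by (rule generate.incl) blast

text \<open>The kernel is generated only as an additive group, but it is an
  \<open>S\<close>-submodule: by \<open>star_smult\<close> a scalar \<open>s\<close> takes the
  generator for \<open>v\<close> to the generator for \<open>s v\<close>.\<close>

sublocale co: submodule_quotient S V.T coker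
proof (intro submodule_quotient.intro submodule_quotient_axioms.intro)
  show "ring S" by (rule Q.S.ring_axioms)
  show "left_module S V.T" by (rule V.left_module_tensor)
  show "subgroup coker (add_monoid V.T)" by (rule coker_subgroup)
  fix s x assume s: "s \<in> carrier S" and "x \<in> coker"
  have "(\<lambda>x. s \<odot>\<^bsub>V.T\<^esub> x) ` generate (add_monoid V.T) {star h v \<ominus>\<^bsub>V.T\<^esub> v | h v. h \<in> H \<and> v \<in> carrier V.T} \<subseteq> coker"
  proof (rule hom_generate_subset[OF V.T.a_group V.T.a_group V.smult_hom[OF s] coker_gens coker_subgroup])
    fix x assume "x \<in> {star h v \<ominus>\<^bsub>V.T\<^esub> v | h v. h \<in> H \<and> v \<in> carrier V.T}"
    then obtain h v where x: "x = star h v \<ominus>\<^bsub>V.T\<^esub> v" and h: "h \<in> H" and v: "v \<in> carrier V.T" by blast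
    have sv: "s \<odot>\<^bsub>V.T\<^esub> v \<in> carrier V.T"
      using hom_in_carrier[OF V.smult_hom[OF s]] v by simp
    have "s \<odot>\<^bsub>V.T\<^esub> x = star h (s \<odot>\<^bsub>V.T\<^esub> v) \<ominus>\<^bsub>V.T\<^esub> s \<odot>\<^bsub>V.T\<^esub> v"
      unfolding x star_smult[OF h s v]
      using hom_a_minus[OF V.T.abelian_group_axioms V.T.a_group V.smult_hom[OF s] star_closed[OF h v] v]
      by (simp add: a_minus_def a_inv_def)
    then show "s \<odot>\<^bsub>V.T\<^esub> x \<in> coker" using coker_mem[OF h sv] by simp
  qed
  then show "s \<odot>\<^bsub>V.T\<^esub> x \<in> coker"
    using \<open>x \<in> coker\<close> unfolding coinvariants_kernel_def by blast
qed

lemma co_eq: "secret_coinvariants G S' act' H' \<beta>' S H \<beta> f M = co.Q"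
  by (simp add: secret_coinvariants_def V_eq Let_def)

lemma cls_star:
  assumes "h \<in> H" "v \<in> carrier V.T"
  shows "co.cls (star h v) = co.cls v"
proof -
  have "star h v = (star h v \<ominus>\<^bsub>V.T\<^esub> v) \<oplus>\<^bsub>V.T\<^esub> v"
    using assms star_closed by (simp add: V.T.minus_eq V.T.a_assoc V.T.l_neg)
  then have "star h v \<in> co.cls v"
    using coker_mem[OF assms] by (force simp: r_coset_def)
  then show ?thesis
    using group.repr_independence[OF V.T.a_group _ _ coker_subgroup] assms(2) by simp
qed

lemma cls_pure_closed: "\<lbrakk>s \<in> carrier S; m \<in> carrier M\<rbrakk> \<Longrightarrow> co.cls (V.pure s m) \<in> carrier co.Q"
  by (rule co.cls_closed) (rule V.pure_closed; simp)

lemma cls_pure_add_left: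
  "\<lbrakk>s \<in> carrier S; t \<in> carrier S; m \<in> carrier M\<rbrakk> \<Longrightarrow>
    co.cls (V.pure (s \<oplus>\<^bsub>S\<^esub> t) m) = co.cls (V.pure s m) \<oplus>\<^bsub>co.Q\<^esub> co.cls (V.pure t m)"
  using V.pure_add_left[of s t m] co.cls_add V.pure_closed by simp

lemma cls_pure_add_right:
  "\<lbrakk>s \<in> carrier S; m \<in> carrier M; n \<in> carrier M\<rbrakk> \<Longrightarrow>
    co.cls (V.pure s (m \<oplus>\<^bsub>M\<^esub> n)) = co.cls (V.pure s m) \<oplus>\<^bsub>co.Q\<^esub> co.cls (V.pure s n)"
  using V.pure_add_right[of s m n] co.cls_add V.pure_closed by simp

lemma cls_pure_balanced:
  "\<lbrakk>s \<in> carrier S; r \<in> carrier S'; m \<in> carrier M\<rbrakk> \<Longrightarrow>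
    co.cls (V.pure (s \<otimes>\<^bsub>S\<^esub> f r) m) = co.cls (V.pure s (P.csingle r \<one>\<^bsub>G\<^esub> \<odot>\<^bsub>M\<^esub> m))"
  using V.pure_balanced[of s r m] by simp

text \<open>Read with \<open>gact g m\<close> in place of \<open>m\<close>, this is the invariance
  that \<open>crossed_lift\<close> demands.\<close>

lemma cls_pure_star:
  "\<lbrakk>s \<in> carrier S; h \<in> H; m \<in> carrier M\<rbrakk> \<Longrightarrow>
    co.cls (V.pure (s \<otimes>\<^bsub>S\<^esub> inv\<^bsub>S\<^esub> \<beta> h) (gact h m)) = co.cls (V.pure s m)"
  using cls_star[of h "V.pure s m"] V.pure_closed[of s m] by (simp add: star_pure)

section \<open>The comparison map and its inverse\<close>

lemma ind_simps [simp]: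
  "carrier (crossed_bimodule S G act H \<beta> f) = carrier Q.C"
  "add (crossed_bimodule S G act H \<beta> f) = add Q.C"
  "s \<odot>\<^bsub>crossed_bimodule S G act H \<beta> f\<^esub> c = Q.csingle s \<one>\<^bsub>G\<^esub> \<otimes>\<^bsub>Q.C\<^esub> c"
  "rsmult (crossed_bimodule S G act H \<beta> f) c r = c \<otimes>\<^bsub>Q.C\<^esub> cmap r"
  by (simp_all add: crossed_bimodule_def)

text \<open>With \<open>m\<close> fixed, the comparison map becomes a map on the crossed product
  alone. The existential form prepares the choice of one such map for every
  \<open>m\<close>.\<close>

lemma exists_component:
  assumes m: "m \<in> carrier M"
  shows "\<exists>h. h \<in> hom (add_monoid Q.C) (add_monoid co.Q) \<and>
    (\<forall>s\<in>carrier S. \<forall>g\<in>carrier G. h (Q.csingle s g) = co.cls (V.pure s (gact g m)))"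
proof -
  obtain h where "h \<in> hom (add_monoid Q.C) (add_monoid co.Q)"
    "\<And>s g. \<lbrakk>s \<in> carrier S; g \<in> carrier G\<rbrakk> \<Longrightarrow> h (Q.csingle s g) = co.cls (V.pure s (gact g m))"
  proof (rule Q.crossed_lift[OF co.comm_group_Q, of "\<lambda>s g. co.cls (V.pure s (gact g m))"])
    fix s g n assume "s \<in> carrier S" "g \<in> carrier G" "n \<in> H"
    then show "co.cls (V.pure (s \<otimes>\<^bsub>S\<^esub> inv\<^bsub>S\<^esub> \<beta> n) (gact (n \<otimes>\<^bsub>G\<^esub> g) m)) = co.cls (V.pure s (gact g m))"
      using m by (simp add: gact_mult Q.N_carrier cls_pure_star gact_closed)
  qed (use m in \<open>simp_all add: cls_pure_closed cls_pure_add_left gact_closed\<close>)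
  then show ?thesis by blast
qed

lemma exists_forward:
  obtains \<Phi> where "\<Phi> \<in> hom (add_monoid ind.T) (add_monoid co.Q)"
    "\<And>s g m. \<lbrakk>s \<in> carrier S; g \<in> carrier G; m \<in> carrier M\<rbrakk> \<Longrightarrow>
      \<Phi> (ind.pure (Q.csingle s g) m) = co.cls (V.pure s (gact g m))"
proof -
  have "\<forall>m. \<exists>h. m \<in> carrier M \<longrightarrow> h \<in> hom (add_monoid Q.C) (add_monoid co.Q) \<and>
      (\<forall>s\<in>carrier S. \<forall>g\<in>carrier G. h (Q.csingle s g) = co.cls (V.pure s (gact g m)))"
    using exists_component by blast
  then obtain \<theta> where \<theta>_spec: "\<forall>m. m \<in> carrier M \<longrightarrow> \<theta> m \<in> hom (add_monoid Q.C) (add_monoid co.Q) \<and>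
      (\<forall>s\<in>carrier S. \<forall>g\<in>carrier G. \<theta> m (Q.csingle s g) = co.cls (V.pure s (gact g m)))"
    by (rule choice[THEN exE])
  have \<theta>: "\<theta> m \<in> hom (add_monoid Q.C) (add_monoid co.Q)" if "m \<in> carrier M" for m
    using \<theta>_spec that by blast
  have \<theta>_single: "\<theta> m (Q.csingle s g) = co.cls (V.pure s (gact g m))"
    if "m \<in> carrier M" "s \<in> carrier S" "g \<in> carrier G" for m s g
    using \<theta>_spec that by blast
  have \<theta>_closed: "\<theta> m c \<in> carrier co.Q" if "m \<in> carrier M" "c \<in> carrier Q.C" for m c
    using hom_in_carrier[OF \<theta>[OF that(1)]] that(2) by simp
  have \<theta>_add: "\<theta> m (c \<oplus>\<^bsub>Q.C\<^esub> d) = \<theta> m c \<oplus>\<^bsub>co.Q\<^esub> \<theta> m d" if "m \<in> carrier M" "c \<in> carrier Q.C" "d \<in> carrier Q.C" for m c d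
    using hom_mult[OF \<theta>[OF that(1)], of c d] that by simp
  \<comment> \<open>The maps \<open>\<theta> m\<close> were chosen independently, so additivity in
    \<open>m\<close> has to be proved; it holds because their values on monomials leave no
    freedom.\<close>
  have sum: "\<theta> (m \<oplus>\<^bsub>M\<^esub> n) c = \<theta> m c \<oplus>\<^bsub>co.Q\<^esub> \<theta> n c"
    if m: "m \<in> carrier M" and n: "n \<in> carrier M" and c: "c \<in> carrier Q.C" for m n c
  proof (rule Q.C_hom_eqI[OF co.Q.a_group _ _ _ c, of "\<theta> (m \<oplus>\<^bsub>M\<^esub> n)" "\<lambda>c. \<theta> m c \<oplus>\<^bsub>co.Q\<^esub> \<theta> n c"])
    show "\<theta> (m \<oplus>\<^bsub>M\<^esub> n) \<in> hom (add_monoid Q.C) (add_monoid co.Q)"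
      by (rule \<theta>) (use m n in simp)
    show "(\<lambda>c. \<theta> m c \<oplus>\<^bsub>co.Q\<^esub> \<theta> n c) \<in> hom (add_monoid Q.C) (add_monoid co.Q)"
      using \<theta>_closed m n by (auto simp: hom_def \<theta>_add co.Q.a_ac)
    fix s g assume "s \<in> carrier S" "g \<in> carrier G"
    then show "\<theta> (m \<oplus>\<^bsub>M\<^esub> n) (Q.csingle s g) = \<theta> m (Q.csingle s g) \<oplus>\<^bsub>co.Q\<^esub> \<theta> n (Q.csingle s g)"
      using m n by (simp add: \<theta>_single M.lm_smult_r_distr P.csingle_closed cls_pure_add_right gact_closed)
  qed
  \<comment> \<open>Balance over the whole crossed product of \<open>S'\<close>: both
    \<open>c\<close> and \<open>r\<close> are reduced to monomials, one after the other.\<close>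
  have bal: "\<theta> m (c \<otimes>\<^bsub>Q.C\<^esub> cmap r) = \<theta> (r \<odot>\<^bsub>M\<^esub> m) c"
    if c: "c \<in> carrier Q.C" and r: "r \<in> carrier P.C" and m: "m \<in> carrier M" for c r m
  proof (rule Q.C_hom_eqI[OF co.Q.a_group _ _ _ c, of "\<lambda>c. \<theta> m (c \<otimes>\<^bsub>Q.C\<^esub> cmap r)" "\<theta> (r \<odot>\<^bsub>M\<^esub> m)"])
    have cr: "cmap r \<in> carrier Q.C" using ring_hom_closed[OF cmap_ring_hom r] .
    show "(\<lambda>c. \<theta> m (c \<otimes>\<^bsub>Q.C\<^esub> cmap r)) \<in> hom (add_monoid Q.C) (add_monoid co.Q)"
      using \<theta>_closed[OF m] \<theta>_add[OF m] cr by (auto simp: hom_def Q.C.l_distr)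
    show "\<theta> (r \<odot>\<^bsub>M\<^esub> m) \<in> hom (add_monoid Q.C) (add_monoid co.Q)"
      by (rule \<theta>) (use r m M.lm_smult_closed in simp)
    fix s g assume s: "s \<in> carrier S" and g: "g \<in> carrier G"
    note sg = Q.csingle_closed[OF s, of g]
    note cc = ring_hom_closed[OF cmap_ring_hom] and ca = ring_hom_add[OF cmap_ring_hom]
    show "\<theta> m (Q.csingle s g \<otimes>\<^bsub>Q.C\<^esub> cmap r) = \<theta> (r \<odot>\<^bsub>M\<^esub> m) (Q.csingle s g)"
    proof (rule hom_eq_on_generate[OF P.C.a_group co.Q.a_group,
          of "\<lambda>r. \<theta> m (Q.csingle s g \<otimes>\<^bsub>Q.C\<^esub> cmap r)" "\<lambda>r. \<theta> (r \<odot>\<^bsub>M\<^esub> m) (Q.csingle s g)"])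
      show "(\<lambda>r. \<theta> m (Q.csingle s g \<otimes>\<^bsub>Q.C\<^esub> cmap r)) \<in> hom (add_monoid P.C) (add_monoid co.Q)"
        using \<theta>_closed[OF m] \<theta>_add[OF m] sg by (auto simp: hom_def cc ca Q.C.r_distr)
      show "(\<lambda>r. \<theta> (r \<odot>\<^bsub>M\<^esub> m) (Q.csingle s g)) \<in> hom (add_monoid P.C) (add_monoid co.Q)"
        using \<theta>_closed sg m by (auto simp: hom_def M.lm_smult_closed M.lm_smult_l_distr sum)
      show "r \<in> generate (add_monoid P.C) {P.csingle s g | s g. s \<in> carrier S' \<and> g \<in> carrier G}"
        using r P.C_generated by simp
      show "{P.csingle s g | s g. s \<in> carrier S' \<and> g \<in> carrier G} \<subseteq> carrier (add_monoid P.C)"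
        using P.csingle_closed by auto
      fix x assume "x \<in> {P.csingle s g | s g. s \<in> carrier S' \<and> g \<in> carrier G}"
      then obtain t h where x: "x = P.csingle t h" and t: "t \<in> carrier S'" and h: "h \<in> carrier G" by blast
      \<comment> \<open>The product of \<open>sg\<close> with \<open>f(t)h\<close> is
        \<open>s f(g \<cdot> t) gh\<close>, where equivariance has moved the action inside
        \<open>f\<close>.\<close>
      have "\<theta> m (Q.csingle s g \<otimes>\<^bsub>Q.C\<^esub> cmap x) = co.cls (V.pure (s \<otimes>\<^bsub>S\<^esub> f (act' g t)) (gact (g \<otimes>\<^bsub>G\<^esub> h) m))"
        using s g t h m
        by (simp add: x cmap_csingle Q.csingle_mult f_simps f_equivariant \<theta>_single Q.act_closed)
      \<comment> \<open>The scalar \<open>g \<cdot> t\<close> of \<open>S'\<close> crosses the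
        tensor sign, and \<open>(g \<cdot> t) gh\<close> is the product of \<open>1g\<close> and
        \<open>th\<close>.\<close>
      also have "\<dots> = co.cls (V.pure s (gact g (x \<odot>\<^bsub>M\<^esub> m)))"
        using s g t h m
        by (simp add: x cls_pure_balanced P.act_closed gact_closed csingle_smult_smult P.act_ring_hom_simps)
      also have "\<dots> = \<theta> (x \<odot>\<^bsub>M\<^esub> m) (Q.csingle s g)"
        using s g t h m by (simp add: x \<theta>_single csingle_smult_closed)
      finally show "\<theta> m (Q.csingle s g \<otimes>\<^bsub>Q.C\<^esub> cmap x) = \<theta> (x \<odot>\<^bsub>M\<^esub> m) (Q.csingle s g)" .
    qed
  qed
  obtain \<Phi> where "\<Phi> \<in> hom (add_monoid ind.T) (add_monoid co.Q)"
    "\<And>c m. \<lbrakk>c \<in> carrier (crossed_bimodule S G act H \<beta> f); m \<in> carrier M\<rbrakk> \<Longrightarrow> \<Phi> (ind.pure c m) = \<theta> m c"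
    by (rule ind.tensor_lift[OF co.comm_group_Q, of "\<lambda>c m. \<theta> m c"])
      (simp_all add: \<theta>_closed \<theta>_add sum bal)
  then show ?thesis
    using that[of \<Phi>] by (simp add: Q.csingle_closed \<theta>_single)
qed

lemma exists_backward:
  obtains \<Psi> where "\<Psi> \<in> hom (add_monoid co.Q) (add_monoid ind.T)"
    "\<And>s m. \<lbrakk>s \<in> carrier S; m \<in> carrier M\<rbrakk> \<Longrightarrow> \<Psi> (co.cls (V.pure s m)) = ind.pure (Q.csingle s \<one>\<^bsub>G\<^esub>) m"
proof -
  obtain h where h: "h \<in> hom (add_monoid V.T) (add_monoid ind.T)"
    and hp: "\<And>s m. \<lbrakk>s \<in> carrier (bimodule_via (\<lambda>s. s) S f); m \<in> carrier (restrict_scalars (\<lambda>s. P.csingle s \<one>\<^bsub>G\<^esub>) M)\<rbrakk> \<Longrightarrow>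
      h (V.pure s m) = ind.pure (Q.csingle s \<one>\<^bsub>G\<^esub>) m"
  proof (rule V.tensor_lift[OF ind.T.a_comm_group, of "\<lambda>s m. ind.pure (Q.csingle s \<one>\<^bsub>G\<^esub>) m"])
    fix s r m assume "s \<in> carrier (bimodule_via (\<lambda>s. s) S f)" "r \<in> carrier S'"
      "m \<in> carrier (restrict_scalars (\<lambda>s. P.csingle s \<one>\<^bsub>G\<^esub>) M)"
    then show "ind.pure (Q.csingle (rsmult (bimodule_via (\<lambda>s. s) S f) s r) \<one>\<^bsub>G\<^esub>) m =
        ind.pure (Q.csingle s \<one>\<^bsub>G\<^esub>) (r \<odot>\<^bsub>restrict_scalars (\<lambda>s. P.csingle s \<one>\<^bsub>G\<^esub>) M\<^esub> m)"
      using ind.pure_balanced[of "Q.csingle s \<one>\<^bsub>G\<^esub>" "P.csingle r \<one>\<^bsub>G\<^esub>" m]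
      by (simp add: Q.csingle_closed P.csingle_closed cmap_csingle f_simps Q.scalar_mult_csingle)
  next
    fix s t m assume "s \<in> carrier (bimodule_via (\<lambda>s. s) S f)" "t \<in> carrier (bimodule_via (\<lambda>s. s) S f)"
      "m \<in> carrier (restrict_scalars (\<lambda>s. P.csingle s \<one>\<^bsub>G\<^esub>) M)"
    then show "ind.pure (Q.csingle (s \<oplus>\<^bsub>bimodule_via (\<lambda>s. s) S f\<^esub> t) \<one>\<^bsub>G\<^esub>) m =
      ind.pure (Q.csingle s \<one>\<^bsub>G\<^esub>) m \<otimes>\<^bsub>add_monoid ind.T\<^esub> ind.pure (Q.csingle t \<one>\<^bsub>G\<^esub>) m"
      using ind.pure_add_left[of "Q.csingle s \<one>\<^bsub>G\<^esub>" "Q.csingle t \<one>\<^bsub>G\<^esub>" m]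
      by (simp add: Q.csingle_add Q.csingle_closed)
  qed (simp_all add: ind.pure_closed ind.pure_add_right Q.csingle_closed)
  have h_star: "h (star k v) = h v" if k: "k \<in> H" and v: "v \<in> carrier V.T" for k v
  proof (rule V.tensor_hom_eqI'[OF ind.T.a_group _ h _ v, of "\<lambda>v. h (star k v)"])
    show "(\<lambda>v. h (star k v)) \<in> hom (add_monoid V.T) (add_monoid ind.T)"
      using hom_compose[OF star_hom[OF k] h] by (simp only: comp_def)
    fix s m assume "s \<in> carrier (bimodule_via (\<lambda>s. s) S f)"
      "m \<in> carrier (restrict_scalars (\<lambda>s. P.csingle s \<one>\<^bsub>G\<^esub>) M)"
    then have s: "s \<in> carrier S" and m: "m \<in> carrier M" by auto
    note b = Q.beta_inv_closed[OF k]
    have "h (star k (V.pure s m)) = ind.pure (Q.csingle (s \<otimes>\<^bsub>S\<^esub> inv\<^bsub>S\<^esub> \<beta> k) \<one>\<^bsub>G\<^esub>) (gact k m)"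
      using s m k b by (simp add: star_pure hp gact_closed)
    \<comment> \<open>The action of \<open>k\<close> on \<open>m\<close> is multiplication by the
      class of \<open>1k\<close>, whose image under \<open>cmap\<close> is again the class of
      \<open>1k\<close>; balance over the larger ring moves it to the left factor.\<close>
    also have "\<dots> = ind.pure (Q.csingle (s \<otimes>\<^bsub>S\<^esub> inv\<^bsub>S\<^esub> \<beta> k) \<one>\<^bsub>G\<^esub> \<otimes>\<^bsub>Q.C\<^esub> Q.csingle \<one>\<^bsub>S\<^esub> k) m"
      using ind.pure_balanced[of "Q.csingle (s \<otimes>\<^bsub>S\<^esub> inv\<^bsub>S\<^esub> \<beta> k) \<one>\<^bsub>G\<^esub>" "P.csingle \<one>\<^bsub>S'\<^esub> k" m] s m b
      by (simp add: Q.csingle_closed P.csingle_closed cmap_csingle f_simps)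
    \<comment> \<open>The product is regrouped so that the inverse of \<open>\<beta> k\<close> and
      \<open>k\<close> form one monomial, which is the unit of the crossed product.\<close>
    also have "Q.csingle (s \<otimes>\<^bsub>S\<^esub> inv\<^bsub>S\<^esub> \<beta> k) \<one>\<^bsub>G\<^esub> \<otimes>\<^bsub>Q.C\<^esub> Q.csingle \<one>\<^bsub>S\<^esub> k =
        Q.csingle s \<one>\<^bsub>G\<^esub> \<otimes>\<^bsub>Q.C\<^esub> Q.csingle (inv\<^bsub>S\<^esub> \<beta> k) k"
      using s b k by (simp add: Q.scalar_mult_csingle Q.N_carrier)
    also have "\<dots> = Q.csingle s \<one>\<^bsub>G\<^esub>"
      using s k by (simp add: Q.csingle_beta Q.csingle_closed)
    finally show "h (star k (V.pure s m)) = h (V.pure s m)"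
      using s m by (simp add: hp)
  qed
  have "h ` coker \<subseteq> {\<one>\<^bsub>add_monoid ind.T\<^esub>}"
    unfolding coinvariants_kernel_def
  proof (rule hom_generate_subset[OF V.T.a_group ind.T.a_group h coker_gens group.triv_subgroup[OF ind.T.a_group]])
    fix x assume "x \<in> {star h v \<ominus>\<^bsub>V.T\<^esub> v | h v. h \<in> H \<and> v \<in> carrier V.T}"
    then obtain k v where x: "x = star k v \<ominus>\<^bsub>V.T\<^esub> v" and k: "k \<in> H" and v: "v \<in> carrier V.T" by blast
    have "h v \<in> carrier (add_monoid ind.T)" using hom_in_carrier[OF h] v by simp
    then show "h x \<in> {\<one>\<^bsub>add_monoid ind.T\<^esub>}"
      unfolding x hom_a_minus[OF V.T.abelian_group_axioms ind.T.a_group h star_closed[OF k v] v] h_star[OF k v]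
      using group.r_inv[OF ind.T.a_group] by blast
  qed
  then have ker: "h x = \<one>\<^bsub>add_monoid ind.T\<^esub>" if "x \<in> coker" for x
    using that by blast
  obtain \<Psi> where \<Psi>: "\<Psi> \<in> hom (add_monoid V.T Mod coker) (add_monoid ind.T)"
    and \<Psi>_cls: "\<And>v. v \<in> carrier (add_monoid V.T) \<Longrightarrow> \<Psi> (co.cls v) = h v"
    by (rule quot_factor[OF co.normal_K ind.T.a_group h ker], assumption, (rule that; simp))
  show ?thesis
  proof (rule that)
    show "\<Psi> \<in> hom (add_monoid co.Q) (add_monoid ind.T)"
      unfolding hom_quot_module by (rule \<Psi>)
    show "\<Psi> (co.cls (V.pure s m)) = ind.pure (Q.csingle s \<one>\<^bsub>G\<^esub>) m"
      if "s \<in> carrier S" "m \<in> carrier M" for s m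
      using \<Psi>_cls[of "V.pure s m"] V.pure_closed[of s m] hp[of s m] that by simp
  qed
qed

lemma ind_hom_eqI:
  assumes "group D" "h \<in> hom (add_monoid ind.T) D" "k \<in> hom (add_monoid ind.T) D"
    and "\<And>s g m. \<lbrakk>s \<in> carrier S; g \<in> carrier G; m \<in> carrier M\<rbrakk> \<Longrightarrow>
      h (ind.pure (Q.csingle s g) m) = k (ind.pure (Q.csingle s g) m)"
    and "x \<in> carrier ind.T"
  shows "h x = k x"
proof (rule ind.tensor_hom_eqI[OF assms(1-3) _ _ _ assms(5)])
  \<comment> \<open>The bimodule and the crossed product are different records with the same
    additive fields.\<close>
  have "generate (add_monoid (crossed_bimodule S G act H \<beta> f)) E = generate (add_monoid Q.C) E" for E
    by (rule generate_cong) (simp_all add: crossed_bimodule_def)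
  then show "carrier (crossed_bimodule S G act H \<beta> f) = generate (add_monoid (crossed_bimodule S G act H \<beta> f))
      {Q.csingle s g | s g. s \<in> carrier S \<and> g \<in> carrier G}"
    using Q.C_generated by simp
  show "{Q.csingle s g | s g. s \<in> carrier S \<and> g \<in> carrier G} \<subseteq> carrier (crossed_bimodule S G act H \<beta> f)"
    using Q.csingle_closed by auto
qed (use assms(4) in auto)

text \<open>Linearity holds because scalars multiply the coefficient of a monomial and the left
  factor of a pure tensor alike. The formula for \<open>\<Phi>\<close> is exported together with the
  isomorphism since naturality rests on it.\<close>

lemma exists_iso:
  obtains \<Phi> where "\<Phi> \<in> left_module_iso S ind.T co.Q"
    "\<And>s g m. \<lbrakk>s \<in> carrier S; g \<in> carrier G; m \<in> carrier M\<rbrakk> \<Longrightarrow>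
      \<Phi> (ind.pure (Q.csingle s g) m) = co.cls (V.pure s (gact g m))"
proof -
  obtain \<Phi> where \<Phi>: "\<Phi> \<in> hom (add_monoid ind.T) (add_monoid co.Q)"
    and \<Phi>_pure: "\<And>s g m. \<lbrakk>s \<in> carrier S; g \<in> carrier G; m \<in> carrier M\<rbrakk> \<Longrightarrow>
      \<Phi> (ind.pure (Q.csingle s g) m) = co.cls (V.pure s (gact g m))"
    using exists_forward by blast
  obtain \<Psi> where \<Psi>: "\<Psi> \<in> hom (add_monoid co.Q) (add_monoid ind.T)"
    and \<Psi>_cls: "\<And>s m. \<lbrakk>s \<in> carrier S; m \<in> carrier M\<rbrakk> \<Longrightarrow> \<Psi> (co.cls (V.pure s m)) = ind.pure (Q.csingle s \<one>\<^bsub>G\<^esub>) m"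
    using exists_backward by blast
  have \<Psi>\<Phi>: "\<Psi> (\<Phi> x) = x" if x: "x \<in> carrier ind.T" for x
  proof (rule ind_hom_eqI[OF ind.T.a_group _ _ _ x, of "\<lambda>x. \<Psi> (\<Phi> x)" "\<lambda>x. x"])
    show "(\<lambda>x. \<Psi> (\<Phi> x)) \<in> hom (add_monoid ind.T) (add_monoid ind.T)"
      using hom_compose[OF \<Phi> \<Psi>] by (simp only: comp_def)
    show "(\<lambda>x. x) \<in> hom (add_monoid ind.T) (add_monoid ind.T)" by (auto simp: hom_def)
    fix s g m assume s: "s \<in> carrier S" and g: "g \<in> carrier G" and m: "m \<in> carrier M"
    \<comment> \<open>The monomial \<open>sg\<close> is \<open>s1\<close> times the image of
      \<open>1g\<close>, so \<open>g\<close> may cross the tensor sign. Thus every monomial tensor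
      already has the form that the backward map produces.\<close>
    have "ind.pure (Q.csingle s \<one>\<^bsub>G\<^esub>) (gact g m) = ind.pure (Q.csingle s g) m"
      using ind.pure_balanced[of "Q.csingle s \<one>\<^bsub>G\<^esub>" "P.csingle \<one>\<^bsub>S'\<^esub> g" m] s g m
      by (simp add: Q.csingle_closed P.csingle_closed cmap_csingle f_simps Q.scalar_mult_csingle)
    then show "\<Psi> (\<Phi> (ind.pure (Q.csingle s g) m)) = ind.pure (Q.csingle s g) m"
      using s g m by (simp add: \<Phi>_pure \<Psi>_cls gact_closed)
  qed
  have \<Phi>\<Psi>: "\<Phi> (\<Psi> (co.cls v)) = co.cls v" if v: "v \<in> carrier V.T" for v
  proof (rule V.tensor_hom_eqI'[OF co.Q.a_group _ co.cls_hom _ v, of "\<lambda>v. \<Phi> (\<Psi> (co.cls v))"])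
    show "(\<lambda>v. \<Phi> (\<Psi> (co.cls v))) \<in> hom (add_monoid V.T) (add_monoid co.Q)"
      using hom_compose[OF hom_compose[OF co.cls_hom \<Psi>] \<Phi>] by (simp only: comp_def)
  \<comment> \<open>The round trip passes through the monomial at the unit of \<open>G\<close>,
    which acts trivially on \<open>m\<close>.\<close>
  qed (simp add: \<Psi>_cls \<Phi>_pure gact_one)
  have "bij_betw \<Phi> (carrier ind.T) (carrier co.Q)"
  proof (rule bij_betw_byWitness[of _ \<Psi>])
    show "\<forall>C\<in>carrier co.Q. \<Phi> (\<Psi> C) = C" using \<Phi>\<Psi> co.carrierE by metis
    show "\<Phi> ` carrier ind.T \<subseteq> carrier co.Q" using hom_in_carrier[OF \<Phi>] by auto
    show "\<Psi> ` carrier co.Q \<subseteq> carrier ind.T" using hom_in_carrier[OF \<Psi>] by auto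
  qed (use \<Psi>\<Phi> in blast)
  moreover have "\<Phi> (s \<odot>\<^bsub>ind.T\<^esub> x) = s \<odot>\<^bsub>co.Q\<^esub> \<Phi> x" if s: "s \<in> carrier S" and x: "x \<in> carrier ind.T" for s x
  proof (rule ind_hom_eqI[OF co.Q.a_group _ _ _ x, of "\<lambda>x. \<Phi> (s \<odot>\<^bsub>ind.T\<^esub> x)"])
    show "(\<lambda>x. \<Phi> (s \<odot>\<^bsub>ind.T\<^esub> x)) \<in> hom (add_monoid ind.T) (add_monoid co.Q)"
      using hom_compose[OF ind.smult_hom[OF s] \<Phi>] by (simp only: comp_def)
    show "(\<lambda>x. s \<odot>\<^bsub>co.Q\<^esub> \<Phi> x) \<in> hom (add_monoid ind.T) (add_monoid co.Q)"
      using hom_compose[OF \<Phi> left_module_smult_hom[OF co.left_module_quot s]] by (simp only: comp_def)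
    fix t g m assume "t \<in> carrier S" "g \<in> carrier G" "m \<in> carrier M"
    then show "\<Phi> (s \<odot>\<^bsub>ind.T\<^esub> ind.pure (Q.csingle t g) m) = s \<odot>\<^bsub>co.Q\<^esub> \<Phi> (ind.pure (Q.csingle t g) m)"
      using s V.pure_closed[of t "gact g m"]
      by (simp add: ind.smult_pure Q.csingle_closed Q.scalar_mult_csingle \<Phi>_pure co.smult_cls V.smult_pure gact_closed)
  qed
  ultimately have "\<Phi> \<in> left_module_iso S ind.T co.Q"
    using \<Phi> by (auto simp: left_module_iso_def left_module_hom_def hom_def)
  then show ?thesis using that \<Phi>_pure by blast
qed

end

section \<open>Naturality in the module\<close>

context crossed_hom
begin

lemma crossed_moduleI: "left_module P.C M \<Longrightarrow> crossed_module S' act' H' \<beta>' G S act H \<beta> f M"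
  by (intro crossed_module.intro crossed_module_axioms.intro crossed_hom_axioms)

text \<open>A predicate rather than a function, because the isomorphism is only known to exist; its
  values on monomials fix it on the carrier. It lives outside \<open>crossed_module\<close> so that
  two modules can be treated at once.\<close>

definition comparison :: "(('g \<Rightarrow> 't) set, 'm) module \<Rightarrow>
    (((('g \<Rightarrow> 's) set \<times> 'm) \<Rightarrow>\<^sub>0 int) set \<Rightarrow> (('s \<times> 'm) \<Rightarrow>\<^sub>0 int) set set) \<Rightarrow> bool" where
  "comparison M \<Phi> \<longleftrightarrow>
    \<Phi> \<in> left_module_iso S (crossed_induced G S' act' H' \<beta>' S act H \<beta> f M)
      (secret_coinvariants G S' act' H' \<beta>' S H \<beta> f M) \<and>
    (\<forall>s\<in>carrier S. \<forall>g\<in>carrier G. \<forall>m\<in>carrier M.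
      \<Phi> (pure_tensor P.C (crossed_bimodule S G act H \<beta> f) M (Q.csingle s g) m) =
      coinvariants_kernel (base_change G S' act' H' \<beta>' S f M) H (secret_action G S' act' H' \<beta>' S \<beta> f M)
        #>\<^bsub>add_monoid (base_change G S' act' H' \<beta>' S f M)\<^esub>
        pure_tensor S' (bimodule_via (\<lambda>s. s) S f) (restrict_scalars (\<lambda>s. P.csingle s \<one>\<^bsub>G\<^esub>) M) s
          (P.csingle \<one>\<^bsub>S'\<^esub> g \<odot>\<^bsub>M\<^esub> m))"

lemma exists_comparison:
  assumes "left_module P.C M"
  shows "\<exists>\<Phi>. comparison M \<Phi>"
proof -
  interpret M: crossed_module S' act' H' \<beta>' G S act H \<beta> f M by (rule crossed_moduleI[OF assms])
  show ?thesis
    unfolding comparison_def M.ind_eq M.co_eq M.V_eq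
    by (rule M.exists_iso) (intro exI conjI ballI; assumption?; blast)
qed

lemma left_module_induced_coinvariants:
  assumes "left_module P.C M"
  shows "left_module S (crossed_induced G S' act' H' \<beta>' S act H \<beta> f M)"
    and "left_module S (secret_coinvariants G S' act' H' \<beta>' S H \<beta> f M)"
proof -
  interpret M: crossed_module S' act' H' \<beta>' G S act H \<beta> f M by (rule crossed_moduleI[OF assms])
  show "left_module S (crossed_induced G S' act' H' \<beta>' S act H \<beta> f M)"
    unfolding M.ind_eq by (rule M.ind.left_module_tensor)
  show "left_module S (secret_coinvariants G S' act' H' \<beta>' S H \<beta> f M)"
    unfolding M.co_eq by (rule M.co.left_module_quot)
qed

text \<open>Any two maps satisfying \<open>comparison\<close> will do: both composites are additive
  on the induced module and send \<open>sg \<otimes> m\<close> to the class of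
  \<open>s \<otimes> g \<cdot> \<phi>(m)\<close>, as \<open>\<phi>\<close> commutes with the action
  of \<open>g\<close>.\<close>

lemma comparison_natural:
  assumes M: "left_module P.C M" and N: "left_module P.C N" and \<phi>: "\<phi> \<in> left_module_hom P.C M N"
    and \<Phi>M: "comparison M \<Phi>M" and \<Phi>N: "comparison N \<Phi>N"
    and x: "x \<in> carrier (crossed_induced G S' act' H' \<beta>' S act H \<beta> f M)"
  shows "\<Phi>N (crossed_induced_map G S' act' H' \<beta>' S act H \<beta> f N \<phi> x) =
    secret_coinvariants_map G S' act' H' \<beta>' S H \<beta> f N \<phi> (\<Phi>M x)"
proof -
  interpret M: crossed_module S' act' H' \<beta>' G S act H \<beta> f M by (rule crossed_moduleI[OF M])
  interpret N: crossed_module S' act' H' \<beta>' G S act H \<beta> f N by (rule crossed_moduleI[OF N])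
  let ?ind = "crossed_induced_map G S' act' H' \<beta>' S act H \<beta> f N \<phi>"
  let ?base = "base_change_map G S' act' H' \<beta>' S f N (\<lambda>s. s) \<phi>"
  let ?co = "secret_coinvariants_map G S' act' H' \<beta>' S H \<beta> f N \<phi>"
  note \<phi>_hom = left_module_homD[OF \<phi>]
  have \<phi>_closed: "\<phi> m \<in> carrier N" if "m \<in> carrier M" for m
    using hom_in_carrier[OF \<phi>_hom(1)] that by simp
  interpret ind: tensor_map_pair P.C "crossed_bimodule S G act H \<beta> f" M
    P.C "crossed_bimodule S G act H \<beta> f" N "\<lambda>c. c" \<phi>
  proof
    show "(\<lambda>c. c) \<in> hom (add_monoid (crossed_bimodule S G act H \<beta> f)) (add_monoid (crossed_bimodule S G act H \<beta> f))"
      by (simp add: hom_def)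
    show "\<phi> \<in> hom (add_monoid M) (add_monoid N)" by (rule \<phi>_hom(1))
    fix a r b assume *: "a \<in> carrier (crossed_bimodule S G act H \<beta> f)" "r \<in> carrier P.C" "b \<in> carrier M"
    show "N.ind.pure (rsmult (crossed_bimodule S G act H \<beta> f) a r) (\<phi> b) = N.ind.pure a (\<phi> (r \<odot>\<^bsub>M\<^esub> b))"
      unfolding \<phi>_hom(2)[OF *(2,3)] by (rule N.ind.pure_balanced[OF *(1,2) \<phi>_closed[OF *(3)]])
  qed
  interpret base: tensor_map_pair S' "bimodule_via (\<lambda>s. s) S f" "restrict_scalars (\<lambda>s. P.csingle s \<one>\<^bsub>G\<^esub>) M"
    S' "bimodule_via (\<lambda>s. s) S f" "restrict_scalars (\<lambda>s. P.csingle s \<one>\<^bsub>G\<^esub>) N" "\<lambda>s. s" \<phi>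
  proof
    show "(\<lambda>s. s) \<in> hom (add_monoid (bimodule_via (\<lambda>s. s) S f)) (add_monoid (bimodule_via (\<lambda>s. s) S f))"
      by (simp add: hom_def)
    show "\<phi> \<in> hom (add_monoid (restrict_scalars (\<lambda>s. P.csingle s \<one>\<^bsub>G\<^esub>) M))
        (add_monoid (restrict_scalars (\<lambda>s. P.csingle s \<one>\<^bsub>G\<^esub>) N))"
      unfolding hom_restrict_scalars by (rule \<phi>_hom(1))
    fix a r b assume "a \<in> carrier (bimodule_via (\<lambda>s. s) S f)" "r \<in> carrier S'"
      "b \<in> carrier (restrict_scalars (\<lambda>s. P.csingle s \<one>\<^bsub>G\<^esub>) M)"
    then show "N.V.pure (rsmult (bimodule_via (\<lambda>s. s) S f) a r) (\<phi> b) =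
        N.V.pure a (\<phi> (r \<odot>\<^bsub>restrict_scalars (\<lambda>s. P.csingle s \<one>\<^bsub>G\<^esub>) M\<^esub> b))"
      using N.V.pure_balanced[of a r "\<phi> b"] by (simp add: \<phi>_hom(2) \<phi>_closed P.csingle_closed)
  qed
  have ind_pure: "?ind (M.ind.pure c m) = N.ind.pure c (\<phi> m)" if "c \<in> carrier Q.C" "m \<in> carrier M" for c m
    using ind.tensor_map_pure[of c m] that by (simp add: crossed_induced_map_def)
  have ind_hom: "?ind \<in> hom (add_monoid M.ind.T) (add_monoid N.ind.T)"
    using ind.tensor_map_hom by (simp only: crossed_induced_map_def)
  have base_pure: "?base (M.V.pure s m) = N.V.pure s (\<phi> m)" if "s \<in> carrier S" "m \<in> carrier M" for s m
    using base.tensor_map_pure[of s m] that by (simp add: base_change_map_def)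
  have base_hom: "?base \<in> hom (add_monoid M.V.T) (add_monoid N.V.T)"
    using base.tensor_map_hom by (simp only: base_change_map_def)
  have base_closed: "?base v \<in> carrier N.V.T" if "v \<in> carrier M.V.T" for v
    using hom_in_carrier[OF base_hom] that by simp
  \<comment> \<open>The group acts through elements of the crossed product, over which
    \<open>\<phi>\<close> is linear.\<close>
  have \<phi>_gact: "\<phi> (M.gact g m) = N.gact g (\<phi> m)" if "m \<in> carrier M" for g m
    using that by (simp add: \<phi>_hom(2) P.csingle_closed)
  have base_star: "?base (M.star h v) = N.star h (?base v)" if h: "h \<in> H" and v: "v \<in> carrier M.V.T" for h v
  proof (rule M.V.tensor_hom_eqI'[OF N.V.T.a_group _ _ _ v, of "\<lambda>v. ?base (M.star h v)"])
    show "(\<lambda>v. ?base (M.star h v)) \<in> hom (add_monoid M.V.T) (add_monoid N.V.T)"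
      using hom_compose[OF M.star_hom[OF h] base_hom] by (simp only: comp_def)
    show "(\<lambda>v. N.star h (?base v)) \<in> hom (add_monoid M.V.T) (add_monoid N.V.T)"
      using hom_compose[OF base_hom N.star_hom[OF h]] by (simp only: comp_def)
    fix s m assume "s \<in> carrier (bimodule_via (\<lambda>s. s) S f)"
      "m \<in> carrier (restrict_scalars (\<lambda>s. P.csingle s \<one>\<^bsub>G\<^esub>) M)"
    then show "?base (M.star h (M.V.pure s m)) = N.star h (?base (M.V.pure s m))"
      using h Q.beta_inv_closed[OF h]
      by (simp add: M.star_pure N.star_pure base_pure M.gact_closed \<phi>_gact \<phi>_closed)
  qed
  \<comment> \<open>By \<open>base_star\<close> a difference for \<open>v\<close> goes to the
    difference for its image, so the base change of \<open>\<phi>\<close> descends to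
    coinvariants.\<close>
  have base_coker: "?base ` M.coker \<subseteq> N.coker"
    unfolding coinvariants_kernel_def[of M.V.T]
  proof (rule hom_generate_subset[OF M.V.T.a_group N.V.T.a_group base_hom M.coker_gens N.coker_subgroup])
    fix y assume "y \<in> {M.star h v \<ominus>\<^bsub>M.V.T\<^esub> v | h v. h \<in> H \<and> v \<in> carrier M.V.T}"
    then obtain h v where y: "y = M.star h v \<ominus>\<^bsub>M.V.T\<^esub> v" and h: "h \<in> H" and v: "v \<in> carrier M.V.T" by blast
    have "?base y = N.star h (?base v) \<ominus>\<^bsub>N.V.T\<^esub> ?base v"
      unfolding y base_star[OF h v, symmetric]
      using hom_a_minus[OF M.V.T.abelian_group_axioms N.V.T.a_group base_hom M.star_closed[OF h v] v]
      by (simp add: a_minus_def a_inv_def)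
    then show "?base y \<in> N.coker" using N.coker_mem[OF h base_closed[OF v]] by simp
  qed
  have co_cls: "?co (M.co.cls v) = N.co.cls (?base v)" if "v \<in> carrier M.V.T" for v
    using quot_map_r_coset[OF M.co.normal_K N.co.normal_K base_hom base_coker, of v] that
    by (simp add: secret_coinvariants_map_def N.V_eq Let_def)
  have co_hom: "?co \<in> hom (add_monoid M.co.Q) (add_monoid N.co.Q)"
    using quot_map_hom[OF M.co.normal_K N.co.normal_K base_hom base_coker]
    unfolding hom_quot_module secret_coinvariants_map_def N.V_eq Let_def .
  have \<Phi>M_hom: "\<Phi>M \<in> hom (add_monoid M.ind.T) (add_monoid M.co.Q)"
    and \<Phi>N_hom: "\<Phi>N \<in> hom (add_monoid N.ind.T) (add_monoid N.co.Q)"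
    using \<Phi>M \<Phi>N left_module_homD(1)
    unfolding comparison_def left_module_iso_def M.ind_eq N.ind_eq M.co_eq N.co_eq by blast+
  have \<Phi>M_pure: "\<Phi>M (M.ind.pure (Q.csingle s g) m) = M.co.cls (M.V.pure s (M.gact g m))"
    if "s \<in> carrier S" "g \<in> carrier G" "m \<in> carrier M" for s g m
    using \<Phi>M that unfolding comparison_def M.V_eq by blast
  have \<Phi>N_pure: "\<Phi>N (N.ind.pure (Q.csingle s g) m) = N.co.cls (N.V.pure s (N.gact g m))"
    if "s \<in> carrier S" "g \<in> carrier G" "m \<in> carrier N" for s g m
    using \<Phi>N that unfolding comparison_def N.V_eq by blast
  show ?thesis
  proof (rule M.ind_hom_eqI[OF N.co.Q.a_group _ _ _ x[unfolded M.ind_eq], of "\<lambda>x. \<Phi>N (?ind x)" "\<lambda>x. ?co (\<Phi>M x)"])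
    show "(\<lambda>x. \<Phi>N (?ind x)) \<in> hom (add_monoid M.ind.T) (add_monoid N.co.Q)"
      using hom_compose[OF ind_hom \<Phi>N_hom] by (simp only: comp_def)
    show "(\<lambda>x. ?co (\<Phi>M x)) \<in> hom (add_monoid M.ind.T) (add_monoid N.co.Q)"
      using hom_compose[OF \<Phi>M_hom co_hom] by (simp only: comp_def)
    fix s g m assume *: "s \<in> carrier S" "g \<in> carrier G" "m \<in> carrier M"
    then show "\<Phi>N (?ind (M.ind.pure (Q.csingle s g) m)) = ?co (\<Phi>M (M.ind.pure (Q.csingle s g) m))"
      using M.V.pure_closed[of s "M.gact g m"]
      by (simp add: ind_pure Q.csingle_closed \<Phi>N_pure \<Phi>M_pure \<phi>_closed co_cls M.gact_closed base_pure \<phi>_gact)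
  qed
qed

end

text \<open>The homomorphism into \<open>BijGroup\<close> is unpacked into identities at the points
  of the carrier.\<close>

lemma ring_action_equivariant_algebra:
  assumes "equivariant_algebra L G S act"
  shows "ring_action S G act"
proof -
  interpret equivariant_algebra L G S act by fact
  interpret gh: group_hom G "BijGroup (carrier S)" act by (rule group_hom)
  show ?thesis
  proof
    show "act \<one>\<^bsub>G\<^esub> s = s" if "s \<in> carrier S" for s
      \<comment> \<open>The unit of \<open>BijGroup\<close> is the identity restricted to the
        carrier, hence the evaluation at \<open>s\<close>.\<close>
      using that id_eq_one[THEN fun_cong, of s] by simp
    show "act (g \<otimes>\<^bsub>G\<^esub> h) s = act g (act h s)" if "g \<in> carrier G" "h \<in> carrier G" "s \<in> carrier S" for g h s
      using composition_rule that by blast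
  qed (rule act_ring_hom)
qed

theorem theorem5p1p8:
  fixes L :: "('l, 'lx) ring_scheme"
    and G :: "('g, 'gx) monoid_scheme"
    and S' :: "('l, 't, 'tx) module_scheme"
    and S :: "('l, 's, 'sx) module_scheme"
    and act' :: "'g \<Rightarrow> 't \<Rightarrow> 't"
    and act :: "'g \<Rightarrow> 's \<Rightarrow> 's"
    and H' H :: "'g set"
    and \<beta>' :: "'g \<Rightarrow> 't"
    and \<beta> :: "'g \<Rightarrow> 's"
    and f :: "'t \<Rightarrow> 's"
  assumes S': "equivariant_algebra L G S' act'"
    and S: "equivariant_algebra L G S act"
    and f_hom: "f \<in> ring_hom S' S"
    and f_linear: "\<And>l x. \<lbrakk>l \<in> carrier L; x \<in> carrier S'\<rbrakk> \<Longrightarrow> f (l \<odot>\<^bsub>S'\<^esub> x) = l \<odot>\<^bsub>S\<^esub> f x"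
    and f_equivariant: "\<And>g x. \<lbrakk>g \<in> carrier G; x \<in> carrier S'\<rbrakk> \<Longrightarrow> f (act' g x) = act g (f x)"
    and H': "H' \<lhd> G"
    and H: "H \<lhd> G"
    and H'_le_H: "H' \<subseteq> H"
    and \<beta>': "equivariant_trivialisation G S' act' H' \<beta>'"
    and \<beta>: "equivariant_trivialisation G S act H \<beta>"
    and f_\<beta>': "\<And>h. h \<in> H' \<Longrightarrow> f (\<beta>' h) = \<beta> h"
  shows "\<exists>\<Phi> :: (('g \<Rightarrow> 't) set, 'm) module \<Rightarrow>
           ((('g \<Rightarrow> 's) set \<times> 'm) \<Rightarrow>\<^sub>0 int) set \<Rightarrow> (('s \<times> 'm) \<Rightarrow>\<^sub>0 int) set set.
     (\<forall>M. left_module (crossed_product S' G act' H' \<beta>') M \<longrightarrow>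
        left_module S (crossed_induced G S' act' H' \<beta>' S act H \<beta> f M) \<and>
        left_module S (secret_coinvariants G S' act' H' \<beta>' S H \<beta> f M) \<and>
        \<Phi> M \<in> left_module_iso S
          (crossed_induced G S' act' H' \<beta>' S act H \<beta> f M)
          (secret_coinvariants G S' act' H' \<beta>' S H \<beta> f M)) \<and>
     (\<forall>M N \<phi>. left_module (crossed_product S' G act' H' \<beta>') M \<and>
        left_module (crossed_product S' G act' H' \<beta>') N \<and>
        \<phi> \<in> left_module_hom (crossed_product S' G act' H' \<beta>') M N \<longrightarrow>
        (\<forall>x \<in> carrier (crossed_induced G S' act' H' \<beta>' S act H \<beta> f M).
          \<Phi> N (crossed_induced_map G S' act' H' \<beta>' S act H \<beta> f N \<phi> x) =
          secret_coinvariants_map G S' act' H' \<beta>' S H \<beta> f N \<phi> (\<Phi> M x)))"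
proof -
  interpret crossed_hom S' act' H' \<beta>' G S act H \<beta> f
    by (intro crossed_hom.intro crossed.intro crossed_hom_axioms.intro
        ring_action_equivariant_algebra[OF S'] ring_action_equivariant_algebra[OF S] \<beta>' \<beta>
        f_hom f_equivariant H'_le_H f_\<beta>')
  \<comment> \<open>One \<open>\<Phi>\<close> must serve all modules at once. The premise sits
    inside the existential so that choice can range over all records, with arbitrary values at those
    that are not modules.\<close>
  have "\<forall>M :: (('g \<Rightarrow> 't) set, 'm) module. \<exists>\<Phi>. left_module P.C M \<longrightarrow> comparison M \<Phi>"
    using exists_comparison by blast
  then obtain \<Phi> :: "(('g \<Rightarrow> 't) set, 'm) module \<Rightarrow>
      ((('g \<Rightarrow> 's) set \<times> 'm) \<Rightarrow>\<^sub>0 int) set \<Rightarrow> (('s \<times> 'm) \<Rightarrow>\<^sub>0 int) set set"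
    where "\<forall>M. left_module P.C M \<longrightarrow> comparison M (\<Phi> M)"
    by (rule choice[THEN exE])
  then have \<Phi>: "comparison M (\<Phi> M)" if "left_module P.C M" for M
    using that by blast
  show ?thesis
  proof (intro exI[of _ \<Phi>] conjI allI impI ballI; (elim conjE)?)
    fix M :: "(('g \<Rightarrow> 't) set, 'm) module" assume M: "left_module P.C M"
    show "left_module S (crossed_induced G S' act' H' \<beta>' S act H \<beta> f M)"
      "left_module S (secret_coinvariants G S' act' H' \<beta>' S H \<beta> f M)"
      by (rule left_module_induced_coinvariants[OF M])+
    show "\<Phi> M \<in> left_module_iso S (crossed_induced G S' act' H' \<beta>' S act H \<beta> f M)
        (secret_coinvariants G S' act' H' \<beta>' S H \<beta> f M)"
      using \<Phi>[OF M] unfolding comparison_def by blast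
  next
    fix M N :: "(('g \<Rightarrow> 't) set, 'm) module" and \<phi> x
    assume "left_module P.C M" "left_module P.C N" "\<phi> \<in> left_module_hom P.C M N"
      and "x \<in> carrier (crossed_induced G S' act' H' \<beta>' S act H \<beta> f M)"
    then show "\<Phi> N (crossed_induced_map G S' act' H' \<beta>' S act H \<beta> f N \<phi> x) =
        secret_coinvariants_map G S' act' H' \<beta>' S H \<beta> f N \<phi> (\<Phi> M x)"
      using comparison_natural \<Phi> by blast
  qed
qed

end
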